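(* For any $\alpha\ge1$ and $\delta>0$, $L^{\alpha+\delta}_G(\Omega_T)\subset L^{\alpha}_{\mathcal{E}}(\Omega_T)$. More precisely, for any $\gamma$ with $1<\gamma<\beta:=(\alpha+\delta)/\alpha$ and $\gamma\le2$, one has $$\|\xi\|_{\alpha,\mathcal{E}}^{\alpha}\le\gamma^*\Big\{\|\xi\|^{\alpha}_{\alpha+\delta,G}+14^{1/\gamma}\,C_{\beta/\gamma}\,\|\xi\|^{(\alpha+\delta)/\gamma}_{\alpha+\delta,G}\Big\}\qquad\text{for all }\xi\in L_{ip}(\Omega_T),$$ where $C_{\beta/\gamma}=\sum_{i=1}^{\infty}i^{-\beta/\gamma}$ and $\gamma^*=\gamma/(\gamma-1)$.
   Context: Sublinear expectations. Let $\mathcal{H}$ be a linear space of real functions on a set $\Omega$ containing the constants. A sublinear expectation on $\mathcal{H}$ is a functional $\hat{E}:\mathcal{H}\to\mathbb{R}$ that is monotone, satisfies $\hat{E}(c)=c$ for constants $c$, $\hat{E}(X)-\hat{E}(Y)\le\hat{E}(X-Y)$, and $\hat{E}(\lambda X)=\lambda\hat{E}(X)$ for $\lambda\ge 0$. $C_{l,Lip}(\mathbb{R}^n)$ is the set of $\varphi:\mathbb{R}^n\to\mathbb{R}$ with $|\varphi(x)-\varphi(y)|\le C(1+|x|^k+|y|^k)|x-y|$ for some $C,k$ depending on $\varphi$. Random vectors $X_1,X_2$ (on possibly different sublinear expectation spaces, with sublinear expectations $\hat{E}_1,\hat{E}_2$) are identically distributed, $X_1\sim X_2$, if $\hat{E}_1[\varphi(X_1)]=\hat{E}_2[\varphi(X_2)]$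 for all $\varphi\in C_{l,Lip}$. $Y$ is independent to $X$ if $\hat{E}[\varphi(X,Y)]=\hat{E}[\hat{E}[\varphi(x,Y)]_{x=X}]$ for all $\varphi\in C_{l,Lip}$. A $d$-dimensional $X$ is $G$-normal distributed if $aX+b\hat{X}\sim\sqrt{a^2+b^2}\,X$ for all $a,b\in\mathbb{R}$, where $\hat{X}$ is an independent copy of $X$; here $G(A):=\frac12\hat{E}[(AX,X)]$ for $A$ in the space $S_d$ of symmetric $d\times d$ matrices. One has $G(A)=\frac12\sup_{\gamma\in\Gamma}\mathrm{Tr}(\gamma A)$ for a bounded, convex, closed set $\Gamma$ of nonnegative symmetric matrices. Standing assumption (non-degeneracy): there is $\beta_0>0$ with $G(A)-G(B)\ge\beta_0\mathrm{Tr}(A-B)$ whenever $A\ge B$. $G$-expectation. $\Omega_T=C_0([0,T];\mathbb{R}^d)$ (continuous paths starting at $0$) with the supremum norm, $B_t(\omega)=\omega_t$ is the canonical process ($G$-Brownian motion), and $$\mathcal{H}^0_T=\{\varphi(B_{t_1},\dots,B_{t_n}): n\ge1,\ t_1,\dots,t_n\in[0,T],\ \varphi\in C_{l,Lip}(\mathbb{R}^{d\times n})\};$$ $L_{ip}(\Omega_T)$ is defined in the same way with $\varphi$ bounded and Lipschitz. The $G$-expectation is the sublinear expectation on $\mathcal{H}^0_T$ given, for $0=t_0<t_1<\dots<t_m\le T$, by $$\hat{E}[\varphi(B_{t_1}-B_{t_0},\dots,B_{t_m}-B_{t_{m-1}})]=\tilde{E}[\varphi(\sqrt{t_1-t_0}\,\xi_1,\dots,\sqrt{t_m-t_{m-1}}\,\xi_m)],$$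 where $\xi_1,\dots,\xi_m$ are identically distributed $G$-normal $d$-dimensional vectors (with the given function $G$) on a sublinear expectation space with sublinear expectation $\tilde{E}$, and $\xi_{i+1}$ is independent to $(\xi_1,\dots,\xi_i)$ for each $i$. The conditional expectation is $\hat{E}_{t_i}[\varphi(B_{t_1}-B_{t_0},\dots,B_{t_m}-B_{t_{m-1}})]=\tilde\varphi(B_{t_1}-B_{t_0},\dots,B_{t_i}-B_{t_{i-1}})$ with $\tilde\varphi(x_1,\dots,x_i)=\hat{E}[\varphi(x_1,\dots,x_i,B_{t_{i+1}}-B_{t_i},\dots,B_{t_m}-B_{t_{m-1}})]$ (any time $t\in[0,T]$ may be inserted into the partition). It is known that there is a weakly compact set $\mathcal{P}$ of Borel probability measures on $\Omega_T$ with $\hat{E}(\xi)=\max_{P\in\mathcal{P}}E_P(\xi)$ on $\mathcal{H}^0_T$; $\hat{E}$ is applied to more general measurable functions by $\hat{E}(X)=\sup_{P\in\mathcal{P}}E_P(X)$. Norms. For $\xi\in\mathcal{H}^0_T$, $\mathcal{E}(\xi):=\hat{E}\big[\sup_{u\in[0,T]}\hat{E}_u(\xi)\big]$ ($G$-evaluation). For $p\ge1$, $\|\xi\|_{p,G}=[\hat{E}(|\xi|^p)]^{1/p}$ and $\|\xi\|_{p,\mathcal{E}}=[\mathcal{E}(|\xi|^p)]^{1/p}$. $L^p_G(\Omega_T)$ is the completion of $\mathcal{H}^0_T$ (equivalently of $L_{ip}(\Omega_T)$ or $C_b(\Omega_T)$) under $\|\cdot\|_{p,G}$, and $L^p_{\mathcal{E}}(\Omega_T)$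 is the completion of $\mathcal{H}^0_T$ under $\|\cdot\|_{p,\mathcal{E}}$. *)

theory Defs
  imports "HOL-Probability.Probability"
begin

section \<open>Sublinear expectations\<close>

text \<open>
  Functions on the underlying set \<open>S\<close> are total functions on the type of its elements,
  of which only the values on \<open>S\<close> matter: monotonicity is required with respect to the pointwise
  order on \<open>S\<close>, so \<open>E\<close> takes the same value on two members of \<open>H\<close> that agree on \<open>S\<close>.
\<close>

definition sublinear_expectation ::
    "'w set \<Rightarrow> ('w \<Rightarrow> real) set \<Rightarrow> (('w \<Rightarrow> real) \<Rightarrow> real) \<Rightarrow> bool" where
  "sublinear_expectation S H E \<longleftrightarrow>
     (\<forall>c. (\<lambda>_. c) \<in> H) \<and>
     (\<forall>X\<in>H. \<forall>Y\<in>H. (\<lambda>w. X w + Y w) \<in> H) \<and>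
     (\<forall>c. \<forall>X\<in>H. (\<lambda>w. c * X w) \<in> H) \<and>
     (\<forall>X\<in>H. \<forall>Y\<in>H. (\<forall>w\<in>S. X w \<le> Y w) \<longrightarrow> E X \<le> E Y) \<and>
     (\<forall>c. E (\<lambda>_. c) = c) \<and>
     (\<forall>X\<in>H. \<forall>Y\<in>H. E X - E Y \<le> E (\<lambda>w. X w - Y w)) \<and>
     (\<forall>c\<ge>0. \<forall>X\<in>H. E (\<lambda>w. c * X w) = c * E X)"

text \<open>
  A point of \<open>\<real>\<^sup>d\<^sup>\<times>\<^sup>n\<close> is encoded by the first \<open>n\<close> values of a sequence of \<open>d\<close>-dimensional vectors,
  with the Euclidean norm of these values.  A function that satisfies the (local) Lipschitz
  estimate for this seminorm depends on the first \<open>n\<close> values only.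
\<close>

definition tuple_norm :: "nat \<Rightarrow> (nat \<Rightarrow> 'a::real_normed_vector) \<Rightarrow> real" where
  "tuple_norm n x = L2_set (\<lambda>i. norm (x i)) {..<n}"

definition C_lLip :: "('a::real_normed_vector \<Rightarrow> real) set" where
  "C_lLip = {\<phi>. \<exists>(C::real) (k::nat). \<forall>x y.
     \<bar>\<phi> x - \<phi> y\<bar> \<le> C * (1 + norm x ^ k + norm y ^ k) * norm (x - y)}"

definition C_lLip_tuple :: "nat \<Rightarrow> ((nat \<Rightarrow> 'a::real_normed_vector) \<Rightarrow> real) set" where
  "C_lLip_tuple n = {\<phi>. \<exists>(C::real) (k::nat). \<forall>x y.
     \<bar>\<phi> x - \<phi> y\<bar> \<le>
       C * (1 + tuple_norm n x ^ k + tuple_norm n y ^ k) * tuple_norm n (\<lambda>i. x i - y i)}"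

definition C_bLip_tuple :: "nat \<Rightarrow> ((nat \<Rightarrow> 'a::real_normed_vector) \<Rightarrow> real) set" where
  "C_bLip_tuple n = {\<phi>. (\<exists>K. \<forall>x. \<bar>\<phi> x\<bar> \<le> K) \<and>
     (\<exists>L. \<forall>x y. \<bar>\<phi> x - \<phi> y\<bar> \<le> L * tuple_norm n (\<lambda>i. x i - y i))}"

text \<open>\<open>(X 0, \<dots>, X (n - 1))\<close> is a random vector: its test functions belong to \<open>H\<close>.\<close>

definition random_tuple ::
    "('w \<Rightarrow> real) set \<Rightarrow> nat \<Rightarrow> (nat \<Rightarrow> 'w \<Rightarrow> 'a::real_normed_vector) \<Rightarrow> bool" where
  "random_tuple H n X \<longleftrightarrow> (\<forall>\<phi>\<in>C_lLip_tuple n. (\<lambda>w. \<phi> (\<lambda>i. X i w)) \<in> H)"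

definition identically_distributed ::
    "(('v \<Rightarrow> real) \<Rightarrow> real) \<Rightarrow> ('v \<Rightarrow> 'a::real_normed_vector) \<Rightarrow>
     (('w \<Rightarrow> real) \<Rightarrow> real) \<Rightarrow> ('w \<Rightarrow> 'a) \<Rightarrow> bool" where
  "identically_distributed E1 X1 E2 X2 \<longleftrightarrow>
     (\<forall>\<phi>\<in>C_lLip. E1 (\<lambda>w. \<phi> (X1 w)) = E2 (\<lambda>w. \<phi> (X2 w)))"

text \<open>\<open>Y\<close> is independent to \<open>(X 0, \<dots>, X (n - 1))\<close>.\<close>

definition independent_to ::
    "(('w \<Rightarrow> real) \<Rightarrow> real) \<Rightarrow> nat \<Rightarrow> (nat \<Rightarrow> 'w \<Rightarrow> 'a::real_normed_vector) \<Rightarrow> ('w \<Rightarrow> 'a) \<Rightarrow> bool" where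
  "independent_to E n X Y \<longleftrightarrow>
     (\<forall>\<phi>\<in>C_lLip_tuple (Suc n).
        E (\<lambda>w. \<phi> ((\<lambda>i. X i w)(n := Y w))) =
        E (\<lambda>w. E (\<lambda>w'. \<phi> ((\<lambda>i. X i w)(n := Y w')))))"


section \<open>\<open>G\<close>-normal distributions\<close>

text \<open>
  The function \<open>G\<close> matters on symmetric matrices only.  The independent copy \<open>X'\<close> lives on the
  same sublinear expectation space as \<open>X\<close>.
\<close>

definition G_normal ::
    "(real^'d^'d \<Rightarrow> real) \<Rightarrow> ('w \<Rightarrow> real) set \<Rightarrow> (('w \<Rightarrow> real) \<Rightarrow> real) \<Rightarrow> ('w \<Rightarrow> real^'d) \<Rightarrow> bool" where
  "G_normal G H E X \<longleftrightarrow>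
     (\<exists>X'. random_tuple H 2 (\<lambda>i. if i = 0 then X else X') \<and>
        identically_distributed E X' E X \<and>
        independent_to E 1 (\<lambda>_. X) X' \<and>
        (\<forall>a b. identically_distributed
           E (\<lambda>w. a *\<^sub>R X w + b *\<^sub>R X' w) E (\<lambda>w. sqrt (a\<^sup>2 + b\<^sup>2) *\<^sub>R X w))) \<and>
     (\<forall>A. transpose A = A \<longrightarrow> G A = 1 / 2 * E (\<lambda>w. (A *v X w) \<bullet> X w))"

text \<open>The sequence \<open>\<xi>\<close> is indexed from \<open>0\<close>.\<close>

definition iid_G_normal ::
    "(real^'d^'d \<Rightarrow> real) \<Rightarrow> ('w \<Rightarrow> real) set \<Rightarrow> (('w \<Rightarrow> real) \<Rightarrow> real) \<Rightarrow>
     (nat \<Rightarrow> 'w \<Rightarrow> real^'d) \<Rightarrow> bool" where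
  "iid_G_normal G H E \<xi> \<longleftrightarrow>
     (\<forall>m. random_tuple H m \<xi>) \<and>
     (\<forall>i. G_normal G H E (\<xi> i)) \<and>
     (\<forall>i j. identically_distributed E (\<xi> i) E (\<xi> j)) \<and>
     (\<forall>i. independent_to E i \<xi> (\<xi> i))"

definition nondegenerate :: "(real^'d^'d \<Rightarrow> real) \<Rightarrow> bool" where
  "nondegenerate G \<longleftrightarrow>
     (\<exists>\<beta>\<^sub>0>0. \<forall>A B. transpose A = A \<and> transpose B = B \<and> (\<forall>x. 0 \<le> ((A - B) *v x) \<bullet> x) \<longrightarrow>
        G A - G B \<ge> \<beta>\<^sub>0 * trace (A - B))"


section \<open>Path space and \<open>G\<close>-expectation\<close>

text \<open>
  The paths in \<open>C\<^sub>0([0,T]; \<real>\<^sup>d)\<close> are extended to the real line by constants; this is an isometry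
  for the supremum norms.
\<close>

type_synonym 'd path = "(real, real^'d) bcontfun"

definition Omega :: "real \<Rightarrow> 'd::finite path set" where
  "Omega T = {\<omega>. (\<forall>t\<le>0. apply_bcontfun \<omega> t = 0) \<and>
                 (\<forall>t\<ge>T. apply_bcontfun \<omega> t = apply_bcontfun \<omega> T)}"

definition B :: "real \<Rightarrow> 'd::finite path \<Rightarrow> real^'d" where
  "B t \<omega> = apply_bcontfun \<omega> t"

definition H0 :: "real \<Rightarrow> ('d::finite path \<Rightarrow> real) set" where
  "H0 T = {X. \<exists>n\<ge>1. \<exists>t \<phi>. (\<forall>i<n. t i \<in> {0..T}) \<and> \<phi> \<in> C_lLip_tuple n \<and>
     (\<forall>\<omega>\<in>Omega T. X \<omega> = \<phi> (\<lambda>i. B (t i) \<omega>))}"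

definition L_ip :: "real \<Rightarrow> ('d::finite path \<Rightarrow> real) set" where
  "L_ip T = {X. \<exists>n\<ge>1. \<exists>t \<phi>. (\<forall>i<n. t i \<in> {0..T}) \<and> \<phi> \<in> C_bLip_tuple n \<and>
     (\<forall>\<omega>\<in>Omega T. X \<omega> = \<phi> (\<lambda>i. B (t i) \<omega>))}"

definition time_grid :: "real \<Rightarrow> nat \<Rightarrow> (nat \<Rightarrow> real) \<Rightarrow> bool" where
  "time_grid T m t \<longleftrightarrow> t 0 = 0 \<and> (\<forall>i<m. t i < t (Suc i)) \<and> t m \<le> T"

definition increment :: "(nat \<Rightarrow> real) \<Rightarrow> 'd::finite path \<Rightarrow> nat \<Rightarrow> real^'d" where
  "increment t \<omega> i = B (t (Suc i)) \<omega> - B (t i) \<omega>"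

definition G_expectation ::
    "real \<Rightarrow> (('w \<Rightarrow> real) \<Rightarrow> real) \<Rightarrow> (nat \<Rightarrow> 'w \<Rightarrow> real^'d) \<Rightarrow>
     (('d::finite path \<Rightarrow> real) \<Rightarrow> real) \<Rightarrow> bool" where
  "G_expectation T E' \<xi> E \<longleftrightarrow>
     sublinear_expectation (Omega T) (H0 T) E \<and>
     (\<forall>m t \<phi>. time_grid T m t \<and> \<phi> \<in> C_lLip_tuple m \<longrightarrow>
        E (\<lambda>\<omega>. \<phi> (increment t \<omega>)) = E' (\<lambda>w. \<phi> (\<lambda>i. sqrt (t (Suc i) - t i) *\<^sub>R \<xi> i w)))"

text \<open>
  The conditional expectation, as a function of the path \<open>\<omega>\<close>, is the value common to all
  representations of \<open>X\<close> by the increments over a time grid that contains \<open>t\<close>.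
\<close>

definition G_cond_exp ::
    "real \<Rightarrow> (('d::finite path \<Rightarrow> real) \<Rightarrow> real) \<Rightarrow> real \<Rightarrow> ('d path \<Rightarrow> real) \<Rightarrow> 'd path \<Rightarrow> real" where
  "G_cond_exp T E t X \<omega> =
     (THE r. \<exists>m s i \<phi>. time_grid T m s \<and> i \<le> m \<and> s i = t \<and> \<phi> \<in> C_lLip_tuple m \<and>
        (\<forall>\<omega>'\<in>Omega T. X \<omega>' = \<phi> (increment s \<omega>')) \<and>
        r = E (\<lambda>\<omega>'. \<phi> (\<lambda>j. if j < i then increment s \<omega> j else increment s \<omega>' j)))"


section \<open>Representation by probability measures\<close>

definition prob_measures :: "real \<Rightarrow> 'd::finite path measure set" where
  "prob_measures T = {P. prob_space P \<and> sets P = sets (restrict_space borel (Omega T))}"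

definition weak_topology :: "real \<Rightarrow> 'd::finite path measure topology" where
  "weak_topology T = topology_generated_by
     {{P \<in> prob_measures T. (\<integral>\<omega>. f \<omega> \<partial>P) \<in> U} | (f :: 'd path \<Rightarrow> real) U.
        continuous_on (Omega T) f \<and> bounded (f ` Omega T) \<and> open U}"

definition represents ::
    "real \<Rightarrow> 'd::finite path measure set \<Rightarrow> (('d path \<Rightarrow> real) \<Rightarrow> real) \<Rightarrow> bool" where
  "represents T \<P> E \<longleftrightarrow>
     \<P> \<subseteq> prob_measures T \<and> compactin (weak_topology T) \<P> \<and>
     (\<forall>X\<in>H0 T. (\<forall>P\<in>\<P>. integrable P X \<and> (\<integral>\<omega>. X \<omega> \<partial>P) \<le> E X) \<and>
                (\<exists>P\<in>\<P>. (\<integral>\<omega>. X \<omega> \<partial>P) = E X))"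

text \<open>
  The extension of the \<open>G\<close>-expectation is used below for \<open>X = sup\<^sub>u E\<^sub>u(\<xi>)\<close> with \<open>\<xi>\<close> in \<open>H0 T\<close>.
  Such \<open>X\<close> grows at most polynomially in the supremum norm of the path, hence is
  integrable, with integrals bounded uniformly in \<open>P\<close>, and the real-valued supremum is the true
  one; likewise the real supremum over \<open>u\<close> in \<open>G_evaluation\<close> is over a bounded set.
\<close>

definition upper_expectation ::
    "'d::finite path measure set \<Rightarrow> ('d path \<Rightarrow> real) \<Rightarrow> real" where
  "upper_expectation \<P> X = (SUP P\<in>\<P>. \<integral>\<omega>. X \<omega> \<partial>P)"

definition G_evaluation ::
    "real \<Rightarrow> (('d::finite path \<Rightarrow> real) \<Rightarrow> real) \<Rightarrow> 'd path measure set \<Rightarrow> ('d path \<Rightarrow> real) \<Rightarrow> real" where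
  "G_evaluation T E \<P> \<xi> = upper_expectation \<P> (\<lambda>\<omega>. SUP u\<in>{0..T}. G_cond_exp T E u \<xi> \<omega>)"


section \<open>Norms and completions\<close>

definition norm_G :: "(('d::finite path \<Rightarrow> real) \<Rightarrow> real) \<Rightarrow> real \<Rightarrow> ('d path \<Rightarrow> real) \<Rightarrow> real" where
  "norm_G E p \<xi> = E (\<lambda>\<omega>. \<bar>\<xi> \<omega>\<bar> powr p) powr (1 / p)"

definition norm_eval ::
    "real \<Rightarrow> (('d::finite path \<Rightarrow> real) \<Rightarrow> real) \<Rightarrow> 'd path measure set \<Rightarrow> real \<Rightarrow>
     ('d path \<Rightarrow> real) \<Rightarrow> real" where
  "norm_eval T E \<P> p \<xi> = G_evaluation T E \<P> (\<lambda>\<omega>. \<bar>\<xi> \<omega>\<bar> powr p) powr (1 / p)"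

text \<open>
  The completion of a space \<open>V\<close> of functions under a (semi)norm \<open>N\<close>: Cauchy sequences in \<open>V\<close>
  modulo sequences that tend to zero.
\<close>

definition cauchy_seqs :: "('w \<Rightarrow> real) set \<Rightarrow> (('w \<Rightarrow> real) \<Rightarrow> real) \<Rightarrow> (nat \<Rightarrow> 'w \<Rightarrow> real) set" where
  "cauchy_seqs V N = {x. (\<forall>n. x n \<in> V) \<and>
     (\<forall>e>0. \<exists>M. \<forall>m\<ge>M. \<forall>n\<ge>M. N (\<lambda>w. x m w - x n w) < e)}"

definition completion ::
    "('w \<Rightarrow> real) set \<Rightarrow> (('w \<Rightarrow> real) \<Rightarrow> real) \<Rightarrow> (nat \<Rightarrow> 'w \<Rightarrow> real) set set" where
  "completion V N = cauchy_seqs V N //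
     {(x, y). x \<in> cauchy_seqs V N \<and> y \<in> cauchy_seqs V N \<and>
              (\<lambda>n. N (\<lambda>w. x n w - y n w)) \<longlonglongrightarrow> 0}"

definition L_G ::
    "real \<Rightarrow> (('d::finite path \<Rightarrow> real) \<Rightarrow> real) \<Rightarrow> real \<Rightarrow> (nat \<Rightarrow> 'd path \<Rightarrow> real) set set" where
  "L_G T E p = completion (H0 T) (norm_G E p)"

definition L_eval ::
    "real \<Rightarrow> (('d::finite path \<Rightarrow> real) \<Rightarrow> real) \<Rightarrow> 'd path measure set \<Rightarrow> real \<Rightarrow>
     (nat \<Rightarrow> 'd path \<Rightarrow> real) set set" where
  "L_eval T E \<P> p = completion (H0 T) (norm_eval T E \<P> p)"

text \<open>
  Inclusion of one completion of \<open>V\<close> in another: every sequence that represents an element of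
  \<open>C\<close> also represents one of \<open>D\<close>, the same one for equivalent sequences, and different elements
  of \<open>C\<close> give different elements of \<open>D\<close>.  That is, the identity of \<open>V\<close> extends to a canonical
  injective map from \<open>C\<close> to \<open>D\<close>.
\<close>

definition completion_included ::
    "(nat \<Rightarrow> 'w \<Rightarrow> real) set set \<Rightarrow> (nat \<Rightarrow> 'w \<Rightarrow> real) set set \<Rightarrow> bool" where
  "completion_included C D \<longleftrightarrow> (\<exists>J. inj_on J C \<and> (\<forall>c\<in>C. J c \<in> D \<and> c \<subseteq> J c))"

end

theory Submission
  imports Defs
begin

text \<open>
  Pasting the increments of a path \<open>\<omega>'\<close> after time \<open>u\<close> to a path \<open>\<omega>\<close> gives the formula
  \<open>E\<^sub>u(X)(\<omega>) = E(X(paste u \<omega> \<sqdot>))\<close>, from which the tower property and Jensen's inequality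
  follow.  Put \<open>\<beta> = (\<alpha> + \<delta>) / \<alpha>\<close> and \<open>X = \<bar>\<xi>\<bar>\<^sup>\<alpha>\<close>.  By Jensen, \<open>E\<^sub>u(X)\<close> is at most
  \<open>M\<^sub>u\<^bsup>1/\<beta>\<^esup>\<close> with the martingale \<open>M\<^sub>u = E\<^sub>u(X\<^sup>\<beta>)\<close>, and a pathwise form of Doob's maximal
  inequality for powers below one bounds the expectation of the maximum of \<open>M\<^sub>u\<^bsup>1/\<beta>\<^esup>\<close> over a time grid by
  \<open>\<beta>\<^sup>* E(X\<^sup>\<beta>)\<^bsup>1/\<beta>\<^esup>\<close>.  Continuity of \<open>u \<mapsto> E\<^sub>u(X)\<close> and Fatou's lemma pass to all times.  As
  \<open>\<beta>\<^sup>* \<le> \<gamma>\<^sup>*\<close>, this is the first term of the bound; the second one is nonnegative.  For the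
  injectivity of the map between the completions, convergence to zero of a moment of order \<open>\<alpha>\<close>
  along a sequence that is Cauchy in order \<open>\<alpha> + \<delta>\<close> upgrades to order \<open>\<alpha> + \<delta>\<close> by truncation.
\<close>

section \<open>Locally Lipschitz functions of polynomial growth\<close>

text \<open>The obstacle is that \<open>E\<close> is only sublinear: sums do not split into
  equalities and negative factors do not come out. The classical proof of Doob's inequality
  integrates over level sets of the maximum, whose indicators are in general not in
  \<open>H0 T\<close>. It is replaced by a function of the running maximum and the current value
  that is affine in the current value with a nonnegative coefficient; this much linearity survives
  conditioning. The coefficient contains the power \<theta> - 1 < 0 of the maximum, which is
  Lipschitz only away from 0. Hence the martingale is built from
  \<open>\<bar>X w\<bar> powr p + e\<close>, and \<open>e\<close> tends to 0 at the end. With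
  \<theta> = 1 / \<beta> the constant 1 / (1 - \<theta>) is the conjugate exponent of \<beta>.
  Independence is given for the noise sequence on the base space, so identities about conditioning
  are transferred to that sequence along a time grid. Continuity in time is what makes the supremum
  over uncountably many times measurable and accessible from grids.\<close>

lemma tuple_norm_nonneg [simp]: "0 \<le> tuple_norm n x"
  by (simp add: tuple_norm_def)

lemma tuple_norm_zero [simp]: "tuple_norm n (\<lambda>i. 0) = 0"
  by (simp add: tuple_norm_def L2_set_def)

lemma tuple_norm_triangle: "tuple_norm n (\<lambda>i. x i + y i) \<le> tuple_norm n x + tuple_norm n y"
proof -
  have "tuple_norm n (\<lambda>i. x i + y i) \<le> L2_set (\<lambda>i. norm (x i) + norm (y i)) {..<n}"
    unfolding tuple_norm_def by (intro L2_set_mono) (auto intro: norm_triangle_ineq)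
  also have "\<dots> \<le> tuple_norm n x + tuple_norm n y"
    unfolding tuple_norm_def by (rule L2_set_triangle_ineq)
  finally show ?thesis .
qed

lemma tuple_norm_le_sum: "tuple_norm n x \<le> (\<Sum>i<n. norm (x i))"
  unfolding tuple_norm_def by (intro L2_set_le_sum) auto

lemma norm_le_tuple_norm: "i < n \<Longrightarrow> norm (x i) \<le> tuple_norm n x"
  unfolding tuple_norm_def using member_le_L2_set[of "{..<n}" i "\<lambda>i. norm (x i)"] by simp

lemma tuple_norm_cong: "(\<And>i. i < n \<Longrightarrow> x i = y i) \<Longrightarrow> tuple_norm n x = tuple_norm n y"
  unfolding tuple_norm_def by (intro L2_set_cong) auto

lemma tuple_norm_le_card: "(\<And>i. i < n \<Longrightarrow> norm (x i) \<le> c) \<Longrightarrow> tuple_norm n x \<le> real n * c"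
  using tuple_norm_le_sum[of n x] sum_bounded_above[of "{..<n}" "\<lambda>i. norm (x i)" c] by simp

lemma tuple_norm_1 [simp]: "tuple_norm (Suc 0) x = norm (x 0)"
  by (simp add: tuple_norm_def L2_set_def lessThan_Suc)

text \<open>Both weights define the same class. The form \<open>(1 + a + b) ^ k\<close> is the
  working one, since under composition such weights multiply and only their exponents add
  up.\<close>

lemma power_growth_equiv:
  fixes a b :: real
  assumes "0 \<le> a" "0 \<le> b"
  shows "1 + a ^ k + b ^ k \<le> 3 * (1 + a + b) ^ k" and "(1 + a + b) ^ k \<le> 3 ^ k * (1 + a ^ k + b ^ k)"
proof -
  have "1 \<le> (1 + a + b) ^ k" "a ^ k \<le> (1 + a + b) ^ k" "b ^ k \<le> (1 + a + b) ^ k"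
    using assms by (auto intro!: power_mono one_le_power)
  then show "1 + a ^ k + b ^ k \<le> 3 * (1 + a + b) ^ k" by simp
  define M where "M = max 1 (max a b)"
  have "(1 + a + b) ^ k \<le> (3 * M) ^ k"
    using assms by (intro power_mono) (auto simp: M_def)
  also have "\<dots> = 3 ^ k * M ^ k" by (simp add: power_mult_distrib)
  also have "M ^ k \<le> 1 + a ^ k + b ^ k"
    using assms by (auto simp: M_def max_def)
  finally show "(1 + a + b) ^ k \<le> 3 ^ k * (1 + a ^ k + b ^ k)" by simp
qed

text \<open>The definition leaves the sign of the constant open; \<open>3 * \<bar>C\<bar>\<close> is
  nonnegative, so later estimates may multiply by it.\<close>

lemma C_lLip_tupleE:
  assumes "\<phi> \<in> C_lLip_tuple n"
  obtains C k where "0 \<le> C" "\<And>x y. \<bar>\<phi> x - \<phi> y\<bar> \<le>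
    C * (1 + tuple_norm n x + tuple_norm n y) ^ k * tuple_norm n (\<lambda>i. x i - y i)"
proof -
  obtain C k where *: "\<And>x y. \<bar>\<phi> x - \<phi> y\<bar> \<le>
       C * (1 + tuple_norm n x ^ k + tuple_norm n y ^ k) * tuple_norm n (\<lambda>i. x i - y i)"
    using assms unfolding C_lLip_tuple_def by blast
  show ?thesis
  proof (rule that[of "3 * \<bar>C\<bar>" k])
    fix x y :: "nat \<Rightarrow> 'a"
    have "C * (1 + tuple_norm n x ^ k + tuple_norm n y ^ k) \<le> \<bar>C\<bar> * (3 * (1 + tuple_norm n x + tuple_norm n y) ^ k)"
      by (intro mult_mono power_growth_equiv) auto
    then have "C * (1 + tuple_norm n x ^ k + tuple_norm n y ^ k) * tuple_norm n (\<lambda>i. x i - y i)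
      \<le> 3 * \<bar>C\<bar> * (1 + tuple_norm n x + tuple_norm n y) ^ k * tuple_norm n (\<lambda>i. x i - y i)"
      by (intro mult_right_mono) (auto simp: algebra_simps)
    with * show "\<bar>\<phi> x - \<phi> y\<bar> \<le> 3 * \<bar>C\<bar> * (1 + tuple_norm n x + tuple_norm n y) ^ k * tuple_norm n (\<lambda>i. x i - y i)"
      by (rule order_trans)
  qed simp
qed

lemma C_lLip_tupleI:
  fixes \<phi> :: "(nat \<Rightarrow> 'a::real_normed_vector) \<Rightarrow> real"
  assumes "0 \<le> C" "\<And>x y. \<bar>\<phi> x - \<phi> y\<bar> \<le>
    C * (1 + tuple_norm n x + tuple_norm n y) ^ k * tuple_norm n (\<lambda>i. x i - y i)"
  shows "\<phi> \<in> C_lLip_tuple n"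
  unfolding C_lLip_tuple_def
proof (intro CollectI exI[of _ "C * 3 ^ k"] exI[of _ k] allI)
  fix x y :: "nat \<Rightarrow> 'a"
  have "C * (1 + tuple_norm n x + tuple_norm n y) ^ k
      \<le> C * (3 ^ k * (1 + tuple_norm n x ^ k + tuple_norm n y ^ k))"
    using assms(1) by (intro mult_left_mono power_growth_equiv) auto
  then have "C * (1 + tuple_norm n x + tuple_norm n y) ^ k * tuple_norm n (\<lambda>i. x i - y i)
      \<le> C * 3 ^ k * (1 + tuple_norm n x ^ k + tuple_norm n y ^ k) * tuple_norm n (\<lambda>i. x i - y i)"
    by (intro mult_right_mono) (auto simp: algebra_simps)
  with assms(2) show "\<bar>\<phi> x - \<phi> y\<bar> \<le> C * 3 ^ k * (1 + tuple_norm n x ^ k + tuple_norm n y ^ k) * tuple_norm n (\<lambda>i. x i - y i)"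
    by (rule order_trans)
qed

lemma C_lLipE:
  assumes "\<phi> \<in> C_lLip"
  obtains C k where "0 \<le> C" "\<And>x y. \<bar>\<phi> x - \<phi> y\<bar> \<le> C * (1 + norm x + norm y) ^ k * norm (x - y)"
proof -
  obtain C k where *: "\<And>x y. \<bar>\<phi> x - \<phi> y\<bar> \<le> C * (1 + norm x ^ k + norm y ^ k) * norm (x - y)"
    using assms unfolding C_lLip_def by blast
  show ?thesis
  proof (rule that[of "3 * \<bar>C\<bar>" k])
    fix x y :: 'a
    have "C * (1 + norm x ^ k + norm y ^ k) \<le> \<bar>C\<bar> * (3 * (1 + norm x + norm y) ^ k)"
      by (intro mult_mono power_growth_equiv) auto
    then have "C * (1 + norm x ^ k + norm y ^ k) * norm (x - y)
      \<le> 3 * \<bar>C\<bar> * (1 + norm x + norm y) ^ k * norm (x - y)"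
      by (intro mult_right_mono) (auto simp: algebra_simps)
    with * show "\<bar>\<phi> x - \<phi> y\<bar> \<le> 3 * \<bar>C\<bar> * (1 + norm x + norm y) ^ k * norm (x - y)"
      by (rule order_trans)
  qed simp
qed

lemma C_lLipI:
  fixes \<phi> :: "'a::real_normed_vector \<Rightarrow> real"
  assumes "0 \<le> C" "\<And>x y. \<bar>\<phi> x - \<phi> y\<bar> \<le> C * (1 + norm x + norm y) ^ k * norm (x - y)"
  shows "\<phi> \<in> C_lLip"
  unfolding C_lLip_def
proof (intro CollectI exI[of _ "C * 3 ^ k"] exI[of _ k] allI)
  fix x y :: 'a
  have "C * (1 + norm x + norm y) ^ k \<le> C * (3 ^ k * (1 + norm x ^ k + norm y ^ k))"
    using assms(1) by (intro mult_left_mono power_growth_equiv) auto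
  then have "C * (1 + norm x + norm y) ^ k * norm (x - y)
      \<le> C * 3 ^ k * (1 + norm x ^ k + norm y ^ k) * norm (x - y)"
    by (intro mult_right_mono) (auto simp: algebra_simps)
  with assms(2) show "\<bar>\<phi> x - \<phi> y\<bar> \<le> C * 3 ^ k * (1 + norm x ^ k + norm y ^ k) * norm (x - y)"
    by (rule order_trans)
qed

lemma C_bLip_tuple_subset: "C_bLip_tuple n \<subseteq> C_lLip_tuple n"
proof
  fix \<phi> :: "(nat \<Rightarrow> 'a) \<Rightarrow> real" assume "\<phi> \<in> C_bLip_tuple n"
  then obtain L where L: "\<And>x y. \<bar>\<phi> x - \<phi> y\<bar> \<le> L * tuple_norm n (\<lambda>i. x i - y i)"
    unfolding C_bLip_tuple_def by blast
  show "\<phi> \<in> C_lLip_tuple n"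
  proof (rule C_lLip_tupleI[of "\<bar>L\<bar>" _ _ 0])
    fix x y
    show "\<bar>\<phi> x - \<phi> y\<bar> \<le> \<bar>L\<bar> * (1 + tuple_norm n x + tuple_norm n y) ^ 0 * tuple_norm n (\<lambda>i. x i - y i)"
      using L[of x y] mult_right_mono[of L "\<bar>L\<bar>" "tuple_norm n (\<lambda>i. x i - y i)"] abs_ge_self[of L] by simp
  qed simp
qed

text \<open>The seminorm of the difference vanishes, which leaves no room for different values. This
  is what lets total sequences stand for \<open>n\<close>-tuples.\<close>

lemma C_lLip_tuple_cong:
  assumes "\<phi> \<in> C_lLip_tuple n" "\<And>i. i < n \<Longrightarrow> x i = y i"
  shows "\<phi> x = \<phi> y"
proof -
  have "tuple_norm n (\<lambda>i. x i - y i) = 0"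
    using tuple_norm_cong[of n "\<lambda>i. x i - y i" "\<lambda>_. 0"] assms(2) by simp
  moreover obtain C k where "0 \<le> C" "\<And>x y. \<bar>\<phi> x - \<phi> y\<bar> \<le>
    C * (1 + tuple_norm n x + tuple_norm n y) ^ k * tuple_norm n (\<lambda>i. x i - y i)"
    by (rule C_lLip_tupleE[OF assms(1)]) (rule that)
  ultimately show ?thesis by (metis abs_le_zero_iff eq_iff_diff_eq_0 mult_zero_right)
qed

text \<open>The tool for all changes of coordinates: values to increments, scaling, freezing. A
  Lipschitz map grows at most linearly, so it changes the weight by a constant factor only;
  \<open>L\<close> may be affine, which is why its value at 0 enters through
  \<open>c\<close>.\<close>

lemma C_lLip_tuple_Lipschitz_comp:
  fixes L :: "(nat \<Rightarrow> 'a::real_normed_vector) \<Rightarrow> nat \<Rightarrow> 'b::real_normed_vector"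
  assumes \<phi>: "\<phi> \<in> C_lLip_tuple n"
    and L: "\<And>x y i. i < n \<Longrightarrow> norm (L x i - L y i) \<le> K * tuple_norm m (\<lambda>i. x i - y i)"
  shows "(\<lambda>x. \<phi> (L x)) \<in> C_lLip_tuple m"
proof -
  obtain C k where C: "0 \<le> C" "\<And>x y. \<bar>\<phi> x - \<phi> y\<bar> \<le>
    C * (1 + tuple_norm n x + tuple_norm n y) ^ k * tuple_norm n (\<lambda>i. x i - y i)"
    by (rule C_lLip_tupleE[OF \<phi>]) (rule that)
  \<comment> \<open>The factor \<open>n\<close> pays for the passage from single coordinates to
    \<open>tuple_norm n\<close>.\<close>
  define R where "R = real n * \<bar>K\<bar>"
  define c where "c = tuple_norm n (L (\<lambda>_. 0))"
  have R: "0 \<le> R" "0 \<le> c" by (auto simp: R_def c_def)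
  have Ld: "tuple_norm n (\<lambda>i. L x i - L y i) \<le> R * tuple_norm m (\<lambda>i. x i - y i)" for x y
  proof -
    have "norm (L x i - L y i) \<le> \<bar>K\<bar> * tuple_norm m (\<lambda>i. x i - y i)" if "i < n" for i
      using L[OF that, of x y] mult_right_mono[of K "\<bar>K\<bar>" "tuple_norm m (\<lambda>i. x i - y i)"]
        abs_ge_self[of K] by simp
    from tuple_norm_le_card[OF this] show ?thesis by (simp add: R_def mult.assoc)
  qed
  have Lg: "tuple_norm n (L x) \<le> c + R * tuple_norm m x" for x
    using tuple_norm_triangle[of n "\<lambda>i. L x i - L (\<lambda>_. 0) i" "L (\<lambda>_. 0)"] Ld[of x "\<lambda>_. 0"]
    by (simp add: c_def)
  show ?thesis
  proof (rule C_lLip_tupleI[of "C * (1 + 2 * c + R) ^ k * R" _ _ k])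
    show "0 \<le> C * (1 + 2 * c + R) ^ k * R" using C(1) R by simp
    fix x y :: "nat \<Rightarrow> 'a"
    let ?r = "1 + tuple_norm m x + tuple_norm m y"
    have "1 + tuple_norm n (L x) + tuple_norm n (L y) \<le> 1 + 2 * c + R * (tuple_norm m x + tuple_norm m y)"
      using Lg[of x] Lg[of y] by (simp add: algebra_simps)
    also have "\<dots> \<le> (1 + 2 * c + R) * ?r"
      using R by (simp add: algebra_simps)
    finally have "(1 + tuple_norm n (L x) + tuple_norm n (L y)) ^ k \<le> ((1 + 2 * c + R) * ?r) ^ k"
      by (intro power_mono) (auto intro: add_nonneg_nonneg)
    then have "C * (1 + tuple_norm n (L x) + tuple_norm n (L y)) ^ k \<le> C * ((1 + 2 * c + R) * ?r) ^ k"
      using C(1) by (rule mult_left_mono)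
    then have "C * (1 + tuple_norm n (L x) + tuple_norm n (L y)) ^ k * tuple_norm n (\<lambda>i. L x i - L y i)
      \<le> C * ((1 + 2 * c + R) * ?r) ^ k * (R * tuple_norm m (\<lambda>i. x i - y i))"
      by (rule mult_mono) (use C(1) R Ld in auto)
    with C(2)[of "L x" "L y"]
    have "\<bar>\<phi> (L x) - \<phi> (L y)\<bar> \<le> C * ((1 + 2 * c + R) * ?r) ^ k * (R * tuple_norm m (\<lambda>i. x i - y i))"
      by (rule order_trans)
    then show "\<bar>\<phi> (L x) - \<phi> (L y)\<bar> \<le> C * (1 + 2 * c + R) ^ k * R * ?r ^ k * tuple_norm m (\<lambda>i. x i - y i)"
      by (simp only: power_mult_distrib mult_ac)
  qed
qed

text \<open>A function whose weight has degree \<open>k\<close> grows with degree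
  \<open>Suc k\<close>. The weight of \<open>F\<close> therefore contributes the exponent
  \<open>Suc k * j\<close>, and the difference of the values of \<open>\<phi>\<close> another
  \<open>k\<close>.\<close>

lemma C_lLip_comp_tuple:
  fixes \<phi> :: "(nat \<Rightarrow> 'a::real_normed_vector) \<Rightarrow> real"
  assumes F: "F \<in> C_lLip" and \<phi>: "\<phi> \<in> C_lLip_tuple n"
  shows "(\<lambda>x. F (\<phi> x)) \<in> C_lLip_tuple n"
proof -
  obtain C k where C: "0 \<le> C" "\<And>x y. \<bar>\<phi> x - \<phi> y\<bar> \<le>
    C * (1 + tuple_norm n x + tuple_norm n y) ^ k * tuple_norm n (\<lambda>i. x i - y i)"
    by (rule C_lLip_tupleE[OF \<phi>]) (rule that)
  obtain D j where D: "0 \<le> D" "\<And>x y. \<bar>F x - F y\<bar> \<le> D * (1 + norm x + norm y) ^ j * norm (x - y)"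
    by (rule C_lLipE[OF F]) (rule that)
  define A where "A = \<bar>\<phi> (\<lambda>_. 0)\<bar> + C"
  have A: "0 \<le> A" using C(1) by (simp add: A_def)
  have g: "\<bar>\<phi> x\<bar> \<le> A * (1 + tuple_norm n x) ^ Suc k" for x
  proof -
    have "\<bar>\<phi> x\<bar> \<le> \<bar>\<phi> (\<lambda>_. 0)\<bar> + C * (1 + tuple_norm n x) ^ k * tuple_norm n x"
      using C(2)[of x "\<lambda>_. 0"] by simp
    also have "\<dots> \<le> \<bar>\<phi> (\<lambda>_. 0)\<bar> * (1 + tuple_norm n x) ^ Suc k + C * (1 + tuple_norm n x) ^ k * (1 + tuple_norm n x)"
      using C(1) one_le_power[of "1 + tuple_norm n x" "Suc k"]
      by (intro add_mono mult_left_mono mult_le_cancel_left1[THEN iffD2]) auto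
    finally show ?thesis by (simp add: A_def algebra_simps)
  qed
  show ?thesis
  proof (rule C_lLip_tupleI[of "D * (1 + 2 * A) ^ j * C" _ _ "Suc k * j + k"])
    show "0 \<le> D * (1 + 2 * A) ^ j * C" using A C(1) D(1) by simp
    fix x y :: "nat \<Rightarrow> 'a"
    let ?r = "1 + tuple_norm n x + tuple_norm n y"
    have m: "(1 + tuple_norm n z) ^ Suc k \<le> ?r ^ Suc k" if "z = x \<or> z = y" for z
      using that by (intro power_mono) auto
    have "1 + norm (\<phi> x) + norm (\<phi> y) \<le> ?r ^ Suc k + A * ?r ^ Suc k + A * ?r ^ Suc k"
      using g[of x] g[of y] mult_left_mono[OF m A, of x] mult_left_mono[OF m A, of y]
        one_le_power[of ?r "Suc k"]
      by (intro add_mono) auto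
    also have "\<dots> = (1 + 2 * A) * ?r ^ Suc k" by (simp add: algebra_simps)
    finally have "(1 + norm (\<phi> x) + norm (\<phi> y)) ^ j \<le> ((1 + 2 * A) * ?r ^ Suc k) ^ j"
      by (intro power_mono) auto
    also have "\<dots> = (1 + 2 * A) ^ j * ?r ^ (Suc k * j)"
      by (simp only: power_mult_distrib power_mult)
    finally have p: "(1 + norm (\<phi> x) + norm (\<phi> y)) ^ j \<le> (1 + 2 * A) ^ j * ?r ^ (Suc k * j)" .
    have "\<bar>F (\<phi> x) - F (\<phi> y)\<bar> \<le> D * (1 + norm (\<phi> x) + norm (\<phi> y)) ^ j * norm (\<phi> x - \<phi> y)"
      by (rule D)
    also have "\<dots> \<le> D * ((1 + 2 * A) ^ j * ?r ^ (Suc k * j)) * (C * ?r ^ k * tuple_norm n (\<lambda>i. x i - y i))"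
      using p C(2)[of x y] D(1) A by (intro mult_mono mult_nonneg_nonneg) (auto simp: add_nonneg_nonneg)
    finally show "\<bar>F (\<phi> x) - F (\<phi> y)\<bar> \<le> D * (1 + 2 * A) ^ j * C * ?r ^ (Suc k * j + k) * tuple_norm n (\<lambda>i. x i - y i)"
      by (simp add: power_add algebra_simps)
  qed
qed

section \<open>Scalar test functions: powers, absolute powers and powers cut off near 0\<close>

lemma C_lLip_Lipschitz:
  assumes "\<And>x y. \<bar>F x - F y\<bar> \<le> K * norm (x - y)"
  shows "F \<in> C_lLip"
proof (rule C_lLipI[of "\<bar>K\<bar>" _ 0])
  fix x y show "\<bar>F x - F y\<bar> \<le> \<bar>K\<bar> * (1 + norm x + norm y) ^ 0 * norm (x - y)"
    using assms[of x y] mult_right_mono[of K "\<bar>K\<bar>" "norm (x - y)"] abs_ge_self[of K] by simp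
qed simp

lemma C_lLip_abs: "(\<lambda>x::real. \<bar>x\<bar>) \<in> C_lLip"
  by (rule C_lLip_Lipschitz[of _ 1]) simp

lemma C_lLip_power: "(\<lambda>x::real. x ^ k) \<in> C_lLip"
proof (rule C_lLipI[of "real k" _ k])
  fix x y :: real
  have eq: "\<bar>x ^ k - y ^ k\<bar> = \<bar>x - y\<bar> * \<bar>\<Sum>i<k. x ^ i * y ^ (k - Suc i)\<bar>"
    by (simp add: power_diff_sumr2 abs_mult mult.commute)
  have "\<bar>\<Sum>i<k. x ^ i * y ^ (k - Suc i)\<bar> \<le> (\<Sum>i<k. (1 + \<bar>x\<bar> + \<bar>y\<bar>) ^ k)"
  proof (intro order_trans[OF sum_abs] sum_mono)
    fix i assume "i \<in> {..<k}"
    have "\<bar>x ^ i * y ^ (k - Suc i)\<bar> \<le> (1 + \<bar>x\<bar> + \<bar>y\<bar>) ^ i * (1 + \<bar>x\<bar> + \<bar>y\<bar>) ^ (k - Suc i)"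
      unfolding abs_mult power_abs by (intro mult_mono power_mono) auto
    also have "\<dots> \<le> (1 + \<bar>x\<bar> + \<bar>y\<bar>) ^ k"
      unfolding power_add[symmetric] by (intro power_increasing) (use \<open>i \<in> _\<close> in auto)
    finally show "\<bar>x ^ i * y ^ (k - Suc i)\<bar> \<le> (1 + \<bar>x\<bar> + \<bar>y\<bar>) ^ k" .
  qed
  then have "\<bar>x - y\<bar> * \<bar>\<Sum>i<k. x ^ i * y ^ (k - Suc i)\<bar> \<le> \<bar>x - y\<bar> * (real k * (1 + \<bar>x\<bar> + \<bar>y\<bar>) ^ k)"
    by (intro mult_left_mono) auto
  with eq show "\<bar>x ^ k - y ^ k\<bar> \<le> real k * (1 + norm x + norm y) ^ k * norm (x - y)"
    by (simp add: mult.commute mult.left_commute)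
qed simp

lemma powr_diff_le:
  fixes x y p :: real
  assumes "1 \<le> p" "0 \<le> x" "x \<le> y"
  shows "y powr p - x powr p \<le> p * y powr (p - 1) * (y - x)"
proof (cases "x = y")
  case False
  then have xy: "x < y" using assms by simp
  show ?thesis
  proof -
    have cont: "continuous_on {x..y} (\<lambda>t. t powr p)"
      using assms by (intro continuous_on_powr' continuous_intros) auto
    have der: "((\<lambda>t. t powr p) has_real_derivative p * t powr (p - 1)) (at t)" if "x < t" "t < y" for t
      using that assms by (intro has_real_derivative_powr) auto
    obtain t where t: "x < t" "t < y" "y powr p - x powr p = (y - x) * (p * t powr (p - 1))"
    proof -
      from MVT[OF xy cont] der obtain l t where
        "x < t" "t < y" "DERIV (\<lambda>t. t powr p) t :> l" "y powr p - x powr p = (y - x) * l"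
        by (metis real_differentiable_def)
      with der[of t] DERIV_unique that show ?thesis by blast
    qed
    have "t powr (p - 1) \<le> y powr (p - 1)" using t assms by (intro powr_mono2) auto
    then have "(y - x) * (p * t powr (p - 1)) \<le> (y - x) * (p * y powr (p - 1))"
      using xy assms by (intro mult_left_mono) auto
    with t(3) show ?thesis by (simp add: algebra_simps)
  qed
qed simp

text \<open>For \<open>1 \<le> p\<close> the slope on an interval is bounded by its value at the
  larger end, and an integer \<open>k\<close> above \<open>p\<close> turns the real exponent into a
  polynomial weight.\<close>

lemma C_lLip_abs_powr:
  assumes "1 \<le> p"
  shows "(\<lambda>x::real. \<bar>x\<bar> powr p) \<in> C_lLip"
proof -
  obtain k :: nat where k: "p \<le> real k" using real_arch_simple by blast
  have main: "\<bar>\<bar>x\<bar> powr p - \<bar>y\<bar> powr p\<bar> \<le> p * (1 + norm x + norm y) ^ k * norm (x - y)"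
    if "\<bar>x\<bar> \<le> \<bar>y\<bar>" for x y :: real
  proof -
    have "\<bar>x\<bar> powr p \<le> \<bar>y\<bar> powr p" using that assms by (intro powr_mono2) auto
    then have "\<bar>\<bar>x\<bar> powr p - \<bar>y\<bar> powr p\<bar> = \<bar>y\<bar> powr p - \<bar>x\<bar> powr p" by simp
    also have "\<dots> \<le> p * \<bar>y\<bar> powr (p - 1) * (\<bar>y\<bar> - \<bar>x\<bar>)"
      using that assms by (intro powr_diff_le) auto
    also have "\<dots> \<le> p * (1 + norm x + norm y) ^ k * norm (x - y)"
    proof (intro mult_mono)
      have "\<bar>y\<bar> powr (p - 1) \<le> (1 + \<bar>x\<bar> + \<bar>y\<bar>) powr (p - 1)"
        using assms by (intro powr_mono2) auto
      also have "\<dots> \<le> (1 + \<bar>x\<bar> + \<bar>y\<bar>) powr real k"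
        using k by (intro powr_mono) auto
      finally show "\<bar>y\<bar> powr (p - 1) \<le> (1 + norm x + norm y) ^ k" by (simp add: powr_realpow)
    qed (use assms that in auto)
    finally show ?thesis .
  qed
  show ?thesis
  proof (rule C_lLipI[of p _ k])
    fix x y :: real
    show "\<bar>\<bar>x\<bar> powr p - \<bar>y\<bar> powr p\<bar> \<le> p * (1 + norm x + norm y) ^ k * norm (x - y)"
      using main[of x y] main[of y x] by (cases "\<bar>x\<bar> \<le> \<bar>y\<bar>") (auto simp: abs_minus_commute algebra_simps)
  qed (use assms in simp)
qed

lemma C_lLip_max_powr:
  fixes q e :: real
  assumes "q \<le> 1" "0 < e"
  shows "(\<lambda>x. max x e powr q) \<in> C_lLip"
proof -
  define K where "K = \<bar>q\<bar> * e powr (q - 1)"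
  have main: "\<bar>x powr q - y powr q\<bar> \<le> K * (y - x)" if "e \<le> x" "x \<le> y" for x y :: real
  proof (cases "x = y")
    case False
    then have xy: "x < y" using that by simp
    have MVT: "\<exists>t>x. t < y \<and> y powr q - x powr q = (y - x) * (q * t powr (q - 1))"
      using that assms by (intro MVT2[OF xy] has_real_derivative_powr) auto
    then obtain t where t: "x < t" "t < y" "y powr q - x powr q = (y - x) * (q * t powr (q - 1))"
      using MVT by blast
    have "\<bar>y powr q - x powr q\<bar> = (y - x) * (\<bar>q\<bar> * t powr (q - 1))"
      using t xy by (simp add: abs_mult)
    also have "\<dots> \<le> (y - x) * (\<bar>q\<bar> * e powr (q - 1))"
      using t xy that assms by (intro mult_left_mono powr_mono2') auto
    finally show ?thesis by (simp add: K_def abs_minus_commute mult.commute)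
  qed simp
  have K: "0 \<le> K" by (simp add: K_def)
  show ?thesis
  proof (rule C_lLip_Lipschitz[of _ K])
    fix x y :: real
    have "\<bar>max x e powr q - max y e powr q\<bar> \<le> K * \<bar>max x e - max y e\<bar>"
      using main[of "max x e" "max y e"] main[of "max y e" "max x e"]
      by (cases "max x e \<le> max y e") (simp_all add: abs_minus_commute del: max.bounded_iff)
    also have "\<dots> \<le> K * \<bar>x - y\<bar>" using K by (intro mult_left_mono) auto
    finally show "\<bar>max x e powr q - max y e powr q\<bar> \<le> K * norm (x - y)" by simp
  qed
qed

section \<open>Sublinear expectations\<close>

locale sublinear =
  fixes S :: "'w set" and H :: "('w \<Rightarrow> real) set" and E :: "('w \<Rightarrow> real) \<Rightarrow> real"
  assumes sublinear: "sublinear_expectation S H E"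
begin

lemma const_mem [simp, intro]: "(\<lambda>_. c) \<in> H"
  and add_mem [intro]: "X \<in> H \<Longrightarrow> Y \<in> H \<Longrightarrow> (\<lambda>w. X w + Y w) \<in> H"
  and scale_mem [intro]: "X \<in> H \<Longrightarrow> (\<lambda>w. c * X w) \<in> H"
  and mono: "X \<in> H \<Longrightarrow> Y \<in> H \<Longrightarrow> (\<And>w. w \<in> S \<Longrightarrow> X w \<le> Y w) \<Longrightarrow> E X \<le> E Y"
  and const [simp]: "E (\<lambda>_. c) = c"
  and E_diff: "X \<in> H \<Longrightarrow> Y \<in> H \<Longrightarrow> E X - E Y \<le> E (\<lambda>w. X w - Y w)"
  and scale: "0 \<le> c \<Longrightarrow> X \<in> H \<Longrightarrow> E (\<lambda>w. c * X w) = c * E X"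
  using sublinear unfolding sublinear_expectation_def by blast+

lemma diff_mem [intro]: "X \<in> H \<Longrightarrow> Y \<in> H \<Longrightarrow> (\<lambda>w. X w - Y w) \<in> H"
  using add_mem[of X "\<lambda>w. (-1) * Y w"] scale_mem[of Y "-1"] by simp

lemma sum_mem: "(\<And>i. i \<in> I \<Longrightarrow> X i \<in> H) \<Longrightarrow> (\<lambda>w. \<Sum>i\<in>I. X i w) \<in> H"
  by (induction I rule: infinite_finite_induct) (auto intro!: add_mem)

lemma cong: "X \<in> H \<Longrightarrow> Y \<in> H \<Longrightarrow> (\<And>w. w \<in> S \<Longrightarrow> X w = Y w) \<Longrightarrow> E X = E Y"
  by (intro antisym mono) auto

lemma nonneg: "X \<in> H \<Longrightarrow> (\<And>w. w \<in> S \<Longrightarrow> 0 \<le> X w) \<Longrightarrow> 0 \<le> E X"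
  using mono[of "\<lambda>_. 0" X] by simp

lemma subadditive: "X \<in> H \<Longrightarrow> Y \<in> H \<Longrightarrow> E (\<lambda>w. X w + Y w) \<le> E X + E Y"
  using E_diff[of "\<lambda>w. X w + Y w" Y] add_mem[of X Y] by simp

lemma subadditive_sum:
  "(\<And>i. i \<in> I \<Longrightarrow> X i \<in> H) \<Longrightarrow> E (\<lambda>w. \<Sum>i\<in>I. X i w) \<le> (\<Sum>i\<in>I. E (X i))"
proof (induction I rule: infinite_finite_induct)
  case (insert i I)
  have "E (\<lambda>w. X i w + (\<Sum>j\<in>I. X j w)) \<le> E (X i) + E (\<lambda>w. \<Sum>j\<in>I. X j w)"
    using insert by (intro subadditive sum_mem) auto
  with insert show ?case by fastforce
qed auto

text \<open>\<open>E_diff\<close> in both orders: the differences are the constants \<open>a\<close>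
  and \<open>- a\<close>.\<close>

lemma add_const: "X \<in> H \<Longrightarrow> E (\<lambda>w. a + X w) = a + E X"
  using E_diff[of "\<lambda>w. a + X w" X] E_diff[of X "\<lambda>w. a + X w"] add_mem[of "\<lambda>_. a" X] by simp

text \<open>Constants and nonnegative factors are what a sublinear \<open>E\<close> lets through
  with equality. Jensen's and Doob's inequalities are arranged so that conditioning meets only such
  expressions.\<close>

lemma affine: "0 \<le> b \<Longrightarrow> X \<in> H \<Longrightarrow> E (\<lambda>w. a + b * X w) = a + b * E X"
  by (simp add: add_const scale_mem scale)

lemma abs_diff_le:
  assumes "X \<in> H" "Y \<in> H" "Z \<in> H" "\<And>w. w \<in> S \<Longrightarrow> \<bar>X w - Y w\<bar> \<le> Z w"
  shows "\<bar>E X - E Y\<bar> \<le> E Z"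
proof -
  have "E X - E Y \<le> E Z" if "X \<in> H" "Y \<in> H" "\<And>w. w \<in> S \<Longrightarrow> \<bar>X w - Y w\<bar> \<le> Z w" for X Y
  proof -
    have "E (\<lambda>w. X w - Y w) \<le> E Z"
      using that assms(3) by (intro mono diff_mem) (auto simp: abs_le_iff)
    with E_diff[of X Y] that show ?thesis by simp
  qed
  from this[of X Y] this[of Y X] assms show ?thesis
    by (simp add: abs_le_iff abs_minus_commute)
qed

end

section \<open>Partial expectations and the tower property of independent sequences\<close>

lemma C_lLip_tuple_fix:
  assumes "\<phi> \<in> C_lLip_tuple m"
  shows "(\<lambda>y. \<phi> (\<lambda>j. if j < i then x j else y j)) \<in> C_lLip_tuple m"
proof (rule C_lLip_tuple_Lipschitz_comp[OF assms, of _ 1])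
  fix y z :: "nat \<Rightarrow> 'a" and j assume "j < m"
  then show "norm ((if j < i then x j else y j) - (if j < i then x j else z j)) \<le> 1 * tuple_norm m (\<lambda>i. y i - z i)"
    using norm_le_tuple_norm[of j m "\<lambda>i. y i - z i"] by simp
qed

lemma C_lLip_tuple_mono:
  assumes "\<phi> \<in> C_lLip_tuple n" "n \<le> m"
  shows "\<phi> \<in> C_lLip_tuple m"
proof -
  have "norm (x i - y i) \<le> 1 * tuple_norm m (\<lambda>i. x i - y i)" if "i < n" for x y :: "nat \<Rightarrow> 'a" and i
    using norm_le_tuple_norm[of i m "\<lambda>i. x i - y i"] that assms(2) by simp
  from C_lLip_tuple_Lipschitz_comp[OF assms(1) this] show ?thesis by simp
qed

lemma C_lLip_tuple_coord:
  assumes "\<phi> \<in> C_lLip" "i < n"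
  shows "(\<lambda>x. \<phi> (x i)) \<in> C_lLip_tuple n"
proof -
  obtain C k where C: "0 \<le> C" "\<And>x y. \<bar>\<phi> x - \<phi> y\<bar> \<le> C * (1 + norm x + norm y) ^ k * norm (x - y)"
    by (rule C_lLipE[OF assms(1)]) (rule that)
  show ?thesis
  proof (rule C_lLip_tupleI[OF C(1), of _ _ k])
    fix x y :: "nat \<Rightarrow> 'a"
    have "C * (1 + norm (x i) + norm (y i)) ^ k * norm (x i - y i)
      \<le> C * (1 + tuple_norm n x + tuple_norm n y) ^ k * tuple_norm n (\<lambda>i. x i - y i)"
      using norm_le_tuple_norm[OF assms(2), of "\<lambda>i. x i - y i"] C(1)
        norm_le_tuple_norm[OF assms(2), of x] norm_le_tuple_norm[OF assms(2), of y]
      by (intro mult_mono power_mono) auto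
    with C(2)[of "x i" "y i"]
    show "\<bar>\<phi> (x i) - \<phi> (y i)\<bar> \<le> C * (1 + tuple_norm n x + tuple_norm n y) ^ k * tuple_norm n (\<lambda>i. x i - y i)"
      by linarith
  qed
qed

lemma C_lLip_tuple_norm_power:
  assumes "0 \<le> a"
  shows "(\<lambda>x. (1 + a * tuple_norm n (x :: nat \<Rightarrow> 'a::real_normed_vector)) ^ k) \<in> C_lLip_tuple n"
proof (rule C_lLip_comp_tuple[OF C_lLip_power])
  show "(\<lambda>x. 1 + a * tuple_norm n (x :: nat \<Rightarrow> 'a)) \<in> C_lLip_tuple n"
  proof (rule C_lLip_tupleI[OF assms, of _ _ 0])
    fix x y :: "nat \<Rightarrow> 'a"
    have "\<bar>tuple_norm n x - tuple_norm n y\<bar> \<le> tuple_norm n (\<lambda>i. x i - y i)"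
      using tuple_norm_triangle[of n "\<lambda>i. x i - y i" y] tuple_norm_triangle[of n "\<lambda>i. y i - x i" x]
      by (simp add: tuple_norm_def norm_minus_commute)
    then have "a * \<bar>tuple_norm n x - tuple_norm n y\<bar> \<le> a * tuple_norm n (\<lambda>i. x i - y i)"
      using assms by (rule mult_left_mono)
    then show "\<bar>(1 + a * tuple_norm n x) - (1 + a * tuple_norm n y)\<bar>
      \<le> a * (1 + tuple_norm n x + tuple_norm n y) ^ 0 * tuple_norm n (\<lambda>i. x i - y i)"
      using assms by (simp add: abs_mult flip: right_diff_distrib)
  qed
qed

context sublinear begin

lemma random_tuple_mem: "random_tuple H m X \<Longrightarrow> \<phi> \<in> C_lLip_tuple m \<Longrightarrow> (\<lambda>w. \<phi> (\<lambda>i. X i w)) \<in> H"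
  by (simp add: random_tuple_def)

text \<open>The weight of the mixed tuple splits into a factor in the free coordinates and a factor
  \<open>Q\<close> in the random ones; the latter integrates to a constant.\<close>

lemma C_lLip_tuple_partial_expectation:
  fixes X :: "nat \<Rightarrow> 'w \<Rightarrow> 'a::real_normed_vector"
  assumes X: "random_tuple H m X" and \<phi>: "\<phi> \<in> C_lLip_tuple m" and i: "i \<le> m"
  shows "(\<lambda>x. E (\<lambda>w. \<phi> (\<lambda>j. if j < i then x j else X j w))) \<in> C_lLip_tuple i"
proof -
  obtain C k where C: "0 \<le> C" "\<And>x y. \<bar>\<phi> x - \<phi> y\<bar> \<le>
    C * (1 + tuple_norm m x + tuple_norm m y) ^ k * tuple_norm m (\<lambda>i. x i - y i)"
    by (rule C_lLip_tupleE[OF \<phi>]) (rule that)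
  define Q where "Q w = (1 + 2 * tuple_norm m (\<lambda>j. X j w)) ^ k" for w
  have Q: "Q \<in> H" unfolding Q_def
    by (rule random_tuple_mem[OF X, of "\<lambda>x. (1 + 2 * tuple_norm m x) ^ k"]) (rule C_lLip_tuple_norm_power, simp)
  have Q0: "0 \<le> E Q" using Q by (intro nonneg) (auto simp: Q_def)
  show ?thesis
  proof (rule C_lLip_tupleI[of "C * E Q" _ _ k])
    show "0 \<le> C * E Q" using C(1) Q0 by simp
    fix x y :: "nat \<Rightarrow> 'a"
    define a where "a x w = (\<lambda>j. if j < i then x j else X j w)" for x :: "nat \<Rightarrow> 'a" and w
    let ?r = "1 + tuple_norm i x + tuple_norm i y"
    let ?D = "tuple_norm i (\<lambda>i. x i - y i)"
    have split: "tuple_norm m z \<le> tuple_norm i z + tuple_norm m (\<lambda>j. if j < i then 0 else z j)" for z :: "nat \<Rightarrow> 'a"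
    proof -
      have "tuple_norm m z \<le> tuple_norm m (\<lambda>j. if j < i then z j else 0) + tuple_norm m (\<lambda>j. if j < i then 0 else z j)"
        by (rule order_trans[OF _ tuple_norm_triangle]) (rule eq_refl, rule tuple_norm_cong, auto)
      also have "tuple_norm m (\<lambda>j. if j < i then z j else 0) = tuple_norm i z"
      proof -
        have "(\<Sum>j<m. (norm (if j < i then z j else 0))\<^sup>2) = (\<Sum>j<i. (norm (z j))\<^sup>2)"
          using i by (intro sum.mono_neutral_cong_right) auto
        then show ?thesis by (simp add: tuple_norm_def L2_set_def)
      qed
      finally show ?thesis .
    qed
    have tail: "tuple_norm m (\<lambda>j. if j < i then 0 else z j) \<le> tuple_norm m z" for z :: "nat \<Rightarrow> 'a"
      unfolding tuple_norm_def by (intro L2_set_mono) auto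
    have g: "tuple_norm m (a z w) \<le> tuple_norm i z + tuple_norm m (\<lambda>j. X j w)" for z w
    proof -
      have "tuple_norm i (a z w) = tuple_norm i z" by (intro tuple_norm_cong) (simp add: a_def)
      moreover have "tuple_norm m (\<lambda>j. if j < i then 0 else a z w j) = tuple_norm m (\<lambda>j. if j < i then 0 else X j w)"
        by (intro tuple_norm_cong) (simp add: a_def)
      ultimately show ?thesis using split[of "a z w"] tail[of "\<lambda>j. X j w"] by simp
    qed
    have d: "tuple_norm m (\<lambda>j. a x w j - a y w j) \<le> ?D" for w
    proof -
      have "tuple_norm i (\<lambda>j. a x w j - a y w j) = ?D" by (intro tuple_norm_cong) (simp add: a_def)
      moreover have "tuple_norm m (\<lambda>j. if j < i then 0 else a x w j - a y w j) = tuple_norm m (\<lambda>_. 0::'a)"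
        by (intro tuple_norm_cong) (simp add: a_def)
      ultimately show ?thesis using split[of "\<lambda>j. a x w j - a y w j"] by simp
    qed
    have mem: "(\<lambda>w. \<phi> (a z w)) \<in> H" for z
      unfolding a_def by (rule random_tuple_mem[OF X, of "\<lambda>y. \<phi> (\<lambda>j. if j < i then z j else y j)"])
        (rule C_lLip_tuple_fix[OF \<phi>])
    have "\<bar>E (\<lambda>w. \<phi> (a x w)) - E (\<lambda>w. \<phi> (a y w))\<bar> \<le> E (\<lambda>w. (C * ?r ^ k * ?D) * Q w)"
    proof (intro abs_diff_le mem scale_mem Q)
      fix w
      let ?q = "tuple_norm m (\<lambda>j. X j w)"
      have "1 + tuple_norm m (a x w) + tuple_norm m (a y w) \<le> ?r + 2 * ?q"
        using g[of x w] g[of y w] by simp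
      \<comment> \<open>As \<open>?r\<close> is at least 1, the sum is dominated by a product, which
        separates the deterministic part from the random one.\<close>
      also have "\<dots> \<le> ?r * (1 + 2 * ?q)" by (simp add: algebra_simps)
      finally have "(1 + tuple_norm m (a x w) + tuple_norm m (a y w)) ^ k \<le> (?r * (1 + 2 * ?q)) ^ k"
        by (intro power_mono) auto
      then have "C * (1 + tuple_norm m (a x w) + tuple_norm m (a y w)) ^ k \<le> C * (?r * (1 + 2 * ?q)) ^ k"
        using C(1) by (rule mult_left_mono)
      then have "C * (1 + tuple_norm m (a x w) + tuple_norm m (a y w)) ^ k * tuple_norm m (\<lambda>j. a x w j - a y w j)
         \<le> C * (?r * (1 + 2 * ?q)) ^ k * ?D"
        by (rule mult_mono) (use C(1) d in auto)
      with C(2)[of "a x w" "a y w"]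
      have "\<bar>\<phi> (a x w) - \<phi> (a y w)\<bar> \<le> C * (?r * (1 + 2 * ?q)) ^ k * ?D" by linarith
      also have "\<dots> = C * ?r ^ k * ?D * Q w"
        by (simp only: Q_def power_mult_distrib mult_ac)
      finally show "\<bar>\<phi> (a x w) - \<phi> (a y w)\<bar> \<le> C * ?r ^ k * ?D * Q w" .
    qed
    also have "\<dots> = C * ?r ^ k * ?D * E Q"
      using Q C(1) by (intro scale) auto
    finally show "\<bar>E (\<lambda>w. \<phi> (\<lambda>j. if j < i then x j else X j w)) - E (\<lambda>w. \<phi> (\<lambda>j. if j < i then y j else X j w))\<bar>
      \<le> C * E Q * ?r ^ k * ?D"
      by (simp add: a_def mult_ac)
  qed
qed

text \<open>Independence of \<open>X m\<close> from its predecessors integrates out one coordinate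
  at a time. At \<open>m = i\<close> nothing random is left in the inner expectation; each further
  step replaces \<open>\<phi>\<close> by \<open>\<psi>\<close>, in which coordinate \<open>m\<close>
  is averaged.\<close>

lemma independent_tower:
  fixes X :: "nat \<Rightarrow> 'w \<Rightarrow> 'a::real_normed_vector"
  assumes X: "\<And>m. random_tuple H m X" and indep: "\<And>i. independent_to E i X (X i)"
    and i: "i \<le> m" and \<phi>: "\<phi> \<in> C_lLip_tuple m"
  shows "E (\<lambda>w. E (\<lambda>w'. \<phi> (\<lambda>j. if j < i then X j w else X j w'))) = E (\<lambda>w. \<phi> (\<lambda>j. X j w))"
  using i \<phi>
proof (induction m arbitrary: \<phi> rule: dec_induct)
  case base
  have "\<phi> (\<lambda>j. if j < i then X j w else X j w') = \<phi> (\<lambda>j. X j w)" for w w'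
    by (rule C_lLip_tuple_cong[OF base]) auto
  then show ?case by simp
next
  case (step m)
  define \<psi> where "\<psi> x = E (\<lambda>w. \<phi> (\<lambda>j. if j < m then x j else X j w))" for x
  have \<psi>: "\<psi> \<in> C_lLip_tuple m"
    unfolding \<psi>_def using step.prems by (intro C_lLip_tuple_partial_expectation X) auto
  have ind: "E (\<lambda>w. g (\<lambda>j. X j w)) = E (\<lambda>w. E (\<lambda>w'. g (\<lambda>j. if j < m then X j w else X j w')))"
    if g: "g \<in> C_lLip_tuple (Suc m)" for g
  proof -
    have "E (\<lambda>w. g ((\<lambda>i. X i w)(m := X m w))) = E (\<lambda>w. E (\<lambda>w'. g ((\<lambda>i. X i w)(m := X m w'))))"
      using indep[of m] g unfolding independent_to_def by blast
    moreover have "g ((\<lambda>i. X i w)(m := X m w)) = g (\<lambda>j. X j w)" for w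
      by (rule C_lLip_tuple_cong[OF g]) auto
    moreover have "g ((\<lambda>i. X i w)(m := X m w')) = g (\<lambda>j. if j < m then X j w else X j w')" for w w'
      by (rule C_lLip_tuple_cong[OF g]) (auto simp: less_Suc_eq)
    ultimately show ?thesis by simp
  qed
  \<comment> \<open>The one-step identity is used for \<open>\<phi>\<close> with its first
    \<open>i\<close> coordinates frozen at \<open>w\<close>, so that the inner expectation, too, is
    expressed by \<open>\<psi>\<close>.\<close>
  have inner: "E (\<lambda>w'. \<phi> (\<lambda>j. if j < i then X j w else X j w')) = E (\<lambda>w'. \<psi> (\<lambda>j. if j < i then X j w else X j w'))" for w
  proof -
    have "E (\<lambda>w'. \<phi> (\<lambda>j. if j < i then X j w else X j w'))
      = E (\<lambda>w'. E (\<lambda>w''. \<phi> (\<lambda>j. if j < i then X j w else if j < m then X j w' else X j w'')))"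
      using ind[OF C_lLip_tuple_fix[OF step.prems, of i "\<lambda>j. X j w"]] .
    also have "\<dots> = E (\<lambda>w'. \<psi> (\<lambda>j. if j < i then X j w else X j w'))"
      unfolding \<psi>_def using step.hyps
      by (intro arg_cong[of _ _ E] ext arg_cong[of _ _ \<phi>]) auto
    finally show ?thesis .
  qed
  have "E (\<lambda>w. E (\<lambda>w'. \<phi> (\<lambda>j. if j < i then X j w else X j w'))) = E (\<lambda>w. \<psi> (\<lambda>j. X j w))"
    unfolding inner by (rule step.IH[OF \<psi>])
  also have "\<dots> = E (\<lambda>w. \<phi> (\<lambda>j. X j w))"
    unfolding \<psi>_def by (rule ind[OF step.prems, symmetric])
  finally show ?case .
qed

end

section \<open>Path space\<close>

text \<open>The clipped times \<open>min t u\<close> and \<open>max t u\<close> make one formula of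
  two cases: the bracket vanishes for \<open>t \<le> u\<close>, and for later \<open>t\<close> the
  first term rests at its value at \<open>u\<close>. Continuity then needs no gluing.\<close>

definition paste :: "real \<Rightarrow> 'd::finite path \<Rightarrow> 'd path \<Rightarrow> 'd path" where
  "paste u w w' = Bcontfun (\<lambda>t. B (min t u) w + (B (max t u) w' - B u w'))"

lemma continuous_on_B: "continuous_on A (\<lambda>t. B t w)"
  unfolding B_def using continuous_on_subset[of UNIV "apply_bcontfun w"] by simp

lemma norm_B_le: "norm (B t w) \<le> norm w"
  unfolding B_def by (rule norm_bounded)

lemma B_paste: "B t (paste u w w') = B (min t u) w + (B (max t u) w' - B u w')"
proof -
  have "(\<lambda>t. B (min t u) w + (B (max t u) w' - B u w')) \<in> bcontfun"
  proof (rule bcontfun_normI[of _ "norm w + norm w' + norm w'"])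
    have cont: "continuous_on UNIV (\<lambda>t. apply_bcontfun v (f t))" if "continuous_on UNIV f"
      for v :: "'a path" and f :: "real \<Rightarrow> real"
      using continuous_on_compose2[of UNIV "apply_bcontfun v" UNIV f] that by auto
    show "continuous_on UNIV (\<lambda>t. B (min t u) w + (B (max t u) w' - B u w'))"
      unfolding B_def by (intro continuous_on_add continuous_on_diff cont continuous_on_const
          continuous_on_min continuous_on_max continuous_on_id)
    fix t
    have "norm (B (min t u) w + (B (max t u) w' - B u w')) \<le> norm (B (min t u) w) + (norm (B (max t u) w') + norm (B u w'))"
      using norm_triangle_ineq4[of "B (max t u) w'" "B u w'"]
      by (intro order_trans[OF norm_triangle_ineq]) auto
    also have "\<dots> \<le> norm w + (norm w' + norm w')"
      by (intro add_mono norm_B_le)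
    finally show "norm (B (min t u) w + (B (max t u) w' - B u w')) \<le> norm w + norm w' + norm w'" by simp
  qed
  then show ?thesis unfolding paste_def by (simp add: B_def Bcontfun_inverse)
qed

lemma path_eqI: "(\<And>t. B t w = B t w') \<Longrightarrow> w = w'"
  unfolding B_def by (rule bcontfun_eqI) simp

lemma B_nonpos: "w \<in> Omega T \<Longrightarrow> t \<le> 0 \<Longrightarrow> B t w = 0"
  and B_ge_T: "w \<in> Omega T \<Longrightarrow> T \<le> t \<Longrightarrow> B t w = B T w"
  unfolding Omega_def B_def by blast+

lemma Omega_iff: "w \<in> Omega T \<longleftrightarrow> (\<forall>t\<le>0. B t w = 0) \<and> (\<forall>t\<ge>T. B t w = B T w)"
  by (simp add: Omega_def B_def)

lemma paste_in_Omega: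
  assumes "w \<in> Omega T" "w' \<in> Omega T" "0 \<le> u" "u \<le> T"
  shows "paste u w w' \<in> Omega T"
  unfolding Omega_iff
proof (intro conjI allI impI)
  fix t :: real
  show "B t (paste u w w') = 0" if "t \<le> 0"
    using that assms B_nonpos[OF assms(1), of t] by (simp add: B_paste min_def max_def)
  show "B t (paste u w w') = B T (paste u w w')" if "T \<le> t"
    using that assms B_ge_T[OF assms(1), of t] B_ge_T[OF assms(2), of t]
    by (cases "u = T") (auto simp: B_paste min_def max_def)
qed

text \<open>Associativity of pasting; combined with the unconditional identity \<open>E_CE\<close>
  it becomes the tower property.\<close>

lemma paste_paste: "u \<le> v \<Longrightarrow> paste v (paste u w w') w'' = paste u w (paste v w' w'')"
  by (rule path_eqI) (auto simp: B_paste min_def max_def)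

lemma paste_T: "w \<in> Omega T \<Longrightarrow> w' \<in> Omega T \<Longrightarrow> paste T w w' = w"
proof (rule path_eqI)
  fix t assume w: "w \<in> Omega T" "w' \<in> Omega T"
  show "B t (paste T w w') = B t w"
    using B_ge_T[OF w(1), of t] B_ge_T[OF w(2), of t] by (cases "t \<le> T") (simp_all add: B_paste)
qed

section \<open>Time grids and cylinder functions of the increments\<close>

lemma time_grid_less:
  assumes "time_grid T m s" "i < j" "j \<le> m"
  shows "s i < s j"
  using assms(2,3)
proof (induction j)
  case (Suc j)
  have "s j < s (Suc j)" using assms(1) Suc.prems unfolding time_grid_def by auto
  with Suc show ?case by (cases "i = j") auto
qed simp

lemma time_grid_le: "time_grid T m s \<Longrightarrow> i \<le> j \<Longrightarrow> j \<le> m \<Longrightarrow> s i \<le> s j"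
  using time_grid_less[of T m s i j] by (cases "i = j") auto

lemma time_grid_bounds:
  assumes "time_grid T m s" "i \<le> m"
  shows "0 \<le> s i" "s i \<le> T"
  using assms time_grid_le[of T m s 0 i] time_grid_le[of T m s i m] unfolding time_grid_def by auto

text \<open>A sorted list without repetitions is strictly increasing; 0 is inserted because a grid
  has to start there.\<close>

lemma time_grid_exists:
  assumes "finite F" "F \<subseteq> {0..T}" "0 \<le> T"
  shows "\<exists>m s. time_grid T m s \<and> F \<subseteq> s ` {..m}"
proof -
  define l where "l = sorted_list_of_set (insert 0 F)"
  have l: "set l = insert 0 F" "sorted l" "distinct l" unfolding l_def using assms(1)
    by (simp_all only: set_sorted_list_of_set finite_insert sorted_sorted_list_of_set distinct_sorted_list_of_set)
  then have ne: "l \<noteq> []" by auto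
  define m where "m = length l - 1"
  have len: "length l = Suc m" using ne by (cases l) (auto simp: m_def)
  have set_l: "set l = (!) l ` {..m}" by (auto simp: set_conv_nth len image_iff less_Suc_eq_le)
  have "l ! 0 = 0"
  proof -
    obtain k where k: "k \<le> m" "l ! k = 0" using equalityD1[OF set_l] l(1) by fastforce
    have "l ! 0 \<le> l ! k" using l(2) k len by (intro sorted_nth_mono) auto
    moreover have "0 \<le> l ! 0" using l(1) assms(2) nth_mem[of 0 l] len by auto
    ultimately show ?thesis using k by simp
  qed
  moreover have "l ! i < l ! Suc i" if "i < m" for i
  proof -
    have "l ! i \<le> l ! Suc i" using l(2) that len by (intro sorted_nth_mono) auto
    moreover have "l ! i \<noteq> l ! Suc i" using l(3) that len nth_eq_iff_index_eq[of l i "Suc i"] by auto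
    ultimately show ?thesis by simp
  qed
  moreover have "l ! m \<le> T" using l(1) assms(2,3) nth_mem[of m l] len by auto
  ultimately have "time_grid T m ((!) l)" by (simp add: time_grid_def)
  moreover have "F \<subseteq> (!) l ` {..m}" using l(1) set_l by auto
  ultimately show ?thesis by blast
qed

lemma B_eq_sum_increments:
  assumes "time_grid T m s" "w \<in> Omega T"
  shows "B (s k) w = (\<Sum>j<k. increment s w j)"
  using sum_lessThan_telescope[of "\<lambda>j. B (s j) w" k] assms B_nonpos[of w T 0]
  by (simp add: increment_def time_grid_def)

text \<open>Values at grid times are partial sums of increments, which is a Lipschitz change of
  coordinates.\<close>

lemma cylinder_on_grid:
  fixes \<phi> :: "(nat \<Rightarrow> real^'d) \<Rightarrow> real"
  assumes "time_grid T m s" "\<phi> \<in> C_lLip_tuple n" "\<forall>i<n. t i \<in> s ` {..m}"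
  shows "\<exists>g\<in>C_lLip_tuple m. \<forall>w\<in>Omega T. \<phi> (\<lambda>i. B (t i) w) = g (increment s w)"
proof -
  have "\<forall>i<n. \<exists>k\<le>m. t i = s k" using assms(3) by auto
  then obtain k where k: "\<And>i. i < n \<Longrightarrow> k i \<le> m" "\<And>i. i < n \<Longrightarrow> t i = s (k i)" by metis
  show ?thesis
  proof (rule bexI[where x = "\<lambda>x. \<phi> (\<lambda>i. \<Sum>j<k i. x j)"], intro ballI)
    fix w :: "'d path" assume w: "w \<in> Omega T"
    show "\<phi> (\<lambda>i. B (t i) w) = \<phi> (\<lambda>i. \<Sum>j<k i. increment s w j)"
      by (rule C_lLip_tuple_cong[OF assms(2)]) (simp add: k(2) B_eq_sum_increments[OF assms(1) w])
  next
    show "(\<lambda>x. \<phi> (\<lambda>i. \<Sum>j<k i. x j)) \<in> C_lLip_tuple m"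
    proof (rule C_lLip_tuple_Lipschitz_comp[OF assms(2)])
      fix x y :: "nat \<Rightarrow> real^'d" and i assume "i < n"
      have "norm ((\<Sum>j<k i. x j) - (\<Sum>j<k i. y j)) \<le> (\<Sum>j<k i. norm (x j - y j))"
        by (simp add: sum_subtractf[symmetric] sum_norm_le)
      also have "\<dots> \<le> (\<Sum>j<m. norm (x j - y j))"
        using k(1)[OF \<open>i < n\<close>] by (intro sum_mono2) auto
      also have "\<dots> \<le> real m * tuple_norm m (\<lambda>i. x i - y i)"
        using sum_bounded_above[of "{..<m}" "\<lambda>j. norm (x j - y j)" "tuple_norm m (\<lambda>i. x i - y i)"]
          norm_le_tuple_norm[of _ m "\<lambda>i. x i - y i"] by simp
      finally show "norm ((\<Sum>j<k i. x j) - (\<Sum>j<k i. y j)) \<le> real m * tuple_norm m (\<lambda>i. x i - y i)" .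
    qed
  qed
qed

text \<open>The extra set \<open>F\<close> puts a conditioning time on the grid, so that no
  increment straddles it.\<close>

lemma H0_gridE:
  fixes X :: "'d::finite path \<Rightarrow> real"
  assumes "X \<in> H0 T" "finite F" "F \<subseteq> {0..T}" "0 \<le> T"
  obtains m s \<phi> where "time_grid T m s" "F \<subseteq> s ` {..m}" "\<phi> \<in> C_lLip_tuple m"
    "\<And>w. w \<in> Omega T \<Longrightarrow> X w = \<phi> (increment s w)"
proof -
  obtain n t and \<psi> :: "(nat \<Rightarrow> real^'d) \<Rightarrow> real" where t: "\<forall>i<n. t i \<in> {0..T}" "\<psi> \<in> C_lLip_tuple n"
    "\<forall>w\<in>Omega T. X w = \<psi> (\<lambda>i. B (t i) w)"
    using assms(1) unfolding H0_def by blast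
  obtain m s where s: "time_grid T m s" "F \<union> t ` {..<n} \<subseteq> s ` {..m}"
  proof -
    have "t ` {..<n} \<subseteq> {0..T}" using t(1) by blast
    then show ?thesis
      using that time_grid_exists[of "F \<union> t ` {..<n}" T] assms(2-4) by auto
  qed
  then have "\<forall>i<n. t i \<in> s ` {..m}" by auto
  from cylinder_on_grid[OF s(1) t(2) this] obtain g where g: "g \<in> C_lLip_tuple m"
     "\<forall>w\<in>Omega T. \<psi> (\<lambda>i. B (t i) w) = g (increment s w)" by blast
  with s t(3) show ?thesis using that[of m s g] by simp
qed

lemma H0_gridI:
  fixes X :: "'d::finite path \<Rightarrow> real"
  assumes s: "time_grid T m s" and \<phi>: "\<phi> \<in> C_lLip_tuple m"
    and X: "\<And>w. w \<in> Omega T \<Longrightarrow> X w = \<phi> (increment s w)"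
  shows "X \<in> H0 T"
  unfolding H0_def
\<comment> \<open>The \<open>m\<close> increments need \<open>Suc m\<close> path values; this also
  meets the demand \<open>n \<ge> 1\<close> when \<open>m = 0\<close>.\<close>
proof (intro CollectI exI[of _ "Suc m"] conjI exI[of _ s] exI[of _ "\<lambda>x. \<phi> (\<lambda>j. x (Suc j) - x j)"] ballI allI impI)
  show "s i \<in> {0..T}" if "i < Suc m" for i using time_grid_bounds[OF s] that by auto
  show "X w = \<phi> (\<lambda>j. B (s (Suc j)) w - B (s j) w)" if "w \<in> Omega T" for w
    using X[OF that] by (simp add: increment_def[abs_def])
  show "(\<lambda>x. \<phi> (\<lambda>j. x (Suc j) - x j)) \<in> C_lLip_tuple (Suc m)"
  proof (rule C_lLip_tuple_Lipschitz_comp[OF \<phi>])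
    fix x y :: "nat \<Rightarrow> real^'d" and i assume i: "i < m"
    have "(x (Suc i) - x i) - (y (Suc i) - y i) = (x (Suc i) - y (Suc i)) - (x i - y i)" by simp
    then have "norm ((x (Suc i) - x i) - (y (Suc i) - y i)) \<le> norm (x (Suc i) - y (Suc i)) + norm (x i - y i)"
      by (metis norm_triangle_ineq4)
    then show "norm ((x (Suc i) - x i) - (y (Suc i) - y i)) \<le> 2 * tuple_norm (Suc m) (\<lambda>i. x i - y i)"
      using norm_le_tuple_norm[of i "Suc m" "\<lambda>i. x i - y i"] norm_le_tuple_norm[of "Suc i" "Suc m" "\<lambda>i. x i - y i"] i
      by simp
  qed
qed simp

lemma H0_comp: "F \<in> C_lLip \<Longrightarrow> X \<in> H0 T \<Longrightarrow> (\<lambda>w. F (X w)) \<in> H0 T"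
  unfolding H0_def by clarsimp (metis C_lLip_comp_tuple)

lemma H0_cong: "X \<in> H0 T \<Longrightarrow> (\<And>w. w \<in> Omega T \<Longrightarrow> X w = Y w) \<Longrightarrow> Y \<in> H0 T"
  unfolding H0_def by auto

lemma L_ip_subset_H0: "L_ip T \<subseteq> H0 T"
  unfolding L_ip_def H0_def by clarsimp (metis C_bLip_tuple_subset subsetD)

lemma increment_paste:
  assumes "time_grid T m s" "i \<le> m" "j < m"
  shows "increment s (paste (s i) w w') j = (if j < i then increment s w j else increment s w' j)"
proof (cases "j < i")
  case True
  then have "s j \<le> s i" "s (Suc j) \<le> s i" using assms by (auto intro!: time_grid_le[of T m s])
  with True show ?thesis by (simp add: increment_def B_paste min_def max_def)
next
  case False
  then have "s i \<le> s j" "s i \<le> s (Suc j)" using assms by (auto intro!: time_grid_le[of T m s])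
  with False show ?thesis by (auto simp add: increment_def B_paste min_def max_def)
qed

section \<open>Conditional \<open>G\<close>-expectation\<close>

locale G_expectation_space =
  fixes T :: real and S :: "'w set" and H :: "('w \<Rightarrow> real) set" and E' :: "('w \<Rightarrow> real) \<Rightarrow> real"
    and G :: "real^'d^'d \<Rightarrow> real" and \<xi> :: "nat \<Rightarrow> 'w \<Rightarrow> real^'d"
    and E :: "('d path \<Rightarrow> real) \<Rightarrow> real"
  assumes T_pos: "0 < T"
    and sublinear_base: "sublinear_expectation S H E'"
    and iid: "iid_G_normal G H E' \<xi>"
    and G_exp: "G_expectation T E' \<xi> E"
begin

sublocale base: sublinear S H E'
  by standard (rule sublinear_base)

sublocale GE: sublinear "Omega T" "H0 T" E
  by standard (use G_exp in \<open>simp add: G_expectation_def\<close>)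

abbreviation scaled_noise :: "(nat \<Rightarrow> real) \<Rightarrow> nat \<Rightarrow> 'w \<Rightarrow> real^'d" where
  "scaled_noise s j w \<equiv> sqrt (s (Suc j) - s j) *\<^sub>R \<xi> j w"

lemma E_grid:
  assumes "time_grid T m s" "\<phi> \<in> C_lLip_tuple m"
  shows "E (\<lambda>w. \<phi> (increment s w)) = E' (\<lambda>w. \<phi> (\<lambda>j. scaled_noise s j w))"
  using G_exp assms unfolding G_expectation_def by blast

lemma C_lLip_tuple_scale_coords:
  fixes \<phi> :: "(nat \<Rightarrow> 'a::real_normed_vector) \<Rightarrow> real"
  assumes "\<phi> \<in> C_lLip_tuple n"
  shows "(\<lambda>x. \<phi> (\<lambda>i. c i *\<^sub>R x i)) \<in> C_lLip_tuple n"
proof (rule C_lLip_tuple_Lipschitz_comp[OF assms])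
  fix x y :: "nat \<Rightarrow> 'a" and i assume "i < n"
  then have "\<bar>c i\<bar> * norm (x i - y i) \<le> (\<Sum>i<n. \<bar>c i\<bar>) * tuple_norm n (\<lambda>i. x i - y i)"
    using norm_le_tuple_norm[of i n "\<lambda>i. x i - y i"]
    by (intro mult_mono member_le_sum sum_nonneg) auto
  then show "norm (c i *\<^sub>R x i - c i *\<^sub>R y i) \<le> (\<Sum>i<n. \<bar>c i\<bar>) * tuple_norm n (\<lambda>i. x i - y i)"
    by (simp flip: scaleR_diff_right)
qed

lemma random_tuple_scaled_noise: "random_tuple H m (scaled_noise s)"
  unfolding random_tuple_def
proof
  fix \<phi> :: "(nat \<Rightarrow> real^'d) \<Rightarrow> real" assume "\<phi> \<in> C_lLip_tuple m"
  moreover have "random_tuple H m \<xi>" using iid by (simp add: iid_G_normal_def)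
  ultimately show "(\<lambda>w. \<phi> (\<lambda>i. scaled_noise s i w)) \<in> H"
    by (intro base.random_tuple_mem[of m \<xi>, OF _ C_lLip_tuple_scale_coords])
qed

text \<open>The deterministic factors are absorbed into the test function.\<close>

lemma independent_scaled_noise: "independent_to E' i (scaled_noise s) (scaled_noise s i)"
  unfolding independent_to_def
proof
  fix \<phi> :: "(nat \<Rightarrow> real^'d) \<Rightarrow> real" assume \<phi>: "\<phi> \<in> C_lLip_tuple (Suc i)"
  let ?c = "\<lambda>j. sqrt (s (Suc j) - s j)"
  have ind: "independent_to E' i \<xi> (\<xi> i)" using iid by (simp add: iid_G_normal_def)
  have upd: "(\<lambda>j. scaled_noise s j w)(i := scaled_noise s i w') = (\<lambda>j. ?c j *\<^sub>R ((\<lambda>j. \<xi> j w)(i := \<xi> i w')) j)" for w w'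
    by auto
  show "E' (\<lambda>w. \<phi> ((\<lambda>j. scaled_noise s j w)(i := scaled_noise s i w)))
     = E' (\<lambda>w. E' (\<lambda>w'. \<phi> ((\<lambda>j. scaled_noise s j w)(i := scaled_noise s i w'))))"
    unfolding upd
    by (rule bspec[OF ind[unfolded independent_to_def] C_lLip_tuple_scale_coords[OF \<phi>, of ?c]])
qed

definition CE :: "real \<Rightarrow> ('d path \<Rightarrow> real) \<Rightarrow> 'd path \<Rightarrow> real" where
  "CE u X w = E (\<lambda>w'. X (paste u w w'))"

lemma paste_on_grid:
  assumes s: "time_grid T m s" "i \<le> m" and \<phi>: "\<phi> \<in> C_lLip_tuple m"
    and X: "\<And>w. w \<in> Omega T \<Longrightarrow> X w = \<phi> (increment s w)"
    and w: "w \<in> Omega T" "w' \<in> Omega T"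
  shows "X (paste (s i) w w') = \<phi> (\<lambda>j. if j < i then increment s w j else increment s w' j)"
proof -
  have "X (paste (s i) w w') = \<phi> (increment s (paste (s i) w w'))"
    using w time_grid_bounds[OF s] by (intro X paste_in_Omega)
  also have "\<dots> = \<phi> (\<lambda>j. if j < i then increment s w j else increment s w' j)"
    by (rule C_lLip_tuple_cong[OF \<phi>]) (rule increment_paste[OF s])
  finally show ?thesis .
qed

lemma paste_mem:
  assumes "X \<in> H0 T" "0 \<le> u" "u \<le> T" "w \<in> Omega T"
  shows "(\<lambda>w'. X (paste u w w')) \<in> H0 T"
proof -
  obtain m s \<phi> where s: "time_grid T m s" "{u} \<subseteq> s ` {..m}" "\<phi> \<in> C_lLip_tuple m"
    "\<And>w. w \<in> Omega T \<Longrightarrow> X w = \<phi> (increment s w)"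
    by (rule H0_gridE[OF assms(1), of "{u}"]) (use assms T_pos in auto)
  then obtain i where i: "i \<le> m" "u = s i" by auto
  show ?thesis
    by (rule H0_gridI[OF s(1) C_lLip_tuple_fix[OF s(3), of i "increment s w"]])
      (simp only: i(2) paste_on_grid[OF s(1) i(1) s(3,4) assms(4)])
qed

text \<open>The first form matches the definition of \<open>G_cond_exp\<close>; the second moves the
  remaining increments to the noise sequence, where independence is available.\<close>

lemma CE_on_grid:
  assumes s: "time_grid T m s" "i \<le> m" and \<phi>: "\<phi> \<in> C_lLip_tuple m"
    and X: "\<And>w. w \<in> Omega T \<Longrightarrow> X w = \<phi> (increment s w)"
    and w: "w \<in> Omega T"
  shows "CE (s i) X w = E (\<lambda>w'. \<phi> (\<lambda>j. if j < i then increment s w j else increment s w' j))"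
    and "CE (s i) X w = E' (\<lambda>w'. \<phi> (\<lambda>j. if j < i then increment s w j else scaled_noise s j w'))"
proof -
  note fixed = C_lLip_tuple_fix[OF \<phi>, of i "increment s w"]
  have "X \<in> H0 T" by (rule H0_gridI[OF s(1) \<phi> X])
  show *: "CE (s i) X w = E (\<lambda>w'. \<phi> (\<lambda>j. if j < i then increment s w j else increment s w' j))"
    unfolding CE_def
  proof (rule GE.cong)
    show "(\<lambda>w'. X (paste (s i) w w')) \<in> H0 T"
      using paste_mem[OF \<open>X \<in> H0 T\<close>] time_grid_bounds[OF s] w by blast
    show "(\<lambda>w'. \<phi> (\<lambda>j. if j < i then increment s w j else increment s w' j)) \<in> H0 T"
      by (rule H0_gridI[OF s(1) fixed]) simp
  qed (rule paste_on_grid[OF s \<phi> X w])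
  show "CE (s i) X w = E' (\<lambda>w'. \<phi> (\<lambda>j. if j < i then increment s w j else scaled_noise s j w'))"
    unfolding * by (rule E_grid[OF s(1) fixed])
qed

text \<open>Every admissible representation yields \<open>CE u X w\<close>, a value that mentions no
  representation. That is the uniqueness behind the \<open>THE\<close>; existence comes from a grid
  through \<open>u\<close>.\<close>

lemma G_cond_exp_eq:
  assumes "X \<in> H0 T" "0 \<le> u" "u \<le> T" "w \<in> Omega T"
  shows "G_cond_exp T E u X w = CE u X w"
  unfolding G_cond_exp_def
proof (rule the_equality)
  obtain m s \<phi> where s: "time_grid T m s" "{u} \<subseteq> s ` {..m}" "\<phi> \<in> C_lLip_tuple m"
    "\<And>w. w \<in> Omega T \<Longrightarrow> X w = \<phi> (increment s w)"
    by (rule H0_gridE[OF assms(1), of "{u}"]) (use assms T_pos in auto)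
  then obtain i where i: "i \<le> m" "u = s i" by auto
  show "\<exists>m s i \<phi>. time_grid T m s \<and> i \<le> m \<and> s i = u \<and> \<phi> \<in> C_lLip_tuple m \<and>
      (\<forall>w'\<in>Omega T. X w' = \<phi> (increment s w')) \<and>
      CE u X w = E (\<lambda>w'. \<phi> (\<lambda>j. if j < i then increment s w j else increment s w' j))"
    using s i CE_on_grid(1)[OF s(1) i(1) s(3,4) assms(4)] by blast
next
  fix r
  assume "\<exists>m s i \<phi>. time_grid T m s \<and> i \<le> m \<and> s i = u \<and> \<phi> \<in> C_lLip_tuple m \<and>
      (\<forall>w'\<in>Omega T. X w' = \<phi> (increment s w')) \<and>
      r = E (\<lambda>w'. \<phi> (\<lambda>j. if j < i then increment s w j else increment s w' j))"
  then show "r = CE u X w" using CE_on_grid(1)[OF _ _ _ _ assms(4)] by auto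
qed

text \<open>Independence is assumed for the noise under \<open>E'\<close>, so both expectations are
  transferred there, where \<open>independent_tower\<close> equates them. The partial expectation
  \<open>\<psi>\<close> is again a test function, which gives the membership.\<close>

lemma CE_mem_and_tower:
  assumes "X \<in> H0 T" "0 \<le> u" "u \<le> T"
  shows CE_mem: "CE u X \<in> H0 T" and E_CE: "E (CE u X) = E X"
proof -
  obtain m s \<phi> where s: "time_grid T m s" "{u} \<subseteq> s ` {..m}" "\<phi> \<in> C_lLip_tuple m"
    "\<And>w. w \<in> Omega T \<Longrightarrow> X w = \<phi> (increment s w)"
    by (rule H0_gridE[OF assms(1), of "{u}"]) (use assms T_pos in auto)
  then obtain i where i: "i \<le> m" "u = s i" by auto
  define \<psi> where "\<psi> x = E' (\<lambda>w'. \<phi> (\<lambda>j. if j < i then x j else scaled_noise s j w'))" for x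
  have "\<psi> \<in> C_lLip_tuple i"
    unfolding \<psi>_def by (rule base.C_lLip_tuple_partial_expectation[OF random_tuple_scaled_noise s(3) i(1)])
  then have \<psi>: "\<psi> \<in> C_lLip_tuple m" using i(1) by (rule C_lLip_tuple_mono)
  have eq: "CE u X w = \<psi> (increment s w)" if "w \<in> Omega T" for w
    unfolding \<psi>_def i(2) by (rule CE_on_grid(2)[OF s(1) i(1) s(3,4) that])
  show mem: "CE u X \<in> H0 T"
    by (rule H0_gridI[OF s(1) \<psi> eq])
  have "E (CE u X) = E (\<lambda>w. \<psi> (increment s w))"
    by (rule GE.cong[OF mem H0_gridI[OF s(1) \<psi>] eq]) auto
  also have "\<dots> = E' (\<lambda>w. \<psi> (\<lambda>j. scaled_noise s j w))" by (rule E_grid[OF s(1) \<psi>])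
  also have "\<dots> = E' (\<lambda>w. \<phi> (\<lambda>j. scaled_noise s j w))"
    unfolding \<psi>_def
    by (rule base.independent_tower[OF random_tuple_scaled_noise independent_scaled_noise i(1) s(3)])
  also have "\<dots> = E (\<lambda>w. \<phi> (increment s w))" by (rule E_grid[OF s(1,3), symmetric])
  also have "\<dots> = E X"
    by (rule GE.cong[OF H0_gridI[OF s(1,3)] assms(1)]) (use s(4) in auto)
  finally show "E (CE u X) = E X" .
qed

text \<open>With \<open>w\<close> frozen up to time \<open>u\<close>, the map from \<open>w'\<close>
  to \<open>X (paste u w w')\<close> is itself in \<open>H0 T\<close>, and the unconditional
  identity \<open>E_CE\<close> at time \<open>v\<close> applies to it.\<close>

lemma CE_CE:
  assumes "X \<in> H0 T" "0 \<le> u" "u \<le> v" "v \<le> T" "w \<in> Omega T"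
  shows "CE u (CE v X) w = CE u X w"
proof -
  have "CE u (CE v X) w = E (\<lambda>w'. E (\<lambda>w''. X (paste u w (paste v w' w''))))"
    unfolding CE_def using assms by (simp add: paste_paste)
  also have "\<dots> = E (CE v (\<lambda>w'. X (paste u w w')))" by (simp add: CE_def[abs_def])
  also have "\<dots> = E (\<lambda>w'. X (paste u w w'))"
    using assms by (intro E_CE paste_mem) auto
  finally show ?thesis by (simp add: CE_def)
qed

lemma CE_T: "X \<in> H0 T \<Longrightarrow> w \<in> Omega T \<Longrightarrow> CE T X w = X w"
  using GE.cong[of "\<lambda>w'. X (paste T w w')" "\<lambda>_. X w"] paste_mem[of X T w] T_pos
  by (simp add: CE_def paste_T GE.const_mem)

lemma CE_mono:
  assumes "X \<in> H0 T" "Y \<in> H0 T" "0 \<le> u" "u \<le> T" "w \<in> Omega T"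
    and "\<And>w. w \<in> Omega T \<Longrightarrow> X w \<le> Y w"
  shows "CE u X w \<le> CE u Y w"
  unfolding CE_def using assms by (intro GE.mono paste_mem) (auto intro: paste_in_Omega)

end

section \<open>Doob's inequality\<close>

text \<open>As a function of \<open>a\<close>, the right side is the tangent at \<open>y\<close> to
  a concave power. After multiplication by \<open>y powr (1 - \<theta>)\<close> the claim is the
  weighted inequality of arithmetic and geometric means.\<close>

lemma powr_tangent_le:
  fixes a y \<theta> :: real
  assumes "0 < a" "0 < y" "0 < \<theta>" "\<theta> < 1"
  shows "a powr \<theta> \<le> (1 - \<theta>) * y powr \<theta> + \<theta> * y powr (\<theta> - 1) * a"
proof -
  have "a powr \<theta> * y powr (1 - \<theta>) \<le> \<theta> * a + (1 - \<theta>) * y"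
    using assms by (intro Youngs_inequality_0) auto
  then have "a powr \<theta> * y powr (1 - \<theta>) * y powr (\<theta> - 1) \<le> (\<theta> * a + (1 - \<theta>) * y) * y powr (\<theta> - 1)"
    by (rule mult_right_mono) simp
  moreover have "y powr (1 - \<theta>) * y powr (\<theta> - 1) = 1"
    using assms(2) by (simp flip: powr_add)
  moreover have "y * y powr (\<theta> - 1) = y powr \<theta>"
    using assms(2) by (simp add: powr_mult_base)
  ultimately show ?thesis by (simp add: algebra_simps)
qed

primrec running_max :: "(nat \<Rightarrow> 'a \<Rightarrow> real) \<Rightarrow> nat \<Rightarrow> 'a \<Rightarrow> real" where
  "running_max M 0 w = M 0 w"
| "running_max M (Suc k) w = max (running_max M k w) (M (Suc k) w)"

lemma running_max_ge: "i \<le> n \<Longrightarrow> M i w \<le> running_max M n w"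
  by (induction n) (auto simp: le_Suc_eq max_def)

lemma running_max_attained: "\<exists>i\<le>n. running_max M n w = M i w"
proof (induction n)
  case (Suc n)
  then obtain i where "i \<le> n" "running_max M n w = M i w" by blast
  then show ?case by (cases "M i w \<le> M (Suc n) w") (auto simp: max_def intro: exI[of _ "Suc n"] exI[of _ i])
qed auto

text \<open>
  The choice \<open>c = \<theta> / (1 - \<theta>)\<close> makes \<open>s powr \<theta> + c * s powr (\<theta> - 1) * m\<close> decrease when \<open>s\<close> jumps
  up to \<open>m\<close>, so this function of the running maximum and the current value is a supermartingale.
\<close>

lemma Doob_pointwise:
  fixes s m \<theta> c :: real
  assumes "0 < s" "0 < m" "0 < \<theta>" "\<theta> < 1" and c: "c = \<theta> / (1 - \<theta>)"
  shows "max s m powr \<theta> + c * max s m powr (\<theta> - 1) * m \<le> s powr \<theta> + c * s powr (\<theta> - 1) * m"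
proof (cases "m \<le> s")
  case False
  \<comment> \<open>For \<open>m\<close> above \<open>s\<close> the left side of the goal collapses
    to \<open>m powr \<theta> / (1 - \<theta>)\<close>, since
    \<open>1 + c = 1 / (1 - \<theta>)\<close>. What remains is the tangent inequality at
    \<open>s\<close>, divided by \<open>1 - \<theta>\<close>.\<close>
  have "m powr \<theta> / (1 - \<theta>) \<le> ((1 - \<theta>) * s powr \<theta> + \<theta> * s powr (\<theta> - 1) * m) / (1 - \<theta>)"
    using assms by (intro divide_right_mono powr_tangent_le) auto
  also have "\<dots> = s powr \<theta> + c * s powr (\<theta> - 1) * m"
    using assms by (simp add: add_divide_distrib)
  finally have *: "m powr \<theta> / (1 - \<theta>) \<le> s powr \<theta> + c * s powr (\<theta> - 1) * m" .
  have "m powr \<theta> + c * m powr (\<theta> - 1) * m = m powr \<theta> + c * m powr \<theta>"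
    using assms powr_mult_base[of m "\<theta> - 1"] by (simp add: mult_ac)
  also have "\<dots> = m powr \<theta> * (1 + c)" by (simp add: algebra_simps)
  also have "1 + c = 1 / (1 - \<theta>)" using assms by (simp add: field_simps)
  finally show ?thesis using * False by simp
qed simp

lemma paste_0: "w \<in> Omega T \<Longrightarrow> w' \<in> Omega T \<Longrightarrow> paste 0 w w' = w'"
  by (rule path_eqI) (auto simp: B_paste min_def max_def B_nonpos)

text \<open>The outer pasting replaces everything after \<open>u\<close>, so changes after
  \<open>v\<close> disappear. This is the adaptedness of conditional expectations.\<close>

lemma paste_paste_earlier: "u \<le> v \<Longrightarrow> paste u (paste v w w') w'' = paste u w w''"
  by (rule path_eqI) (simp add: B_paste min_def max_def)

section \<open>The maximal inequality along a finite sequence of times\<close>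

context G_expectation_space begin

text \<open>Polarization reduces the product to squares, so composition with scalar functions
  suffices and no common grid has to be chosen.\<close>

lemma H0_mult:
  fixes X Y :: "'d path \<Rightarrow> real"
  assumes X: "X \<in> H0 T" and Y: "Y \<in> H0 T"
  shows "(\<lambda>w. X w * Y w) \<in> H0 T"
proof -
  have "(\<lambda>w. 1 / 4 * ((X w + Y w)\<^sup>2 - (X w - Y w)\<^sup>2)) \<in> H0 T"
    using X Y by (intro GE.scale_mem GE.diff_mem GE.add_mem H0_comp[OF C_lLip_power])
  then show ?thesis by (rule H0_cong) (simp add: power2_eq_square algebra_simps)
qed

lemma H0_max:
  fixes X Y :: "'d path \<Rightarrow> real"
  assumes X: "X \<in> H0 T" and Y: "Y \<in> H0 T"
  shows "(\<lambda>w. max (X w) (Y w)) \<in> H0 T"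
proof -
  have "(\<lambda>w. 1 / 2 * ((X w + Y w) + \<bar>X w - Y w\<bar>)) \<in> H0 T"
    using X Y by (intro GE.scale_mem GE.diff_mem GE.add_mem H0_comp[OF C_lLip_abs])
  then show ?thesis by (rule H0_cong) (simp add: max_def)
qed

lemma H0_powr:
  assumes "X \<in> H0 T" "\<And>w. w \<in> Omega T \<Longrightarrow> e \<le> X w" "0 < e" "q \<le> 1"
  shows "(\<lambda>w. X w powr q) \<in> H0 T"
  using H0_comp[OF C_lLip_max_powr[OF assms(4,3)] assms(1)]
  by (rule H0_cong) (use assms(2) in \<open>simp add: max_absorb1\<close>)

lemma running_max_mem:
  fixes M :: "nat \<Rightarrow> 'd path \<Rightarrow> real"
  shows "(\<And>k. k \<le> n \<Longrightarrow> M k \<in> H0 T) \<Longrightarrow> running_max M n \<in> H0 T"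
proof (induction n)
  case 0
  then show ?case using H0_cong[of "M 0" T "running_max M 0"] by simp
next
  case (Suc n)
  then have "(\<lambda>w. max (running_max M n w) (M (Suc n) w)) \<in> H0 T" by (intro H0_max) auto
  then show ?case by (rule H0_cong) simp
qed

lemma CE_0: "X \<in> H0 T \<Longrightarrow> w \<in> Omega T \<Longrightarrow> CE 0 X w = E X"
  unfolding CE_def using T_pos by (intro GE.cong paste_mem) (auto simp: paste_0)

lemma CE_paste: "u \<le> v \<Longrightarrow> CE u X (paste v w w') = CE u X w"
  by (simp add: CE_def paste_paste_earlier)

text \<open>Conditioning at \<open>u\<close> sees \<open>A\<close> and \<open>D\<close> as
  constants, since pasting at \<open>u\<close> leaves them unchanged. The sign of \<open>D\<close>
  matters because \<open>E\<close> is homogeneous for nonnegative factors only.\<close>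

lemma E_le_CE_affine:
  assumes "A \<in> H0 T" "D \<in> H0 T" "X \<in> H0 T" "0 \<le> u" "u \<le> T"
    and adapted: "\<And>w w'. A (paste u w w') = A w" "\<And>w w'. D (paste u w w') = D w"
    and D: "\<And>w. w \<in> Omega T \<Longrightarrow> 0 \<le> D w"
  shows "E (\<lambda>w. A w + D w * X w) = E (\<lambda>w. A w + D w * CE u X w)"
proof -
  have mem: "(\<lambda>w. A w + D w * X w) \<in> H0 T" using assms by (intro GE.add_mem H0_mult)
  have "E (\<lambda>w. A w + D w * X w) = E (CE u (\<lambda>w. A w + D w * X w))"
    using E_CE[OF mem] assms by simp
  also have "\<dots> = E (\<lambda>w. A w + D w * CE u X w)"
  proof (intro GE.cong CE_mem mem GE.add_mem H0_mult assms)
    fix w :: "'d path" assume w: "w \<in> Omega T"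
    show "CE u (\<lambda>w. A w + D w * X w) w = A w + D w * CE u X w"
      unfolding CE_def adapted using assms w by (intro GE.affine paste_mem D)
  qed
  finally show ?thesis .
qed

text \<open>The expectation of \<open>v k\<close>, the combination from
  \<open>Doob_pointwise\<close>, cannot increase with \<open>k\<close>: the jump of the maximum is
  paid for pointwise, and conditioning at \<open>u k\<close> then turns \<open>M (Suc k)\<close>
  into \<open>M k\<close>. The lower bound \<open>e\<close> keeps the maximum away from 0, where its
  negative power is singular.\<close>

lemma Doob_discrete:
  assumes Y: "Y \<in> H0 T" "\<And>w. w \<in> Omega T \<Longrightarrow> e \<le> Y w" and e: "0 < e"
    and \<theta>: "0 < \<theta>" "\<theta> < 1"
    and u: "u 0 = 0" "\<And>i j. i \<le> j \<Longrightarrow> j \<le> n \<Longrightarrow> u i \<le> u j" "u n \<le> T"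
  shows "E (\<lambda>w. running_max (\<lambda>k. CE (u k) Y) n w powr \<theta>) \<le> E Y powr \<theta> / (1 - \<theta>)"
proof -
  define M where "M k = CE (u k) Y" for k
  define R where "R = running_max M"
  define c where "c = \<theta> / (1 - \<theta>)"
  define v where "v k w = R k w powr \<theta> + (c * R k w powr (\<theta> - 1)) * M k w" for k w
  have c: "0 < c" using \<theta> by (simp add: c_def)
  have u_bounds: "0 \<le> u k" "u k \<le> T" if "k \<le> n" for k
    using u(2)[of 0 k] u(2)[of k n] u(1,3) that by auto
  have M: "M k \<in> H0 T" if "k \<le> n" for k
    unfolding M_def using u_bounds[OF that] Y by (intro CE_mem) auto
  have M_ge: "e \<le> M k w" if "k \<le> n" "w \<in> Omega T" for k w
    using CE_mono[of "\<lambda>_. e" Y "u k" w] u_bounds[OF that(1)] Y that(2)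
    by (simp add: M_def CE_def GE.const_mem)
  have R: "R k \<in> H0 T" if "k \<le> n" for k
    unfolding R_def using that by (intro running_max_mem M) auto
  have R_ge: "e \<le> R k w" if "k \<le> n" "w \<in> Omega T" for k w
    using running_max_ge[of 0 k M w] M_ge[of 0 w] that by (auto simp: R_def)
  have R_powr: "(\<lambda>w. R k w powr q) \<in> H0 T" if "k \<le> n" "q \<le> 1" for k q
    using that by (intro H0_powr[OF R R_ge e]) auto
  have v: "v k \<in> H0 T" if "k \<le> n" for k
    unfolding v_def using that \<theta> by (intro GE.add_mem GE.scale_mem H0_mult R_powr M) auto
  have R_adapted: "R j (paste (u k) w w') = R j w" if "j \<le> k" "k \<le> n" for j k w w'
    using that
  proof (induction j)
    case 0
    then show ?case using CE_paste[of "u 0" "u k" Y w w'] u(2)[of 0 k] by (simp add: R_def M_def)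
  next
    case (Suc j)
    then show ?case using CE_paste[of "u (Suc j)" "u k" Y w w'] u(2)[of "Suc j" k]
      by (simp add: R_def M_def)
  qed
  have bound: "E (v k) \<le> E Y powr \<theta> / (1 - \<theta>)" if "k \<le> n" for k
    using that
  proof (induction k)
    case 0
    have EY: "0 < E Y" using M_ge[of 0] e GE.mono[of "\<lambda>_. e" Y] Y by (simp add: GE.const_mem)
    \<comment> \<open>At time 0 the maximum and the current value are both the constant
      \<open>E Y\<close>, so the bound holds with equality because
      \<open>1 + c = 1 / (1 - \<theta>)\<close>.\<close>
    have "E (v 0) = E (\<lambda>_. E Y powr \<theta> / (1 - \<theta>))"
    proof (intro GE.cong v GE.const_mem)
      fix w :: "'d path" assume w: "w \<in> Omega T"
      have M0: "M 0 w = E Y" using CE_0[OF Y(1) w] by (simp add: M_def u(1))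
      have "v 0 w = E Y powr \<theta> + c * (E Y * E Y powr (\<theta> - 1))"
        by (simp add: v_def R_def M0)
      also have "E Y * E Y powr (\<theta> - 1) = E Y powr \<theta>"
        using EY powr_mult_base[of "E Y" "\<theta> - 1"] by simp
      also have "E Y powr \<theta> + c * E Y powr \<theta> = E Y powr \<theta> / (1 - \<theta>)"
        using \<theta> by (simp add: c_def field_simps)
      finally show "v 0 w = E Y powr \<theta> / (1 - \<theta>)" .
    qed simp
    then show ?case by simp
  next
    case (Suc k)
    \<comment> \<open>The maximum steps back to \<open>R k\<close> while the current value stays
      \<open>M (Suc k)\<close>.\<close>
    have "E (v (Suc k)) \<le> E (\<lambda>w. R k w powr \<theta> + (c * R k w powr (\<theta> - 1)) * M (Suc k) w)"
    proof (intro GE.mono v GE.add_mem H0_mult GE.scale_mem R_powr M)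
      fix w :: "'d path" assume w: "w \<in> Omega T"
      have "max (R k w) (M (Suc k) w) powr \<theta> + c * max (R k w) (M (Suc k) w) powr (\<theta> - 1) * M (Suc k) w
         \<le> R k w powr \<theta> + c * R k w powr (\<theta> - 1) * M (Suc k) w"
        using R_ge[of k w] M_ge[of "Suc k" w] Suc.prems w e \<theta>
        by (intro Doob_pointwise) (auto simp: c_def)
      then show "v (Suc k) w \<le> R k w powr \<theta> + c * R k w powr (\<theta> - 1) * M (Suc k) w"
        by (simp add: v_def R_def)
    qed (use Suc.prems \<theta> in auto)
    \<comment> \<open>The coefficients now involve \<open>R k\<close> only, which is known at time
      \<open>u k\<close>.\<close>
    also have "\<dots> = E (\<lambda>w. R k w powr \<theta> + (c * R k w powr (\<theta> - 1)) * CE (u k) (M (Suc k)) w)"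
      using Suc.prems \<theta> c u_bounds[of k]
      by (intro E_le_CE_affine GE.scale_mem R_powr M) (auto simp: R_adapted)
    also have "\<dots> = E (v k)"
    proof (intro GE.cong v GE.add_mem H0_mult GE.scale_mem R_powr M CE_mem)
      fix w :: "'d path" assume w: "w \<in> Omega T"
      have "CE (u k) (M (Suc k)) w = M k w"
        unfolding M_def using Suc.prems w Y u(2)[of k "Suc k"] u_bounds[of k] u_bounds[of "Suc k"]
        by (intro CE_CE) auto
      then show "R k w powr \<theta> + c * R k w powr (\<theta> - 1) * CE (u k) (M (Suc k)) w = v k w"
        by (simp add: v_def)
    qed (use Suc.prems \<theta> u_bounds[of k] in auto)
    also have "\<dots> \<le> E Y powr \<theta> / (1 - \<theta>)" using Suc by simp
    finally show ?case .
  qed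
  \<comment> \<open>The term of \<open>v n\<close> that contains the martingale is nonnegative and
    is dropped.\<close>
  have "E (\<lambda>w. R n w powr \<theta>) \<le> E (v n)"
  proof (intro GE.mono R_powr v)
    fix w :: "'d path" assume w: "w \<in> Omega T"
    show "R n w powr \<theta> \<le> v n w"
      using M_ge[of n w] w c e by (simp add: v_def)
  qed (use \<theta> in auto)
  also have "\<dots> \<le> E Y powr \<theta> / (1 - \<theta>)" by (rule bound) simp
  finally show ?thesis by (simp add: R_def M_def[abs_def])
qed

text \<open>The power lies below its tangent at the conditional expectation \<open>y\<close>, and
  \<open>E\<close> is exact on affine functions with nonnegative slope; at its own base point the
  tangent returns \<open>y powr (1 / p)\<close>. The summand \<open>e\<close> makes the base point
  positive.\<close>

lemma CE_Jensen:
  assumes X: "X \<in> H0 T" "\<And>w. w \<in> Omega T \<Longrightarrow> 0 \<le> X w" and e: "0 < e" and p: "1 < p"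
    and u: "0 \<le> u" "u \<le> T" and w: "w \<in> Omega T"
  shows "CE u X w \<le> CE u (\<lambda>w. \<bar>X w\<bar> powr p + e) w powr (1 / p)"
proof -
  let ?Y = "\<lambda>w. \<bar>X w\<bar> powr p + e" and ?\<theta> = "1 / p"
  have Y: "?Y \<in> H0 T" using p X by (intro GE.add_mem GE.const_mem H0_comp[OF C_lLip_abs_powr]) auto
  have "e \<le> CE u ?Y w"
    using CE_mono[of "\<lambda>_. e" ?Y u w] Y u w by (simp add: CE_def GE.const_mem)
  define y where "y = CE u ?Y w"
  have y: "0 < y" using \<open>e \<le> CE u ?Y w\<close> e by (simp add: y_def)
  let ?c = "?\<theta> * y powr (?\<theta> - 1)"
  have "X v \<le> (1 - ?\<theta>) * y powr ?\<theta> + ?c * ?Y v" if "v \<in> Omega T" for v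
  proof -
    have "X v = (\<bar>X v\<bar> powr p) powr ?\<theta>" using X(2)[OF that] p by (simp add: powr_powr)
    also have "\<dots> \<le> ?Y v powr ?\<theta>" using p e by (intro powr_mono2) auto
    also have "\<dots> \<le> (1 - ?\<theta>) * y powr ?\<theta> + ?c * ?Y v"
      using e y p by (intro powr_tangent_le) (auto simp: add_nonneg_pos)
    finally show ?thesis .
  qed
  then have "CE u X w \<le> CE u (\<lambda>v. (1 - ?\<theta>) * y powr ?\<theta> + ?c * ?Y v) w"
    using X u w by (intro CE_mono GE.add_mem[OF GE.const_mem GE.scale_mem[OF Y]]) auto
  also have "\<dots> = (1 - ?\<theta>) * y powr ?\<theta> + ?c * y"
    unfolding CE_def y_def using p u w Y
    by (intro GE.affine[of _ "\<lambda>w'. ?Y (paste u w w')"] paste_mem) auto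
  also have "?c * y = ?\<theta> * y powr ?\<theta>"
    using y powr_mult_base[of y "?\<theta> - 1"] by (simp add: mult_ac)
  also have "(1 - ?\<theta>) * y powr ?\<theta> + ?\<theta> * y powr ?\<theta> = y powr ?\<theta>" by (simp add: algebra_simps)
  finally show ?thesis by (simp add: y_def)
qed

text \<open>Jensen's inequality at each time, then \<open>Doob_discrete\<close> with the exponent
  \<open>1 / p\<close>, for which \<open>1 / (1 - \<theta>)\<close> is the conjugate exponent of
  \<open>p\<close>.\<close>

lemma E_running_max_le:
  assumes X: "X \<in> H0 T" "\<And>w. w \<in> Omega T \<Longrightarrow> 0 \<le> X w" and p: "1 < p"
    and u: "u 0 = 0" "\<And>i j. i \<le> j \<Longrightarrow> j \<le> n \<Longrightarrow> u i \<le> u j" "u n \<le> T"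
  shows "E (running_max (\<lambda>k. CE (u k) X) n) \<le> p / (p - 1) * E (\<lambda>w. \<bar>X w\<bar> powr p) powr (1 / p)"
proof -
  let ?\<theta> = "1 / p" and ?Z = "\<lambda>w. \<bar>X w\<bar> powr p"
  have Z: "?Z \<in> H0 T" using p X by (intro H0_comp[OF C_lLip_abs_powr]) auto
  have u_bounds: "0 \<le> u k" "u k \<le> T" if "k \<le> n" for k
    using u(2)[of 0 k] u(2)[of k n] u(1,3) that by auto
  have const: "1 / (1 - ?\<theta>) = p / (p - 1)" using p by (simp add: field_simps)
  have eps: "E (running_max (\<lambda>k. CE (u k) X) n) \<le> p / (p - 1) * (E ?Z + e) powr ?\<theta>" if e: "0 < e" for e
  proof -
    define Y where "Y w = ?Z w + e" for w
    have Y: "Y \<in> H0 T" unfolding Y_def using Z by (intro GE.add_mem GE.const_mem)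
    have CE_Y: "e \<le> CE (u k) Y w" if "k \<le> n" "w \<in> Omega T" for k w
      using CE_mono[of "\<lambda>_. e" Y "u k" w] Y u_bounds[OF that(1)] that(2)
      by (simp add: CE_def GE.const_mem Y_def)
    have mem: "running_max (\<lambda>k. CE (u k) Y) n \<in> H0 T"
      using Y u_bounds by (intro running_max_mem CE_mem) auto
    have mem_powr: "(\<lambda>w. running_max (\<lambda>k. CE (u k) Y) n w powr ?\<theta>) \<in> H0 T"
    proof (rule H0_powr[OF mem _ e])
      fix w :: "'d path" assume "w \<in> Omega T"
      then show "e \<le> running_max (\<lambda>k. CE (u k) Y) n w"
        using running_max_ge[of 0 n "\<lambda>k. CE (u k) Y" w] CE_Y[of 0 w] by simp
    qed (use p in simp)
    have "E (running_max (\<lambda>k. CE (u k) X) n) \<le> E (\<lambda>w. running_max (\<lambda>k. CE (u k) Y) n w powr ?\<theta>)"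
    proof (intro GE.mono mem_powr running_max_mem CE_mem X(1))
      fix w :: "'d path" assume w: "w \<in> Omega T"
      obtain i where i: "i \<le> n" "running_max (\<lambda>k. CE (u k) X) n w = CE (u i) X w"
        using running_max_attained[of n "\<lambda>k. CE (u k) X" w] by auto
      have "CE (u i) X w \<le> CE (u i) Y w powr ?\<theta>"
        unfolding Y_def using X e p u_bounds[OF i(1)] w by (intro CE_Jensen) auto
      also have "\<dots> \<le> running_max (\<lambda>k. CE (u k) Y) n w powr ?\<theta>"
        using running_max_ge[OF i(1), of "\<lambda>k. CE (u k) Y" w] CE_Y[OF i(1) w] e p
        by (intro powr_mono2) auto
      finally show "running_max (\<lambda>k. CE (u k) X) n w \<le> running_max (\<lambda>k. CE (u k) Y) n w powr ?\<theta>"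
        by (simp add: i(2))
    qed (use u_bounds in auto)
    also have "\<dots> \<le> E Y powr ?\<theta> / (1 - ?\<theta>)"
      using Y e p u by (intro Doob_discrete) (auto simp: Y_def)
    also have "E Y = E ?Z + e"
      using GE.add_const[OF Z, of e] by (simp add: Y_def[abs_def] add.commute)
    finally show ?thesis unfolding const[symmetric] by (simp only: times_divide_eq_left mult_1)
  qed
  \<comment> \<open>Right continuity of the power at \<open>E ?Z\<close> removes \<open>e\<close>,
    including the case that \<open>E ?Z\<close> is 0.\<close>
  have "((\<lambda>e. p / (p - 1) * (E ?Z + e) powr ?\<theta>) \<longlongrightarrow> p / (p - 1) * (E ?Z + 0) powr ?\<theta>) (at_right 0)"
    using GE.nonneg[OF Z] p
    by (intro tendsto_intros tendsto_powr' ) (auto simp: eventually_at_right_less intro!: eventually_at_rightI[of 0 1])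
  moreover have "\<forall>\<^sub>F e in at_right 0. E (running_max (\<lambda>k. CE (u k) X) n) \<le> p / (p - 1) * (E ?Z + e) powr ?\<theta>"
    using eps by (intro eventually_at_rightI[of 0 1]) auto
  ultimately show ?thesis using tendsto_lowerbound by force
qed

end

section \<open>Continuity in time and the supremum over all times\<close>

text \<open>Every term is replaced by the largest one; counting \<open>K\<close> there are
  \<open>Suc (card I)\<close> terms.\<close>

lemma power_sum_le:
  fixes b :: "'i \<Rightarrow> real"
  assumes "finite I" "0 \<le> K" "\<And>i. i \<in> I \<Longrightarrow> 0 \<le> b i"
  shows "(K + (\<Sum>i\<in>I. b i)) ^ j \<le> real (Suc (card I)) ^ j * (K ^ j + (\<Sum>i\<in>I. b i ^ j))"
proof -
  define m where "m = Max (insert K (b ` I))"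
  have fin: "finite (insert K (b ` I))" using assms(1) by simp
  have m: "K \<le> m" "\<And>i. i \<in> I \<Longrightarrow> b i \<le> m" "m \<in> insert K (b ` I)"
    unfolding m_def using fin Max_in[OF fin] by auto
  have m0: "0 \<le> m" using m(1) assms(2) by simp
  have "K + (\<Sum>i\<in>I. b i) \<le> m + real (card I) * m"
    using m sum_bounded_above[of I b m] by (intro add_mono) auto
  then have "(K + (\<Sum>i\<in>I. b i)) ^ j \<le> (real (Suc (card I)) * m) ^ j"
    using assms by (intro power_mono) (auto simp: algebra_simps intro!: add_nonneg_nonneg sum_nonneg)
  also have "\<dots> = real (Suc (card I)) ^ j * m ^ j" by (rule power_mult_distrib)
  also have "m ^ j \<le> K ^ j + (\<Sum>i\<in>I. b i ^ j)"
  proof (cases "m = K")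
    case True
    then show ?thesis using assms by (auto intro!: sum_nonneg)
  next
    case False
    then obtain i where i: "i \<in> I" "m = b i" using m(3) by auto
    have "b i ^ j \<le> (\<Sum>i\<in>I. b i ^ j)" using assms i(1) by (intro member_le_sum) auto
    then show ?thesis using i(2) assms(2) by (simp add: add_increasing)
  qed
  finally show ?thesis by (simp add: mult_left_mono)
qed

text \<open>Stands in for the Cauchy-Schwarz inequality under \<open>E\<close>; the weight
  \<open>r\<close> stays free and is chosen after taking expectations.\<close>

lemma mult_le_weighted_squares:
  fixes a b r :: real
  assumes "0 < r"
  shows "a * b \<le> r * a\<^sup>2 + 1 / r * b\<^sup>2"
proof -
  have "r * (a * b) \<le> (r * a)\<^sup>2 + b\<^sup>2"
    using sum_squares_bound[of "r * a" b] add_nonneg_nonneg[OF zero_le_power2 zero_le_power2, of "r * a" b]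
    unfolding mult.assoc by linarith
  also have "\<dots> = r * (r * a\<^sup>2 + 1 / r * b\<^sup>2)"
    using assms by (simp add: power2_eq_square algebra_simps)
  finally show ?thesis using assms by (simp only: mult_le_cancel_left_pos)
qed

lemma C_lLip_norm_power: "(\<lambda>x::'a::real_normed_vector. norm x ^ j) \<in> C_lLip"
proof -
  obtain C k where C: "0 \<le> C" "\<And>x y. \<bar>x ^ j - y ^ j\<bar> \<le> C * (1 + norm x + norm y) ^ k * norm (x - y :: real)"
    by (rule C_lLipE[OF C_lLip_power[of j]]) (rule that)
  show ?thesis
  proof (rule C_lLipI[OF C(1), of _ k])
    fix x y :: 'a
    have "C * (1 + norm (norm x) + norm (norm y)) ^ k * norm (norm x - norm y)
       \<le> C * (1 + norm x + norm y) ^ k * norm (x - y)"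
      using C(1) norm_triangle_ineq3[of x y] by (intro mult_left_mono mult_mono) auto
    with C(2)[of "norm x" "norm y"]
    show "\<bar>norm x ^ j - norm y ^ j\<bar> \<le> C * (1 + norm x + norm y) ^ k * norm (x - y)" by linarith
  qed
qed

lemma H0_increment:
  fixes F :: "real^'d \<Rightarrow> real"
  assumes F: "F \<in> C_lLip" and "0 \<le> a" "a \<le> T" "0 \<le> b" "b \<le> T"
  shows "(\<lambda>w. F (B b w - B a w)) \<in> H0 T"
  unfolding H0_def
proof (intro CollectI exI[of _ 2] conjI exI[of _ "\<lambda>i::nat. if i = 0 then a else b"]
    exI[of _ "\<lambda>x. F (x 1 - x 0)"] ballI allI impI)
  have "(\<lambda>x. F (x 0)) \<in> C_lLip_tuple 1" using F by (rule C_lLip_tuple_coord) simp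
  then show "(\<lambda>x. F (x 1 - x 0)) \<in> C_lLip_tuple 2"
  proof (rule C_lLip_tuple_Lipschitz_comp[where L = "\<lambda>x i. x 1 - x 0"])
    fix x y :: "nat \<Rightarrow> real^'d"
    have "(x 1 - x 0) - (y 1 - y 0) = (x 1 - y 1) - (x 0 - y 0)" by simp
    then have "norm ((x 1 - x 0) - (y 1 - y 0)) \<le> norm (x 1 - y 1) + norm (x 0 - y 0)"
      by (metis norm_triangle_ineq4)
    then show "norm ((x 1 - x 0) - (y 1 - y 0)) \<le> 2 * tuple_norm 2 (\<lambda>i. x i - y i)"
      using norm_le_tuple_norm[of 0 2 "\<lambda>i. x i - y i"] norm_le_tuple_norm[of 1 2 "\<lambda>i. x i - y i"] by simp
  qed
qed (use assms in auto)

section \<open>Moments of path increments and continuity of conditional expectations in time\<close>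

context G_expectation_space begin

definition noise_moment :: "nat \<Rightarrow> real" where
  "noise_moment j = E' (\<lambda>w. norm (\<xi> 0 w) ^ j)"

lemma noise_power_mem: "(\<lambda>w. norm (\<xi> i w) ^ j) \<in> H"
proof -
  have "random_tuple H (Suc i) \<xi>" using iid by (simp add: iid_G_normal_def)
  from base.random_tuple_mem[OF this C_lLip_tuple_coord[OF C_lLip_norm_power[of j], of i]]
  show ?thesis by simp
qed

lemma noise_moment_nonneg: "0 \<le> noise_moment j"
  unfolding noise_moment_def by (intro base.nonneg noise_power_mem) simp

lemma E_one_step:
  assumes "time_grid T m s" "i < m"
  shows "E (\<lambda>w. norm (B (s (Suc i)) w - B (s i) w) ^ j) = sqrt (s (Suc i) - s i) ^ j * noise_moment j"
proof -
  have pos: "0 \<le> sqrt (s (Suc i) - s i)" using assms by (auto simp: time_grid_def intro: less_imp_le)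
  have "E (\<lambda>w. norm (increment s w i) ^ j) = E' (\<lambda>w. norm (scaled_noise s i w) ^ j)"
    by (rule E_grid[OF assms(1) C_lLip_tuple_coord[OF C_lLip_norm_power assms(2)]])
  also have "\<dots> = E' (\<lambda>w. sqrt (s (Suc i) - s i) ^ j * norm (\<xi> i w) ^ j)"
    using pos by (simp add: power_mult_distrib)
  also have "\<dots> = sqrt (s (Suc i) - s i) ^ j * E' (\<lambda>w. norm (\<xi> i w) ^ j)"
    using pos by (intro base.scale noise_power_mem) simp
  also have "E' (\<lambda>w. norm (\<xi> i w) ^ j) = noise_moment j"
  proof -
    have "identically_distributed E' (\<xi> i) E' (\<xi> 0)" using iid by (simp add: iid_G_normal_def)
    then show ?thesis
      unfolding identically_distributed_def noise_moment_def using C_lLip_norm_power[of j] by (rule bspec)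
  qed
  finally show ?thesis by (simp add: increment_def)
qed

lemma E_increment_power:
  assumes "0 \<le> a" "a \<le> b" "b \<le> T"
  shows "E (\<lambda>w. norm (B b w - B a w) ^ j) = sqrt (b - a) ^ j * noise_moment j"
proof -
  \<comment> \<open>Grids start at 0 and increase strictly: the interval from \<open>a\<close> to
    \<open>b\<close> is the first step of a grid if \<open>a = 0\<close>, the second if
    \<open>a > 0\<close>, and no step at all if \<open>a = b\<close>, where \<open>j = 0\<close>
    gives 1 on both sides.\<close>
  consider "a = b" | "a = 0" "0 < b" | "0 < a" "a < b" using assms by linarith
  then show ?thesis
  proof cases
    case 1
    then show ?thesis
      by (cases j) (simp_all add: noise_moment_def)
  next
    case 2
    then show ?thesis
      using E_one_step[of 1 "\<lambda>i. if i = 0 then 0 else b" 0 j] assms by (simp add: time_grid_def)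
  next
    case 3
    then show ?thesis
      using E_one_step[of 2 "\<lambda>i. if i = 0 then 0 else if i = 1 then a else b" 1 j] assms
      by (simp add: time_grid_def less_Suc_eq numeral_2_eq_2 all_conj_distrib)
  qed
qed

lemma increments_sum_mem:
  assumes "\<And>i. i \<in> I \<Longrightarrow> 0 \<le> a i \<and> a i \<le> b i \<and> b i \<le> T"
  shows "(\<lambda>w. (K + (\<Sum>i\<in>I. norm (B (b i) w - B (a i) w :: real^'d))) ^ j) \<in> H0 T"
proof (intro H0_comp[OF C_lLip_power] GE.add_mem GE.const_mem GE.sum_mem)
  fix i assume "i \<in> I"
  with assms[of i] H0_increment[OF C_lLip_norm_power[of 1], of "a i" T "b i"]
  show "(\<lambda>w. norm (B (b i) w - B (a i) w)) \<in> H0 T" by simp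
qed

lemma E_increments_power_le:
  assumes "finite I" "0 \<le> K" and ab: "\<And>i. i \<in> I \<Longrightarrow> 0 \<le> a i \<and> a i \<le> b i \<and> b i \<le> T"
  shows "E (\<lambda>w. (K + (\<Sum>i\<in>I. norm (B (b i) w - B (a i) w))) ^ j)
    \<le> real (Suc (card I)) ^ j * (K ^ j + (\<Sum>i\<in>I. sqrt (b i - a i) ^ j) * noise_moment j)"
proof -
  let ?c = "real (Suc (card I)) ^ j"
  have mem: "(\<lambda>w. norm (B (b i) w - B (a i) w) ^ j) \<in> H0 T" if "i \<in> I" for i
    using ab[OF that] by (intro H0_increment[OF C_lLip_norm_power]) auto
  have "E (\<lambda>w. (K + (\<Sum>i\<in>I. norm (B (b i) w - B (a i) w))) ^ j)
     \<le> E (\<lambda>w. ?c * (K ^ j + (\<Sum>i\<in>I. norm (B (b i) w - B (a i) w) ^ j)))"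
    using assms by (intro GE.mono increments_sum_mem GE.scale_mem GE.add_mem GE.const_mem GE.sum_mem mem power_sum_le) auto
  also have "\<dots> = ?c * (K ^ j + E (\<lambda>w. \<Sum>i\<in>I. norm (B (b i) w - B (a i) w) ^ j))"
    by (simp add: GE.scale GE.add_const GE.add_mem GE.const_mem GE.sum_mem mem)
  also have "E (\<lambda>w. \<Sum>i\<in>I. norm (B (b i) w - B (a i) w) ^ j) \<le> (\<Sum>i\<in>I. E (\<lambda>w. norm (B (b i) w - B (a i) w) ^ j))"
    by (intro GE.subadditive_sum mem)
  also have "\<dots> = (\<Sum>i\<in>I. sqrt (b i - a i) ^ j * noise_moment j)"
    using ab by (intro sum.cong E_increment_power) auto
  finally show ?thesis by (simp add: sum_distrib_right mult_left_mono)
qed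

text \<open>Both conditional expectations average over the same continuation, so their difference
  compares the paths pasted at \<open>u\<close> and at \<open>v\<close>. These differ by increments
  of the fixed path \<open>w\<close> and by an increment of the continuation between
  \<open>u\<close> and \<open>v\<close>, whose second moment is of order
  \<open>\<bar>u - v\<bar>\<close>. The weight \<open>\<eta>\<close> balances this difference
  against the polynomial growth factor.\<close>

lemma CE_diff_le:
  assumes X: "X \<in> H0 T" and w: "w \<in> Omega T"
  obtains A M and n :: nat and t where "0 \<le> A" "0 \<le> M"
    "\<And>u v \<eta>. \<lbrakk>0 \<le> u; u \<le> T; 0 \<le> v; v \<le> T; u \<noteq> v; 0 < \<eta>\<rbrakk> \<Longrightarrow>
      \<bar>CE u X w - CE v X w\<bar> \<le>
      A * (\<eta> * M + M * ((\<Sum>i<n. norm (B (min (t i) u) w - B (min (t i) v) w))\<^sup>2 + \<bar>u - v\<bar>) / \<eta>)"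
proof -
  obtain n t and \<phi> :: "(nat \<Rightarrow> real^'d) \<Rightarrow> real" where t: "\<forall>i<n. t i \<in> {0..T}"
    and \<phi>: "\<phi> \<in> C_lLip_tuple n" and X_eq: "\<forall>w\<in>Omega T. X w = \<phi> (\<lambda>i. B (t i) w)"
    using X unfolding H0_def by blast
  obtain C k where C: "0 \<le> C" "\<And>x y. \<bar>\<phi> x - \<phi> y\<bar> \<le>
    C * (1 + tuple_norm n x + tuple_norm n y) ^ k * tuple_norm n (\<lambda>i. x i - y i)"
    by (rule C_lLip_tupleE[OF \<phi>]) (rule that)
  \<comment> \<open>In each of the two pasted paths the part taken from \<open>w\<close> contributes
    at most \<open>n * norm w\<close> to the tuple norm.\<close>
  define K where "K = 1 + 2 * real n * norm w"
  define c where "c = real (Suc (2 * n))"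
  \<comment> \<open>One constant for both moments: the first summand serves \<open>R\<close>, the
    second serves \<open>Q\<close>. The number of terms, counting the constant one, is at most
    \<open>c\<close> in either sum.\<close>
  define M where "M = c ^ (2 * k) * (K ^ (2 * k) + 2 * real n * sqrt T ^ (2 * k) * noise_moment (2 * k))
    + c\<^sup>2 * (1 + real n * noise_moment 2)"
  have K: "0 \<le> K" by (simp add: K_def)
  have c: "0 \<le> c" by (simp add: c_def)
  have M: "0 \<le> M" unfolding M_def
    using K c T_pos noise_moment_nonneg by (intro add_nonneg_nonneg mult_nonneg_nonneg) auto
  show thesis
  proof (rule that[OF C(1) M, of t n])
    fix u v \<eta> :: real
    assume u: "0 \<le> u" "u \<le> T" and v: "0 \<le> v" "v \<le> T" and uv: "u \<noteq> v" and \<eta>: "0 < \<eta>"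
    define \<omega> where "\<omega> = (\<Sum>i<n. norm (B (min (t i) u) w - B (min (t i) v) w))"
    define \<mu> where "\<mu> = min u v"
    \<comment> \<open>The time \<open>t i\<close> clipped to the interval between \<open>u\<close>
      and \<open>v\<close>; the contributions of the continuation to the two pasted paths differ by
      its increment over that part only.\<close>
    define \<tau> where "\<tau> i = max \<mu> (min (t i) (max u v))" for i
    \<comment> \<open>Pairs, because the growth factor involves both pasted paths;
      \<open>u \<noteq> v\<close> keeps the two copies apart.\<close>
    let ?I = "{..<n} \<times> {u, v}"
    define R where "R w' = K + (\<Sum>p\<in>?I. norm (B (max (t (fst p)) (snd p)) w' - B (snd p) w'))" for w' :: "'d path"
    define Q where "Q w' = \<omega> + (\<Sum>i<n. norm (B (\<tau> i) w' - B \<mu> w'))" for w' :: "'d path"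
    have \<omega>: "0 \<le> \<omega>" by (auto simp: \<omega>_def intro: sum_nonneg)
    have times_R: "0 \<le> snd p \<and> snd p \<le> max (t (fst p)) (snd p) \<and> max (t (fst p)) (snd p) \<le> T" if "p \<in> ?I" for p
      using that t u v by auto
    have times_Q: "0 \<le> \<mu> \<and> \<mu> \<le> \<tau> i \<and> \<tau> i \<le> T" if "i \<in> {..<n}" for i
      using that t u v by (auto simp: \<mu>_def \<tau>_def)
    have R_mem: "(\<lambda>w'. R w' ^ (2 * k)) \<in> H0 T"
      unfolding R_def by (rule increments_sum_mem[of ?I snd "\<lambda>p. max (t (fst p)) (snd p)", OF times_R])
    have Q_mem: "(\<lambda>w'. Q w' ^ 2) \<in> H0 T"
      unfolding Q_def by (rule increments_sum_mem[of "{..<n}" "\<lambda>_. \<mu>" \<tau>, OF times_Q])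
    have R_split: "R w' = K + (\<Sum>i<n. norm (B (max (t i) u) w' - B u w')) + (\<Sum>i<n. norm (B (max (t i) v) w' - B v w'))" for w'
    proof -
      have "(\<Sum>p\<in>?I. norm (B (max (t (fst p)) (snd p)) w' - B (snd p) w'))
        = (\<Sum>i<n. \<Sum>x\<in>{u, v}. norm (B (max (t i) x) w' - B x w'))"
        by (simp add: sum.cartesian_product case_prod_unfold)
      also have "\<dots> = (\<Sum>i<n. norm (B (max (t i) u) w' - B u w') + norm (B (max (t i) v) w' - B v w'))"
        using uv by simp
      finally show ?thesis by (simp add: R_def sum.distrib)
    qed
    have size: "tuple_norm n (\<lambda>i. B (t i) (paste x w w')) \<le> real n * norm w + (\<Sum>i<n. norm (B (max (t i) x) w' - B x w'))" for x w'
    proof -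
      have "tuple_norm n (\<lambda>i. B (t i) (paste x w w')) \<le> (\<Sum>i<n. norm (B (t i) (paste x w w')))"
        by (rule tuple_norm_le_sum)
      also have "\<dots> \<le> (\<Sum>i<n. norm w + norm (B (max (t i) x) w' - B x w'))"
        unfolding B_paste by (intro sum_mono order_trans[OF norm_triangle_ineq] add_mono norm_B_le order_refl)
      finally show ?thesis by (simp add: sum.distrib)
    qed
    have diff: "tuple_norm n (\<lambda>i. B (t i) (paste u w w') - B (t i) (paste v w w')) \<le> Q w'" for w'
    proof -
      have "norm (B s (paste u w w') - B s (paste v w w'))
         \<le> norm (B (min s u) w - B (min s v) w) + norm (B (max \<mu> (min s (max u v))) w' - B \<mu> w')" for s
      proof -
        define d where "d = (B (max s u) w' - B u w') - (B (max s v) w' - B v w')"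
        have d: "norm d = norm (B (max \<mu> (min s (max u v))) w' - B \<mu> w')"
          by (cases "u \<le> v"; cases "s \<le> u"; cases "s \<le> v")
            (auto simp: d_def \<mu>_def min_def max_def norm_minus_commute)
        have "B s (paste u w w') - B s (paste v w w') = (B (min s u) w - B (min s v) w) + d"
          by (simp add: B_paste d_def)
        then show ?thesis using norm_triangle_ineq[of "B (min s u) w - B (min s v) w" d] d by simp
      qed
      then have "(\<Sum>i<n. norm (B (t i) (paste u w w') - B (t i) (paste v w w'))) \<le> Q w'"
        unfolding Q_def \<omega>_def \<tau>_def sum.distrib[symmetric] by (intro sum_mono) blast
      with tuple_norm_le_sum show ?thesis by (rule order_trans)
    qed
    have "\<bar>CE u X w - CE v X w\<bar> \<le> E (\<lambda>w'. C * (\<eta> * R w' ^ (2 * k) + 1 / \<eta> * Q w' ^ 2))"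
      unfolding CE_def
    proof (intro GE.abs_diff_le paste_mem X u v w GE.scale_mem GE.add_mem R_mem Q_mem)
      fix w' :: "'d path" assume w': "w' \<in> Omega T"
      let ?r = "1 + tuple_norm n (\<lambda>i. B (t i) (paste u w w')) + tuple_norm n (\<lambda>i. B (t i) (paste v w w'))"
      have R_ge: "0 \<le> ?r" "?r \<le> R w'"
        using size[of u w'] size[of v w'] by (auto simp: R_split K_def intro!: add_nonneg_nonneg)
      have Q_ge: "0 \<le> Q w'" using order_trans[OF tuple_norm_nonneg diff] .
      have "\<bar>X (paste u w w') - X (paste v w w')\<bar>
         \<le> C * ?r ^ k * tuple_norm n (\<lambda>i. B (t i) (paste u w w') - B (t i) (paste v w w'))"
        using C(2) X_eq paste_in_Omega[OF w w'] u v by simp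
      also have "\<dots> \<le> C * R w' ^ k * Q w'"
        using C(1) R_ge order_trans[OF R_ge] diff
        by (intro mult_mono mult_left_mono power_mono mult_nonneg_nonneg zero_le_power) auto
      also have "\<dots> \<le> C * (\<eta> * R w' ^ (2 * k) + 1 / \<eta> * Q w' ^ 2)"
      proof -
        have "R w' ^ k * Q w' \<le> \<eta> * R w' ^ (2 * k) + 1 / \<eta> * Q w' ^ 2"
          using mult_le_weighted_squares[OF \<eta>, of "R w' ^ k" "Q w'"] by (simp only: power_even_eq)
        then show ?thesis using C(1) by (simp only: mult.assoc mult_left_mono)
      qed
      finally show "\<bar>X (paste u w w') - X (paste v w w')\<bar> \<le> C * (\<eta> * R w' ^ (2 * k) + 1 / \<eta> * Q w' ^ 2)" .
    qed
    also have "\<dots> = C * E (\<lambda>w'. \<eta> * R w' ^ (2 * k) + 1 / \<eta> * Q w' ^ 2)"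
      by (intro GE.scale C(1) GE.add_mem GE.scale_mem R_mem Q_mem)
    also have "\<dots> \<le> C * (E (\<lambda>w'. \<eta> * R w' ^ (2 * k)) + E (\<lambda>w'. 1 / \<eta> * Q w' ^ 2))"
      by (intro mult_left_mono GE.subadditive GE.scale_mem R_mem Q_mem C(1))
    also have "\<dots> = C * (\<eta> * E (\<lambda>w'. R w' ^ (2 * k)) + 1 / \<eta> * E (\<lambda>w'. Q w' ^ 2))"
      using \<eta> GE.scale[OF _ R_mem, of \<eta>] GE.scale[OF _ Q_mem, of "1 / \<eta>"] by simp
    also have "\<dots> \<le> C * (\<eta> * M + 1 / \<eta> * (M * (\<omega>\<^sup>2 + \<bar>u - v\<bar>)))"
    proof (intro mult_left_mono add_mono C(1))
      have card: "card ?I = 2 * n" using uv by (simp add: card_cartesian_product)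
      have "E (\<lambda>w'. R w' ^ (2 * k)) \<le> real (Suc (card ?I)) ^ (2 * k) *
          (K ^ (2 * k) + (\<Sum>p\<in>?I. sqrt (max (t (fst p)) (snd p) - snd p) ^ (2 * k)) * noise_moment (2 * k))"
        unfolding R_def by (rule E_increments_power_le[OF _ K times_R]) auto
      also have "\<dots> \<le> c ^ (2 * k) * (K ^ (2 * k) + 2 * real n * sqrt T ^ (2 * k) * noise_moment (2 * k))"
      proof -
        have "(\<Sum>p\<in>?I. sqrt (max (t (fst p)) (snd p) - snd p) ^ (2 * k)) \<le> real (card ?I) * sqrt T ^ (2 * k)"
        proof (rule sum_bounded_above)
          fix p assume "p \<in> ?I"
          from times_R[OF this] show "sqrt (max (t (fst p)) (snd p) - snd p) ^ (2 * k) \<le> sqrt T ^ (2 * k)"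
            by (intro power_mono real_sqrt_le_mono) (auto intro!: real_sqrt_ge_zero)
        qed
        then have "(\<Sum>p\<in>?I. sqrt (max (t (fst p)) (snd p) - snd p) ^ (2 * k)) * noise_moment (2 * k)
           \<le> 2 * real n * sqrt T ^ (2 * k) * noise_moment (2 * k)"
          unfolding card by (intro mult_right_mono noise_moment_nonneg) simp
        then show ?thesis unfolding card c_def by (intro mult_left_mono add_left_mono) auto
      qed
      also have "\<dots> \<le> M" unfolding M_def using noise_moment_nonneg by (simp add: mult_nonneg_nonneg)
      finally show "E (\<lambda>w'. R w' ^ (2 * k)) \<le> M" .
      have "E (\<lambda>w'. Q w' ^ 2) \<le> real (Suc (card {..<n})) ^ 2 *
          (\<omega> ^ 2 + (\<Sum>i<n. sqrt (\<tau> i - \<mu>) ^ 2) * noise_moment 2)"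
        unfolding Q_def by (rule E_increments_power_le[OF _ \<omega> times_Q]) auto
      also have "\<dots> \<le> c\<^sup>2 * (\<omega>\<^sup>2 + (real n * noise_moment 2) * \<bar>u - v\<bar>)"
      proof (rule mult_mono[OF _ add_left_mono])
        show "real (Suc (card {..<n})) ^ 2 \<le> c\<^sup>2" by (intro power_mono) (auto simp: c_def)
        have "(\<Sum>i<n. sqrt (\<tau> i - \<mu>) ^ 2) \<le> real (card {..<n}) * \<bar>u - v\<bar>"
        proof (rule sum_bounded_above)
          fix i assume "i \<in> {..<n}"
          then show "sqrt (\<tau> i - \<mu>) ^ 2 \<le> \<bar>u - v\<bar>"
            using times_Q[of i] by (simp add: \<tau>_def \<mu>_def)
        qed
        from mult_right_mono[OF this noise_moment_nonneg[of 2]]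
        show "(\<Sum>i<n. sqrt (\<tau> i - \<mu>) ^ 2) * noise_moment 2 \<le> real n * noise_moment 2 * \<bar>u - v\<bar>"
          by (simp add: mult_ac)
        show "0 \<le> \<omega> ^ 2 + (\<Sum>i<n. sqrt (\<tau> i - \<mu>) ^ 2) * noise_moment 2"
          by (intro add_nonneg_nonneg mult_nonneg_nonneg sum_nonneg noise_moment_nonneg) auto
      qed auto
      also have "\<dots> \<le> c\<^sup>2 * ((1 + real n * noise_moment 2) * (\<omega>\<^sup>2 + \<bar>u - v\<bar>))"
        using noise_moment_nonneg[of 2] by (intro mult_left_mono) (auto simp: algebra_simps)
      also have "\<dots> = c\<^sup>2 * (1 + real n * noise_moment 2) * (\<omega>\<^sup>2 + \<bar>u - v\<bar>)" by simp
      also have "\<dots> \<le> M * (\<omega>\<^sup>2 + \<bar>u - v\<bar>)"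
        unfolding M_def using K c T_pos noise_moment_nonneg[of "2 * k"]
        by (intro mult_right_mono) (auto intro!: mult_nonneg_nonneg add_nonneg_nonneg)
      finally show "E (\<lambda>w'. Q w' ^ 2) \<le> M * (\<omega>\<^sup>2 + \<bar>u - v\<bar>)" .
    qed (use \<eta> in auto)
    finally show "\<bar>CE u X w - CE v X w\<bar> \<le>
      C * (\<eta> * M + M * ((\<Sum>i<n. norm (B (min (t i) u) w - B (min (t i) v) w))\<^sup>2 + \<bar>u - v\<bar>) / \<eta>)"
      by (simp add: \<omega>_def)
  qed
qed

text \<open>The choice \<open>\<eta> = sqrt (f v)\<close> balances the two terms of
  \<open>CE_diff_le\<close>; it is admissible since \<open>v \<noteq> u\<close> makes
  \<open>f v\<close> positive, and \<open>f v\<close> tends to 0 by continuity of the path.\<close>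

lemma continuous_on_CE:
  assumes X: "X \<in> H0 T" and w: "w \<in> Omega T"
  shows "continuous_on {0..T} (\<lambda>u. CE u X w)"
  unfolding continuous_on_def
proof
  fix u assume u: "u \<in> {0..T}"
  obtain A M and n :: nat and t where AM: "0 \<le> A" "0 \<le> M" and
    bound: "\<And>u v \<eta>. \<lbrakk>0 \<le> u; u \<le> T; 0 \<le> v; v \<le> T; u \<noteq> v; 0 < \<eta>\<rbrakk> \<Longrightarrow>
      \<bar>CE u X w - CE v X w\<bar> \<le>
      A * (\<eta> * M + M * ((\<Sum>i<n. norm (B (min (t i) u) w - B (min (t i) v) w))\<^sup>2 + \<bar>u - v\<bar>) / \<eta>)"
    by (rule CE_diff_le[OF X w]) (rule that)
  define f where "f v = (\<Sum>i<n. norm (B (min (t i) u) w - B (min (t i) v) w))\<^sup>2 + \<bar>u - v\<bar>" for v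
  have f: "(f \<longlongrightarrow> f u) (at u within {0..T})"
  proof -
    have "continuous_on UNIV (\<lambda>v. B (min s v) w)" for s
      by (rule continuous_on_compose2[OF continuous_on_B[of UNIV]]) (auto intro!: continuous_intros)
    then have "continuous_on UNIV f" unfolding f_def by (intro continuous_intros) auto
    then show ?thesis by (meson UNIV_I continuous_on_def continuous_on_subset subset_UNIV u)
  qed
  have fu: "f u = 0" by (simp add: f_def)
  have le: "\<bar>CE v X w - CE u X w\<bar> \<le> A * (2 * M * sqrt (f v))" if "v \<in> {0..T}" "v \<noteq> u" for v
  proof -
    have pos: "0 < f v" using that by (simp add: f_def add_nonneg_pos)
    have "\<bar>CE u X w - CE v X w\<bar> \<le> A * (sqrt (f v) * M + M * f v / sqrt (f v))"
      using bound[of u v "sqrt (f v)"] that u pos unfolding f_def[symmetric] by simp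
    also have "M * f v / sqrt (f v) = M * sqrt (f v)"
      using pos by (simp add: real_div_sqrt flip: times_divide_eq_right)
    finally show ?thesis by (simp add: abs_minus_commute algebra_simps)
  qed
  have lim: "((\<lambda>v. A * (2 * M * sqrt (f v))) \<longlongrightarrow> 0) (at u within {0..T})"
  proof -
    have "((\<lambda>v. A * (2 * M * sqrt (f v))) \<longlongrightarrow> A * (2 * M * sqrt (f u))) (at u within {0..T})"
      by (intro tendsto_intros f)
    then show ?thesis by (simp add: fu)
  qed
  have "((\<lambda>v. CE v X w - CE u X w) \<longlongrightarrow> 0) (at u within {0..T})"
  proof (rule Lim_null_comparison[OF _ lim])
    show "\<forall>\<^sub>F v in at u within {0..T}. norm (CE v X w - CE u X w) \<le> A * (2 * M * sqrt (f v))"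
      unfolding eventually_at_filter using le by (intro always_eventually) auto
  qed
  then show "((\<lambda>u. CE u X w) \<longlongrightarrow> CE u X w) (at u within {0..T})"
    by (rule LIM_zero_cancel)
qed

end

section \<open>\<open>G\<close>-evaluation\<close>

locale G_represented = G_expectation_space T S H E' G \<xi> E
  for T :: real and S :: "'w set" and H :: "('w \<Rightarrow> real) set" and E' :: "('w \<Rightarrow> real) \<Rightarrow> real"
    and G :: "real^'d^'d \<Rightarrow> real" and \<xi> :: "nat \<Rightarrow> 'w \<Rightarrow> real^'d"
    and E :: "('d path \<Rightarrow> real) \<Rightarrow> real" +
  fixes \<P> :: "'d path measure set"
  assumes rep: "represents T \<P> E"
begin

lemma space_eq_Omega: "P \<in> \<P> \<Longrightarrow> space P = Omega T"
  using rep sets_eq_imp_space_eq[of P "restrict_space borel (Omega T)"]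
  by (auto simp: represents_def prob_measures_def space_restrict_space)

lemma integrable_H0: "P \<in> \<P> \<Longrightarrow> X \<in> H0 T \<Longrightarrow> integrable P X"
  and integral_le_E: "P \<in> \<P> \<Longrightarrow> X \<in> H0 T \<Longrightarrow> (\<integral>w. X w \<partial>P) \<le> E X"
  and E_attained: "X \<in> H0 T \<Longrightarrow> \<exists>P\<in>\<P>. (\<integral>w. X w \<partial>P) = E X"
  using rep unfolding represents_def by blast+

lemma nonempty: "\<P> \<noteq> {}"
  using E_attained[OF GE.const_mem[of 0]] by blast

definition CE_sup :: "('d path \<Rightarrow> real) \<Rightarrow> 'd path \<Rightarrow> real" where
  "CE_sup X w = (SUP u\<in>{0..T}. CE u X w)"

text \<open>Continuity on a compact interval gives the bound that makes the real \<open>SUP\<close>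
  in \<open>CE_sup\<close> the true supremum.\<close>

lemma bdd_above_CE:
  assumes "X \<in> H0 T" "w \<in> Omega T"
  shows "bdd_above ((\<lambda>u. CE u X w) ` {0..T})"
  using compact_continuous_image[OF continuous_on_CE[OF assms] compact_Icc]
  by (intro bounded_imp_bdd_above compact_imp_bounded)

lemma CE_le_CE_sup:
  assumes "X \<in> H0 T" "w \<in> Omega T" "0 \<le> u" "u \<le> T"
  shows "CE u X w \<le> CE_sup X w"
  unfolding CE_sup_def using assms by (intro cSUP_upper bdd_above_CE) auto

text \<open>The uniform grids are not nested, so convergence need not be monotone; it follows from
  continuity at a nearly optimal time. Taking \<open>Suc n\<close> steps excludes division by
  0.\<close>

lemma grid_running_max_tendsto:
  assumes X: "X \<in> H0 T" and w: "w \<in> Omega T"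
  shows "(\<lambda>n. running_max (\<lambda>k. CE (T * real k / real (Suc n)) X) (Suc n) w) \<longlonglongrightarrow> CE_sup X w"
proof (rule LIMSEQ_I)
  let ?R = "\<lambda>n. running_max (\<lambda>k. CE (T * real k / real (Suc n)) X) (Suc n) w"
  fix e :: real assume e: "0 < e"
  obtain u where u: "u \<in> {0..T}" "CE_sup X w - e / 2 < CE u X w"
    using less_cSUP_iff[of "{0..T}" "\<lambda>u. CE u X w" "CE_sup X w - e / 2", OF _ bdd_above_CE[OF X w]] T_pos e
    by (auto simp: CE_sup_def)
  obtain d where d: "0 < d" "\<And>v. v \<in> {0..T} \<Longrightarrow> dist v u < d \<Longrightarrow> dist (CE v X w) (CE u X w) < e / 2"
    using continuous_on_CE[OF X w] u(1) e unfolding continuous_on_iff by (metis half_gt_zero)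
  obtain N :: nat where N: "T / d < real N" using reals_Archimedean2 by blast
  have "norm (?R n - CE_sup X w) < e" if n: "N \<le> n" for n
  proof -
    let ?m = "real (Suc n)"
    obtain i where i: "i \<le> Suc n" "?R n = CE (T * real i / ?m) X w"
      using running_max_attained[of "Suc n" "\<lambda>k. CE (T * real k / ?m) X" w] by auto
    have grid: "T * real k / ?m \<in> {0..T}" if "k \<le> Suc n" for k
    proof -
      have "real k / ?m \<le> 1" using that by simp
      then have "T * (real k / ?m) \<le> T * 1" using T_pos by (intro mult_left_mono) auto
      then show ?thesis using T_pos by simp
    qed
    have upper: "?R n \<le> CE_sup X w"
      unfolding i(2) using grid[OF i(1)] by (intro CE_le_CE_sup X w) auto
    \<comment> \<open>The last grid point not after \<open>u\<close>, at distance less than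
      \<open>T / ?m\<close>.\<close>
    define k where "k = nat \<lfloor>u * ?m / T\<rfloor>"
    have k: "real k \<le> u * ?m / T" "u * ?m / T < real k + 1"
      using u(1) T_pos by (auto simp: k_def)
    have k1: "T * real k / ?m \<le> u" using k(1) T_pos by (simp add: field_simps)
    have "u * ?m < (real k + 1) * T" using k(2) T_pos by (simp add: pos_divide_less_eq)
    then have "u < (T * real k + T) / ?m" by (simp add: pos_less_divide_eq algebra_simps)
    then have k2: "u < T * real k / ?m + T / ?m" by (simp only: add_divide_distrib)
    have "u * ?m \<le> T * ?m" using u(1) by (intro mult_right_mono) auto
    then have "u * ?m / T \<le> ?m" using T_pos by (simp add: pos_divide_le_eq mult.commute)
    then have "k \<le> Suc n" using k(1) by linarith
    have "T / ?m < d"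
    proof -
      have "T < d * real N" using N d(1) by (simp add: field_simps)
      also have "\<dots> \<le> d * ?m" using n d(1) by (intro mult_left_mono) auto
      finally show ?thesis by (simp add: field_simps)
    qed
    with k1 k2 have "dist (T * real k / ?m) u < d" by (simp add: dist_real_def)
    from d(2)[OF grid[OF \<open>k \<le> Suc n\<close>] this]
    have "CE u X w - e / 2 < CE (T * real k / ?m) X w" unfolding dist_real_def abs_less_iff by linarith
    also have "\<dots> \<le> ?R n"
      using running_max_ge[OF \<open>k \<le> Suc n\<close>, of "\<lambda>k. CE (T * real k / ?m) X" w] .
    finally show ?thesis using u(2) upper e unfolding real_norm_def by linarith
  qed
  then show "\<exists>N. \<forall>n\<ge>N. norm (?R n - CE_sup X w) < e" by blast
qed

text \<open>The limit along grids gives measurability as well as the estimate, since the bound of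
  \<open>E_running_max_le\<close> is the same for all grids and dominates the integral under every
  measure in \<open>\<P>\<close>.\<close>

lemma CE_sup_integral:
  assumes X: "X \<in> H0 T" "\<And>w. w \<in> Omega T \<Longrightarrow> 0 \<le> X w" and p: "1 < p" and P: "P \<in> \<P>"
  shows integrable_CE_sup: "integrable P (CE_sup X)"
    and integral_CE_sup_le: "(\<integral>w. CE_sup X w \<partial>P) \<le> p / (p - 1) * E (\<lambda>w. \<bar>X w\<bar> powr p) powr (1 / p)"
proof -
  define R where "R n = running_max (\<lambda>k. CE (T * real k / real (Suc n)) X) (Suc n)" for n
  define c where "c = p / (p - 1) * E (\<lambda>w. \<bar>X w\<bar> powr p) powr (1 / p)"
  have c: "0 \<le> c" using p by (simp add: c_def)
  have grid: "0 \<le> T * real k / real (Suc n)" "T * real k / real (Suc n) \<le> T" if "k \<le> Suc n" for k n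
  proof -
    have "real k / real (Suc n) \<le> 1" using that by simp
    then have "T * (real k / real (Suc n)) \<le> T * 1" using T_pos by (intro mult_left_mono) auto
    then show "T * real k / real (Suc n) \<le> T" by simp
  qed (use T_pos in auto)
  have R: "R n \<in> H0 T" for n
    unfolding R_def using X grid by (intro running_max_mem CE_mem) auto
  have R_nonneg: "0 \<le> R n w" if "w \<in> Omega T" for n w
  proof -
    have "0 \<le> CE (T * real 0 / real (Suc n)) X w"
      using CE_mono[of "\<lambda>_. 0" X 0 w] X that T_pos by (simp add: CE_def GE.const_mem)
    also have "\<dots> \<le> R n w"
      unfolding R_def by (rule running_max_ge[of 0 "Suc n" "\<lambda>k. CE (T * real k / real (Suc n)) X" w]) simp
    finally show ?thesis .
  qed
  have lim: "(\<lambda>n. R n w) \<longlonglongrightarrow> CE_sup X w" if "w \<in> Omega T" for w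
    unfolding R_def by (rule grid_running_max_tendsto[OF X(1) that])
  have meas: "CE_sup X \<in> borel_measurable P"
    by (rule borel_measurable_LIMSEQ_real[of P R])
      (use lim integrable_H0[OF P R] in \<open>auto simp: space_eq_Omega[OF P]\<close>)
  have nonneg: "0 \<le> CE_sup X w" if "w \<in> Omega T" for w
    using CE_le_CE_sup[OF X(1) that, of T] CE_T[OF X(1) that] X(2)[OF that] T_pos by simp
  have "(\<integral>\<^sup>+w. ennreal (CE_sup X w) \<partial>P) = (\<integral>\<^sup>+w. liminf (\<lambda>n. ennreal (R n w)) \<partial>P)"
  proof (rule nn_integral_cong)
    fix w assume "w \<in> space P"
    then have "(\<lambda>n. ennreal (R n w)) \<longlonglongrightarrow> ennreal (CE_sup X w)"
      by (intro tendsto_ennrealI lim) (simp add: space_eq_Omega[OF P])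
    then show "ennreal (CE_sup X w) = liminf (\<lambda>n. ennreal (R n w))"
      by (simp add: lim_imp_Liminf)
  qed
  also have "\<dots> \<le> liminf (\<lambda>n. \<integral>\<^sup>+w. ennreal (R n w) \<partial>P)"
    using integrable_H0[OF P R] by (intro nn_integral_liminf) auto
  also have "\<dots> \<le> ennreal c"
  proof (rule Liminf_le)
    have "(\<integral>\<^sup>+w. ennreal (R n w) \<partial>P) \<le> ennreal c" for n
    proof -
      have "(\<integral>\<^sup>+w. ennreal (R n w) \<partial>P) = ennreal (\<integral>w. R n w \<partial>P)"
        using R_nonneg by (intro nn_integral_eq_integral integrable_H0[OF P R]) (auto simp: space_eq_Omega[OF P])
      moreover have "(\<integral>w. R n w \<partial>P) \<le> c"
      proof (rule order_trans[OF integral_le_E[OF P R]])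
        show "E (R n) \<le> c"
          unfolding R_def c_def using X p grid T_pos
          by (intro E_running_max_le) (auto intro!: divide_right_mono mult_left_mono)
      qed
      ultimately show ?thesis by (simp add: ennreal_leI)
    qed
    then show "\<forall>\<^sub>F n in sequentially. (\<integral>\<^sup>+w. ennreal (R n w) \<partial>P) \<le> ennreal c" by simp
  qed simp
  finally have nn: "(\<integral>\<^sup>+w. ennreal (CE_sup X w) \<partial>P) \<le> ennreal c" .
  show int: "integrable P (CE_sup X)"
  proof (rule integrableI_nonneg[OF meas])
    show "AE w in P. 0 \<le> CE_sup X w" using nonneg by (auto simp: space_eq_Omega[OF P])
    show "(\<integral>\<^sup>+w. ennreal (CE_sup X w) \<partial>P) < \<infinity>" using nn by (simp add: le_less_trans)
  qed
  have "ennreal (\<integral>w. CE_sup X w \<partial>P) = (\<integral>\<^sup>+w. ennreal (CE_sup X w) \<partial>P)"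
    using nonneg by (intro nn_integral_eq_integral[symmetric] int) (auto simp: space_eq_Omega[OF P])
  with nn have "ennreal (\<integral>w. CE_sup X w \<partial>P) \<le> ennreal c" by simp
  then show "(\<integral>w. CE_sup X w \<partial>P) \<le> p / (p - 1) * E (\<lambda>w. \<bar>X w\<bar> powr p) powr (1 / p)"
    using c by (simp add: c_def)
qed

text \<open>The two conditional expectations agree on \<open>Omega T\<close>, which is the whole
  space of each measure in \<open>\<P>\<close>.\<close>

lemma G_evaluation_eq:
  assumes "X \<in> H0 T"
  shows "G_evaluation T E \<P> X = (SUP P\<in>\<P>. \<integral>w. CE_sup X w \<partial>P)"
  unfolding G_evaluation_def upper_expectation_def
proof (intro SUP_cong refl Bochner_Integration.integral_cong)
  fix P w assume "P \<in> \<P>" "w \<in> space P"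
  then have w: "w \<in> Omega T" by (simp add: space_eq_Omega)
  show "(SUP u\<in>{0..T}. G_cond_exp T E u X w) = CE_sup X w"
    unfolding CE_sup_def using assms w by (intro SUP_cong refl G_cond_exp_eq) auto
qed

lemma G_evaluation_le:
  assumes "X \<in> H0 T" "\<And>w. w \<in> Omega T \<Longrightarrow> 0 \<le> X w" "1 < p"
  shows "G_evaluation T E \<P> X \<le> p / (p - 1) * E (\<lambda>w. \<bar>X w\<bar> powr p) powr (1 / p)"
  unfolding G_evaluation_eq[OF assms(1)]
  by (rule cSUP_least[OF nonempty]) (rule integral_CE_sup_le[OF assms])

text \<open>At time \<open>T\<close> the conditional expectation is \<open>X\<close> itself, so
  \<open>X\<close> lies below \<open>CE_sup X\<close>; this is integrated under a measure that
  attains \<open>E X\<close>.\<close>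

lemma E_le_G_evaluation:
  assumes X: "X \<in> H0 T" "\<And>w. w \<in> Omega T \<Longrightarrow> 0 \<le> X w"
  shows "E X \<le> G_evaluation T E \<P> X"
proof -
  obtain P where P: "P \<in> \<P>" "(\<integral>w. X w \<partial>P) = E X" using E_attained[OF X(1)] by blast
  have "(\<integral>w. X w \<partial>P) \<le> (\<integral>w. CE_sup X w \<partial>P)"
  \<comment> \<open>The exponent 2 is an arbitrary choice above 1 and only supplies
    finiteness.\<close>
  proof (intro integral_mono integrable_H0[OF P(1) X(1)] integrable_CE_sup[OF X _ P(1), of 2])
    fix w assume "w \<in> space P"
    then have w: "w \<in> Omega T" by (simp add: space_eq_Omega[OF P(1)])
    show "X w \<le> CE_sup X w"
      using CE_le_CE_sup[OF X(1) w, of T] CE_T[OF X(1) w] T_pos by simp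
  qed auto
  also have "\<dots> \<le> (SUP P\<in>\<P>. \<integral>w. CE_sup X w \<partial>P)"
    using P(1) integral_CE_sup_le[OF X, of 2] by (intro cSUP_upper bdd_aboveI2) auto
  finally show ?thesis by (simp add: G_evaluation_eq[OF X(1)] P(2))
qed

end

section \<open>Completions\<close>

text \<open>A class for \<open>N1\<close> is sent to the class for \<open>N2\<close> of one of its
  representatives. Domination makes the result independent of the representative,
  \<open>compatible\<close> makes the map injective. Transitivity is asked for null sequences, so a
  triangle inequality up to a constant factor can supply it.\<close>

lemma completion_includedI:
  assumes dom: "\<And>x. x \<in> V \<Longrightarrow> N2 x \<le> c * N1 x" and c: "0 \<le> c"
    and nonneg: "\<And>x. 0 \<le> N2 x"
    and diff: "\<And>x y. x \<in> V \<Longrightarrow> y \<in> V \<Longrightarrow> (\<lambda>w. x w - y w) \<in> V"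
    and refl: "N1 (\<lambda>w. 0) = 0"
    and sym: "\<And>x y. N1 (\<lambda>w. x w - y w) = N1 (\<lambda>w. y w - x w)"
    and trans: "\<And>x y z. \<lbrakk>\<And>n. x n \<in> V; \<And>n. y n \<in> V; \<And>n. z n \<in> V;
        (\<lambda>n. N1 (\<lambda>w. x n w - y n w)) \<longlonglongrightarrow> 0; (\<lambda>n. N1 (\<lambda>w. y n w - z n w)) \<longlonglongrightarrow> 0\<rbrakk>
        \<Longrightarrow> (\<lambda>n. N1 (\<lambda>w. x n w - z n w)) \<longlonglongrightarrow> 0"
    and compatible: "\<And>x y. \<lbrakk>x \<in> cauchy_seqs V N1; y \<in> cauchy_seqs V N1;
        (\<lambda>n. N2 (\<lambda>w. x n w - y n w)) \<longlonglongrightarrow> 0\<rbrakk> \<Longrightarrow> (\<lambda>n. N1 (\<lambda>w. x n w - y n w)) \<longlonglongrightarrow> 0"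
  shows "completion_included (completion V N1) (completion V N2)"
proof -
  define r where "r N = {(x, y). x \<in> cauchy_seqs V N \<and> y \<in> cauchy_seqs V N \<and>
              (\<lambda>n. N (\<lambda>w. x n w - y n w)) \<longlonglongrightarrow> 0}" for N :: "('a \<Rightarrow> real) \<Rightarrow> real"
  have r_iff: "(x, y) \<in> r N \<longleftrightarrow> x \<in> cauchy_seqs V N \<and> y \<in> cauchy_seqs V N \<and>
              (\<lambda>n. N (\<lambda>w. x n w - y n w)) \<longlonglongrightarrow> 0" for x y N
    by (simp add: r_def)
  have V: "x n \<in> V" if "x \<in> cauchy_seqs V N" for x n N
    using that by (simp add: cauchy_seqs_def)
  have eq: "equiv (cauchy_seqs V N1) (r N1)"
  proof (rule equivI)
    show "r N1 \<subseteq> cauchy_seqs V N1 \<times> cauchy_seqs V N1" by (auto simp: r_def)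
    show "refl_on (cauchy_seqs V N1) (r N1)" by (auto simp: refl_on_def r_iff refl)
    show "Relation.sym (r N1)"
    proof (rule symI)
      fix x y assume "(x, y) \<in> r N1"
      then show "(y, x) \<in> r N1" using sym[of "x _" "y _"] by (simp add: r_iff)
    qed
    show "Relation.trans (r N1)"
    proof (rule transI)
      fix x y z assume "(x, y) \<in> r N1" "(y, z) \<in> r N1"
      then show "(x, z) \<in> r N1" using trans[of x y z] V[of x N1] V[of y N1] V[of z N1] by (simp add: r_iff)
    qed
  qed
  have cauchy: "x \<in> cauchy_seqs V N2" if x: "x \<in> cauchy_seqs V N1" for x
    unfolding cauchy_seqs_def
  proof (intro CollectI conjI allI impI)
    show "x n \<in> V" for n using V[OF x] .
    fix e :: real assume e: "0 < e"
    then have "0 < e / (c + 1)" using c by simp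
    then obtain M where M: "\<And>m n. m \<ge> M \<Longrightarrow> n \<ge> M \<Longrightarrow> N1 (\<lambda>w. x m w - x n w) < e / (c + 1)"
      using x unfolding cauchy_seqs_def by blast
    have "N2 (\<lambda>w. x m w - x n w) < e" if "m \<ge> M" "n \<ge> M" for m n
    proof -
      have "N2 (\<lambda>w. x m w - x n w) \<le> c * N1 (\<lambda>w. x m w - x n w)"
        by (intro dom diff V[OF x])
      also have "\<dots> \<le> c * (e / (c + 1))" using M[OF that] c by (intro mult_left_mono) auto
      also have "\<dots> < e" using c e by (simp add: field_simps)
      finally show ?thesis .
    qed
    then show "\<exists>M. \<forall>m\<ge>M. \<forall>n\<ge>M. N2 (\<lambda>w. x m w - x n w) < e" by blast
  qed
  have sub: "(x, y) \<in> r N2" if "(x, y) \<in> r N1" for x y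
  proof -
    have "(\<lambda>n. N2 (\<lambda>w. x n w - y n w)) \<longlonglongrightarrow> 0"
    proof (rule tendsto_sandwich[OF _ _ tendsto_const])
      show "\<forall>\<^sub>F n in sequentially. N2 (\<lambda>w. x n w - y n w) \<le> c * N1 (\<lambda>w. x n w - y n w)"
        using that by (intro always_eventually allI dom diff) (auto simp: r_iff intro: V)
      show "(\<lambda>n. c * N1 (\<lambda>w. x n w - y n w)) \<longlonglongrightarrow> 0"
        using that tendsto_mult_right_zero by (auto simp: r_iff)
    qed (simp add: nonneg)
    with that show ?thesis by (simp add: r_iff cauchy)
  qed
  define pick where "pick A = (SOME x. x \<in> A)" for A :: "(nat \<Rightarrow> 'a \<Rightarrow> real) set"
  have pick: "pick A \<in> A" if A: "A \<in> cauchy_seqs V N1 // r N1" for A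
    unfolding pick_def using in_quotient_imp_non_empty[OF eq A] by (simp add: some_in_eq)
  have pick_cauchy: "pick A \<in> cauchy_seqs V N1" if "A \<in> cauchy_seqs V N1 // r N1" for A
    using pick[OF that] in_quotient_imp_subset[OF eq that] by blast
  let ?J = "\<lambda>A. r N2 `` {pick A}"
  have "inj_on ?J (cauchy_seqs V N1 // r N1)"
  proof (rule inj_onI)
    fix A A' assume A: "A \<in> cauchy_seqs V N1 // r N1" and A': "A' \<in> cauchy_seqs V N1 // r N1"
      and J: "?J A = ?J A'"
    have "(pick A', pick A') \<in> r N1" using pick_cauchy[OF A'] by (simp add: r_iff refl)
    from sub[OF this] J have "(pick A, pick A') \<in> r N2" by blast
    then have "(\<lambda>n. N1 (\<lambda>w. pick A n w - pick A' n w)) \<longlonglongrightarrow> 0"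
      using compatible[OF pick_cauchy[OF A] pick_cauchy[OF A']] by (simp add: r_iff)
    then have "(pick A, pick A') \<in> r N1"
      using pick_cauchy[OF A] pick_cauchy[OF A'] by (simp add: r_iff)
    then show "A = A'"
      using quotient_eqI[OF eq A A' pick[OF A] pick[OF A']] by simp
  qed
  moreover have "?J A \<in> cauchy_seqs V N2 // r N2 \<and> A \<subseteq> ?J A" if A: "A \<in> cauchy_seqs V N1 // r N1" for A
  proof
    show "?J A \<in> cauchy_seqs V N2 // r N2"
      by (intro quotientI cauchy pick_cauchy A)
    show "A \<subseteq> ?J A"
    proof
      fix y assume "y \<in> A"
      with in_quotient_imp_in_rel[OF eq A, of "pick A" y] pick[OF A] have "(pick A, y) \<in> r N1" by simp
      from sub[OF this] show "y \<in> ?J A" by simp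
    qed
  qed
  ultimately show ?thesis
    unfolding completion_included_def completion_def r_def[symmetric] by blast
qed

text \<open>Takes the place of Minkowski's inequality; the factor \<open>2 powr p\<close> is
  harmless for null and Cauchy sequences.\<close>

lemma abs_add_powr_le:
  fixes a b p :: real
  assumes "0 \<le> p"
  shows "\<bar>a + b\<bar> powr p \<le> 2 powr p * (\<bar>a\<bar> powr p + \<bar>b\<bar> powr p)"
proof -
  have "\<bar>a + b\<bar> powr p \<le> (2 * max \<bar>a\<bar> \<bar>b\<bar>) powr p" using assms by (intro powr_mono2) auto
  also have "\<dots> = 2 powr p * max \<bar>a\<bar> \<bar>b\<bar> powr p" by (simp add: powr_mult)
  also have "\<dots> \<le> 2 powr p * (\<bar>a\<bar> powr p + \<bar>b\<bar> powr p)"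
    by (intro mult_left_mono) (auto simp: max_def)
  finally show ?thesis .
qed

text \<open>
  Truncation at the level \<open>K\<close>: large values of \<open>x\<close> are compared with \<open>y\<close>, whose moments of order
  above \<open>p\<close> are finite, so that convergence of a lower moment upgrades to order \<open>p\<close>.
\<close>

lemma powr_le_truncated:
  fixes x y K a p :: real
  assumes "0 < K" "0 < a" "a < p"
  shows "\<bar>x\<bar> powr p \<le> K powr (p - a) * \<bar>x\<bar> powr a + 2 powr (p + 1) / K * \<bar>y\<bar> powr (p + 1) + 2 powr p * \<bar>x - y\<bar> powr p"
proof -
  have nn: "0 \<le> K powr (p - a) * \<bar>x\<bar> powr a" "0 \<le> 2 powr (p + 1) / K * \<bar>y\<bar> powr (p + 1)"
    "0 \<le> 2 powr p * \<bar>x - y\<bar> powr p" using assms by auto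
  consider "\<bar>x\<bar> \<le> K" | "K < \<bar>x\<bar>" "\<bar>x\<bar> \<le> 2 * \<bar>y\<bar>" | "2 * \<bar>y\<bar> < \<bar>x\<bar>" by linarith
  then show ?thesis
  proof cases
    case 1
    have "\<bar>x\<bar> powr p = \<bar>x\<bar> powr (p - a) * \<bar>x\<bar> powr a" by (simp flip: powr_add)
    also have "\<dots> \<le> K powr (p - a) * \<bar>x\<bar> powr a" using 1 assms by (intro mult_right_mono powr_mono2) auto
    finally show ?thesis using nn by linarith
  next
    case 2
    have "K * \<bar>x\<bar> powr p \<le> \<bar>x\<bar> * \<bar>x\<bar> powr p" using 2 by (intro mult_right_mono) auto
    also have "\<dots> = \<bar>x\<bar> powr (p + 1)" by (simp add: powr_mult_base add.commute)
    also have "\<dots> \<le> (2 * \<bar>y\<bar>) powr (p + 1)" using 2 assms by (intro powr_mono2) auto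
    also have "\<dots> = 2 powr (p + 1) * \<bar>y\<bar> powr (p + 1)" by (simp add: powr_mult)
    finally have "\<bar>x\<bar> powr p \<le> 2 powr (p + 1) / K * \<bar>y\<bar> powr (p + 1)"
      using assms(1) by (simp add: field_simps)
    then show ?thesis using nn by linarith
  next
    case 3
    then have "\<bar>x\<bar> \<le> 2 * \<bar>x - y\<bar>" using abs_triangle_ineq2[of x y] by argo
    then have "\<bar>x\<bar> powr p \<le> (2 * \<bar>x - y\<bar>) powr p" using assms by (intro powr_mono2) auto
    also have "\<dots> = 2 powr p * \<bar>x - y\<bar> powr p" by (simp add: powr_mult)
    finally show ?thesis using nn by linarith
  qed
qed

section \<open>Comparison of the two norms and inclusion of the completions\<close>

context G_represented begin

lemma abs_powr_mem: "X \<in> H0 T \<Longrightarrow> 1 \<le> p \<Longrightarrow> (\<lambda>w. \<bar>X w\<bar> powr p) \<in> H0 T"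
  by (rule H0_comp[OF C_lLip_abs_powr])

lemma moment_nonneg: "X \<in> H0 T \<Longrightarrow> 1 \<le> p \<Longrightarrow> 0 \<le> E (\<lambda>w. \<bar>X w\<bar> powr p)"
  by (intro GE.nonneg abs_powr_mem) auto

lemma norm_G_powr: "X \<in> H0 T \<Longrightarrow> 1 \<le> p \<Longrightarrow> norm_G E p X powr q = E (\<lambda>w. \<bar>X w\<bar> powr p) powr (q / p)"
  by (simp add: norm_G_def powr_powr)

lemma G_evaluation_abs_powr_nonneg:
  assumes "X \<in> H0 T" "1 \<le> a"
  shows "0 \<le> G_evaluation T E \<P> (\<lambda>w. \<bar>X w\<bar> powr a)"
  using E_le_G_evaluation[OF abs_powr_mem[OF assms]] moment_nonneg[OF assms] by simp

lemma norm_eval_powr: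
  assumes "X \<in> H0 T" "1 \<le> a"
  shows "norm_eval T E \<P> a X powr a = G_evaluation T E \<P> (\<lambda>w. \<bar>X w\<bar> powr a)"
  using assms G_evaluation_abs_powr_nonneg[OF assms] by (simp add: norm_eval_def powr_powr)

text \<open>\<open>G_evaluation_le\<close> for the variable \<open>\<bar>X w\<bar> powr a\<close>
  and the exponent \<open>p / a\<close>, whose conjugate exponent is
  \<open>p / (p - a)\<close>.\<close>

lemma norm_eval_powr_le:
  assumes X: "X \<in> H0 T" and a: "1 \<le> a" "a < p"
  shows "norm_eval T E \<P> a X powr a \<le> p / (p - a) * norm_G E p X powr a"
proof -
  have pa: "1 < p / a" using a by simp
  have "G_evaluation T E \<P> (\<lambda>w. \<bar>X w\<bar> powr a)
      \<le> (p / a) / (p / a - 1) * E (\<lambda>w. \<bar>\<bar>X w\<bar> powr a\<bar> powr (p / a)) powr (1 / (p / a))"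
    using abs_powr_mem[OF X a(1)] pa by (intro G_evaluation_le) auto
  also have "(p / a) / (p / a - 1) = p / (p - a)" using a by (simp add: field_simps)
  also have "(\<lambda>w. \<bar>\<bar>X w\<bar> powr a\<bar> powr (p / a)) = (\<lambda>w. \<bar>X w\<bar> powr p)"
    using a by (simp add: powr_powr)
  finally show ?thesis
    using X a by (simp add: norm_eval_powr norm_G_powr)
qed

lemma norm_eval_le:
  assumes "X \<in> H0 T" "1 \<le> a" "a < p"
  shows "norm_eval T E \<P> a X \<le> (p / (p - a)) powr (1 / a) * norm_G E p X"
proof -
  have nn: "0 \<le> norm_eval T E \<P> a X" "0 \<le> norm_G E p X" by (simp_all add: norm_eval_def norm_G_def)
  have "norm_eval T E \<P> a X = (norm_eval T E \<P> a X powr a) powr (1 / a)"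
    using assms nn by (simp add: powr_powr)
  also have "\<dots> \<le> (p / (p - a) * norm_G E p X powr a) powr (1 / a)"
    using norm_eval_powr_le[OF assms] assms by (intro powr_mono2) auto
  also have "\<dots> = (p / (p - a)) powr (1 / a) * norm_G E p X"
    using assms nn by (subst powr_mult) (simp_all add: powr_powr)
  finally show ?thesis .
qed

text \<open>Passing to moments removes the roots, so that subadditivity of \<open>E\<close> can be
  applied directly.\<close>

lemma norm_G_tendsto_0_iff:
  assumes x: "\<And>n. x n \<in> H0 T" and p: "1 \<le> p"
  shows "(\<lambda>n. norm_G E p (x n)) \<longlonglongrightarrow> 0 \<longleftrightarrow> (\<lambda>n. E (\<lambda>w. \<bar>x n w\<bar> powr p)) \<longlonglongrightarrow> 0"
proof
  assume "(\<lambda>n. norm_G E p (x n)) \<longlonglongrightarrow> 0"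
  then have "(\<lambda>n. norm_G E p (x n) powr p) \<longlonglongrightarrow> 0"
    using p by (intro tendsto_zero_powrI[OF _ tendsto_const]) (auto simp: norm_G_def)
  then show "(\<lambda>n. E (\<lambda>w. \<bar>x n w\<bar> powr p)) \<longlonglongrightarrow> 0"
    using norm_G_powr[OF x p, of _ p] moment_nonneg[OF x p] p by simp
next
  assume "(\<lambda>n. E (\<lambda>w. \<bar>x n w\<bar> powr p)) \<longlonglongrightarrow> 0"
  then show "(\<lambda>n. norm_G E p (x n)) \<longlonglongrightarrow> 0"
    unfolding norm_G_def using p moment_nonneg[OF x p]
    by (intro tendsto_zero_powrI[OF _ tendsto_const]) auto
qed

lemma moment_add_le:
  assumes "X \<in> H0 T" "Y \<in> H0 T" "1 \<le> p"
  shows "E (\<lambda>w. \<bar>X w + Y w\<bar> powr p) \<le> 2 powr p * (E (\<lambda>w. \<bar>X w\<bar> powr p) + E (\<lambda>w. \<bar>Y w\<bar> powr p))"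
proof -
  note mem = abs_powr_mem[OF assms(1,3)] abs_powr_mem[OF assms(2,3)]
  have "E (\<lambda>w. \<bar>X w + Y w\<bar> powr p) \<le> E (\<lambda>w. 2 powr p * (\<bar>X w\<bar> powr p + \<bar>Y w\<bar> powr p))"
    using assms mem by (intro GE.mono abs_powr_mem GE.add_mem GE.scale_mem abs_add_powr_le) auto
  also have "\<dots> = 2 powr p * E (\<lambda>w. \<bar>X w\<bar> powr p + \<bar>Y w\<bar> powr p)"
    using mem by (intro GE.scale GE.add_mem) auto
  also have "\<dots> \<le> 2 powr p * (E (\<lambda>w. \<bar>X w\<bar> powr p) + E (\<lambda>w. \<bar>Y w\<bar> powr p))"
    using mem by (intro mult_left_mono GE.subadditive) auto
  finally show ?thesis .
qed

lemma cauchy_seqs_moment: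
  assumes x: "x \<in> cauchy_seqs (H0 T) (norm_G E p)" and p: "1 \<le> p" and e: "0 < e"
  shows "\<exists>M. \<forall>m\<ge>M. \<forall>n\<ge>M. E (\<lambda>w. \<bar>x m w - x n w\<bar> powr p) < e"
proof -
  have V: "x n \<in> H0 T" for n using x by (simp add: cauchy_seqs_def)
  have "0 < e powr (1 / p)" using e by simp
  then obtain M where M: "\<And>m n. m \<ge> M \<Longrightarrow> n \<ge> M \<Longrightarrow> norm_G E p (\<lambda>w. x m w - x n w) < e powr (1 / p)"
    using x unfolding cauchy_seqs_def by blast
  have "E (\<lambda>w. \<bar>x m w - x n w\<bar> powr p) < e" if "m \<ge> M" "n \<ge> M" for m n
  proof (rule ccontr)
    assume "\<not> ?thesis"
    then have "e powr (1 / p) \<le> norm_G E p (\<lambda>w. x m w - x n w)"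
      unfolding norm_G_def using e p by (intro powr_mono2) auto
    with M[OF that] show False by simp
  qed
  then show ?thesis by blast
qed

text \<open>The order of the choices matters: first \<open>N\<close> from the Cauchy property, then
  the level \<open>K\<close> in terms of the moment of order \<open>p + 1\<close> of the fixed
  \<open>d N\<close>, available because \<open>d N\<close> is in \<open>H0 T\<close>, and last
  \<open>n\<close>. Each term of \<open>powr_le_truncated\<close> then contributes less than a third
  of \<open>e\<close>.\<close>

lemma moment_upgrade:
  assumes d: "\<And>n. d n \<in> H0 T" and a: "1 \<le> a" "a < p"
    and cauchy: "\<And>e. 0 < e \<Longrightarrow> \<exists>N. \<forall>m\<ge>N. \<forall>n\<ge>N. E (\<lambda>w. \<bar>d m w - d n w\<bar> powr p) < e"
    and lim: "(\<lambda>n. E (\<lambda>w. \<bar>d n w\<bar> powr a)) \<longlonglongrightarrow> 0"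
  shows "(\<lambda>n. E (\<lambda>w. \<bar>d n w\<bar> powr p)) \<longlonglongrightarrow> 0"
proof (rule LIMSEQ_I)
  fix e :: real assume e: "0 < e"
  have p: "1 \<le> p" "1 \<le> p + 1" using a by auto
  obtain N where N: "\<And>n. n \<ge> N \<Longrightarrow> E (\<lambda>w. \<bar>d n w - d N w\<bar> powr p) < e / 3 / 2 powr p"
    using cauchy[of "e / 3 / 2 powr p"] e by auto
  define L where "L = 2 powr (p + 1) * E (\<lambda>w. \<bar>d N w\<bar> powr (p + 1))"
  have L: "0 \<le> L" using moment_nonneg[OF d p(2)] by (simp add: L_def)
  \<comment> \<open>Chosen so that \<open>L / K < e / 3\<close>; the summand 1 keeps
    \<open>K\<close> positive when \<open>L = 0\<close>.\<close>
  define K where "K = 3 * (L + 1) / e"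
  have K: "0 < K" using L e by (simp add: K_def)
  have LK: "L / K < e / 3"
  proof -
    have "L < K * (e / 3)" using e by (simp add: K_def)
    then show ?thesis using K by (simp add: pos_divide_less_eq mult.commute)
  qed
  have "(\<lambda>n. K powr (p - a) * E (\<lambda>w. \<bar>d n w\<bar> powr a)) \<longlonglongrightarrow> 0"
    using lim by (rule tendsto_mult_right_zero)
  then obtain N' where N': "\<And>n. n \<ge> N' \<Longrightarrow> K powr (p - a) * E (\<lambda>w. \<bar>d n w\<bar> powr a) < e / 3"
    using LIMSEQ_D[of _ 0 "e / 3"] e by fastforce
  have "norm (E (\<lambda>w. \<bar>d n w\<bar> powr p) - 0) < e" if n: "n \<ge> max N N'" for n
  proof -
    note mem = abs_powr_mem[OF d a(1)] abs_powr_mem[OF d p(2)] abs_powr_mem[OF GE.diff_mem[OF d d] p(1)]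
    let ?A = "\<lambda>w. K powr (p - a) * \<bar>d n w\<bar> powr a"
    let ?B = "\<lambda>w. 2 powr (p + 1) / K * \<bar>d N w\<bar> powr (p + 1)"
    let ?C = "\<lambda>w. 2 powr p * \<bar>d n w - d N w\<bar> powr p"
    have ABC: "?A \<in> H0 T" "?B \<in> H0 T" "?C \<in> H0 T" by (intro GE.scale_mem mem)+
    have "E (\<lambda>w. \<bar>d n w\<bar> powr p) \<le> E (\<lambda>w. ?A w + ?B w + ?C w)"
      using K a by (intro GE.mono abs_powr_mem d p GE.add_mem ABC powr_le_truncated) auto
    also have "\<dots> \<le> E (\<lambda>w. ?A w + ?B w) + E ?C" by (intro GE.subadditive GE.add_mem ABC)
    also have "\<dots> \<le> E ?A + E ?B + E ?C" by (intro add_right_mono GE.subadditive ABC)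
    also have "E ?A = K powr (p - a) * E (\<lambda>w. \<bar>d n w\<bar> powr a)" by (intro GE.scale mem) simp
    also have "E ?B = 2 powr (p + 1) / K * E (\<lambda>w. \<bar>d N w\<bar> powr (p + 1))"
      using K by (intro GE.scale mem) simp
    also have "\<dots> = L / K" by (simp add: L_def)
    also have "E ?C = 2 powr p * E (\<lambda>w. \<bar>d n w - d N w\<bar> powr p)" by (intro GE.scale mem) simp
    also have "\<dots> < e / 3"
      using N[of n] n by (simp add: pos_less_divide_eq mult.commute)
    finally have "E (\<lambda>w. \<bar>d n w\<bar> powr p) < K powr (p - a) * E (\<lambda>w. \<bar>d n w\<bar> powr a) + L / K + e / 3" by simp
    moreover have "K powr (p - a) * E (\<lambda>w. \<bar>d n w\<bar> powr a) < e / 3" using N'[of n] n by simp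
    ultimately have "E (\<lambda>w. \<bar>d n w\<bar> powr p) < e" using LK by linarith
    then show ?thesis using moment_nonneg[OF d p(1)] by simp
  qed
  then show "\<exists>N. \<forall>n\<ge>N. norm (E (\<lambda>w. \<bar>d n w\<bar> powr p) - 0) < e" by blast
qed

lemma L_G_included_in_L_eval:
  assumes a: "1 \<le> a" "a < p"
  shows "completion_included (L_G T E p) (L_eval T E \<P> a)"
  unfolding L_G_def L_eval_def
proof (rule completion_includedI)
  have p: "1 \<le> p" using a by simp
  show "norm_eval T E \<P> a X \<le> (p / (p - a)) powr (1 / a) * norm_G E p X" if "X \<in> H0 T" for X
    using that a by (rule norm_eval_le)
  show "norm_G E p (\<lambda>w. 0) = 0" by (simp add: norm_G_def)
  show "norm_G E p (\<lambda>w. x w - y w) = norm_G E p (\<lambda>w. y w - x w)" for x y :: "'d path \<Rightarrow> real"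
    by (simp add: norm_G_def abs_minus_commute)
  show "(\<lambda>n. norm_G E p (\<lambda>w. x n w - z n w)) \<longlonglongrightarrow> 0"
    if mem: "\<And>n. x n \<in> H0 T" "\<And>n. y n \<in> H0 T" "\<And>n. z n \<in> H0 T"
      and lim: "(\<lambda>n. norm_G E p (\<lambda>w. x n w - y n w)) \<longlonglongrightarrow> 0" "(\<lambda>n. norm_G E p (\<lambda>w. y n w - z n w)) \<longlonglongrightarrow> 0"
    for x y z :: "nat \<Rightarrow> 'd path \<Rightarrow> real"
  proof -
    have lim': "(\<lambda>n. E (\<lambda>w. \<bar>x n w - y n w\<bar> powr p)) \<longlonglongrightarrow> 0" "(\<lambda>n. E (\<lambda>w. \<bar>y n w - z n w\<bar> powr p)) \<longlonglongrightarrow> 0"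
      using lim norm_G_tendsto_0_iff[OF GE.diff_mem p] mem by auto
    have "(\<lambda>n. E (\<lambda>w. \<bar>x n w - z n w\<bar> powr p)) \<longlonglongrightarrow> 0"
    proof (rule tendsto_sandwich[OF _ _ tendsto_const])
      show "\<forall>\<^sub>F n in sequentially. 0 \<le> E (\<lambda>w. \<bar>x n w - z n w\<bar> powr p)"
        by (intro always_eventually allI moment_nonneg GE.diff_mem mem p)
      show "\<forall>\<^sub>F n in sequentially. E (\<lambda>w. \<bar>x n w - z n w\<bar> powr p)
          \<le> 2 powr p * (E (\<lambda>w. \<bar>x n w - y n w\<bar> powr p) + E (\<lambda>w. \<bar>y n w - z n w\<bar> powr p))"
      proof (intro always_eventually allI)
        fix n
        show "E (\<lambda>w. \<bar>x n w - z n w\<bar> powr p)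
          \<le> 2 powr p * (E (\<lambda>w. \<bar>x n w - y n w\<bar> powr p) + E (\<lambda>w. \<bar>y n w - z n w\<bar> powr p))"
          using moment_add_le[OF GE.diff_mem[OF mem(1)[of n] mem(2)[of n]] GE.diff_mem[OF mem(2)[of n] mem(3)[of n]] p]
          by simp
      qed
      show "(\<lambda>n. 2 powr p * (E (\<lambda>w. \<bar>x n w - y n w\<bar> powr p) + E (\<lambda>w. \<bar>y n w - z n w\<bar> powr p))) \<longlonglongrightarrow> 0"
        by (intro tendsto_mult_right_zero tendsto_add_zero lim')
    qed
    then show ?thesis using norm_G_tendsto_0_iff[OF GE.diff_mem[OF mem(1,3)] p] by simp
  qed
  \<comment> \<open>Since \<open>E\<close> lies below the evaluation, the difference tends to 0 in
    the moment of order \<open>a\<close>; it is also Cauchy in order \<open>p\<close>, which is what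
    \<open>moment_upgrade\<close> asks for.\<close>
  show "(\<lambda>n. norm_G E p (\<lambda>w. x n w - y n w)) \<longlonglongrightarrow> 0"
    if x: "x \<in> cauchy_seqs (H0 T) (norm_G E p)" and y: "y \<in> cauchy_seqs (H0 T) (norm_G E p)"
      and lim: "(\<lambda>n. norm_eval T E \<P> a (\<lambda>w. x n w - y n w)) \<longlonglongrightarrow> 0" for x y
  proof -
    have mem: "x n \<in> H0 T" "y n \<in> H0 T" for n using x y by (auto simp: cauchy_seqs_def)
    define d where "d n w = x n w - y n w" for n w
    have d: "d n \<in> H0 T" for n unfolding d_def using mem by (intro GE.diff_mem)
    have "(\<lambda>n. E (\<lambda>w. \<bar>d n w\<bar> powr a)) \<longlonglongrightarrow> 0"
    proof (rule tendsto_sandwich[OF _ _ tendsto_const])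
      show "\<forall>\<^sub>F n in sequentially. 0 \<le> E (\<lambda>w. \<bar>d n w\<bar> powr a)"
        by (intro always_eventually allI moment_nonneg d a)
      show "\<forall>\<^sub>F n in sequentially. E (\<lambda>w. \<bar>d n w\<bar> powr a) \<le> norm_eval T E \<P> a (d n) powr a"
        unfolding norm_eval_powr[OF d a(1)]
        by (intro always_eventually allI E_le_G_evaluation abs_powr_mem d a) simp
      show "(\<lambda>n. norm_eval T E \<P> a (d n) powr a) \<longlonglongrightarrow> 0"
        using lim a by (intro tendsto_zero_powrI[OF _ tendsto_const]) (auto simp: d_def[abs_def] norm_eval_def)
    qed
    moreover have "\<exists>N. \<forall>m\<ge>N. \<forall>n\<ge>N. E (\<lambda>w. \<bar>d m w - d n w\<bar> powr p) < e" if e: "0 < e" for e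
    proof -
      define e' where "e' = e / (2 * 2 powr p)"
      have e': "0 < e'" using e by (simp add: e'_def)
      obtain N where N: "\<forall>m\<ge>N. \<forall>n\<ge>N. E (\<lambda>w. \<bar>x m w - x n w\<bar> powr p) < e'"
        using cauchy_seqs_moment[OF x p e'] by blast
      obtain N' where N': "\<forall>m\<ge>N'. \<forall>n\<ge>N'. E (\<lambda>w. \<bar>y n w - y m w\<bar> powr p) < e'"
        using cauchy_seqs_moment[OF y p e'] by blast
      have "E (\<lambda>w. \<bar>d m w - d n w\<bar> powr p) < e" if "m \<ge> max N N'" "n \<ge> max N N'" for m n
      proof -
        have "(\<lambda>w. \<bar>d m w - d n w\<bar> powr p) = (\<lambda>w. \<bar>(x m w - x n w) + (y n w - y m w)\<bar> powr p)"
          by (simp add: d_def algebra_simps)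
        then have "E (\<lambda>w. \<bar>d m w - d n w\<bar> powr p)
           \<le> 2 powr p * (E (\<lambda>w. \<bar>x m w - x n w\<bar> powr p) + E (\<lambda>w. \<bar>y n w - y m w\<bar> powr p))"
          using moment_add_le[OF GE.diff_mem[OF mem(1) mem(1)] GE.diff_mem[OF mem(2) mem(2)] p, of m n n m] by simp
        also have "\<dots> < 2 powr p * (e' + e')"
          using N N' that by (intro mult_strict_left_mono add_strict_mono) auto
        also have "\<dots> = e" by (simp add: e'_def)
        finally show ?thesis .
      qed
      then show ?thesis by blast
    qed
    ultimately have "(\<lambda>n. E (\<lambda>w. \<bar>d n w\<bar> powr p)) \<longlonglongrightarrow> 0"
      using d a by (intro moment_upgrade[of d a p])
    then show ?thesis using norm_G_tendsto_0_iff[OF d p] by (simp add: d_def[abs_def])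
  qed
qed (use GE.diff_mem in \<open>auto simp: norm_eval_def\<close>)

end

theorem theorem3p3:
  fixes T \<alpha> \<delta> :: real
    and G :: "real^'d^'d \<Rightarrow> real"
    and S :: "'w set" and H :: "('w \<Rightarrow> real) set" and E' :: "('w \<Rightarrow> real) \<Rightarrow> real"
    and \<xi>' :: "nat \<Rightarrow> 'w \<Rightarrow> real^'d"
    and E :: "('d path \<Rightarrow> real) \<Rightarrow> real"
    and \<P> :: "'d path measure set"
  assumes "0 < T"
    and "sublinear_expectation S H E'"
    and "iid_G_normal G H E' \<xi>'"
    and "nondegenerate G"
    and "G_expectation T E' \<xi>' E"
    and "represents T \<P> E"
    and "1 \<le> \<alpha>" and "0 < \<delta>"
  shows "completion_included (L_G T E (\<alpha> + \<delta>)) (L_eval T E \<P> \<alpha>) \<and>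
    (\<forall>\<gamma>. 1 < \<gamma> \<and> \<gamma> < (\<alpha> + \<delta>) / \<alpha> \<and> \<gamma> \<le> 2 \<longrightarrow>
      (\<forall>\<xi>\<in>L_ip T.
        norm_eval T E \<P> \<alpha> \<xi> powr \<alpha> \<le>
          \<gamma> / (\<gamma> - 1) *
            (norm_G E (\<alpha> + \<delta>) \<xi> powr \<alpha> +
             14 powr (1 / \<gamma>) * (\<Sum>i. real (Suc i) powr (- (((\<alpha> + \<delta>) / \<alpha>) / \<gamma>))) *
               norm_G E (\<alpha> + \<delta>) \<xi> powr ((\<alpha> + \<delta>) / \<gamma>))))"
proof -
  interpret G_represented T S H E' G \<xi>' E \<P>
    using assms by unfold_locales
  have \<alpha>: "1 \<le> \<alpha>" "\<alpha> < \<alpha> + \<delta>" using assms by auto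
  show ?thesis
  proof (intro conjI allI impI ballI)
    show "completion_included (L_G T E (\<alpha> + \<delta>)) (L_eval T E \<P> \<alpha>)"
      by (rule L_G_included_in_L_eval[OF \<alpha>])
    fix \<gamma> and X :: "'d path \<Rightarrow> real"
    assume \<gamma>: "1 < \<gamma> \<and> \<gamma> < (\<alpha> + \<delta>) / \<alpha> \<and> \<gamma> \<le> 2" and "X \<in> L_ip T"
    then have X: "X \<in> H0 T" using L_ip_subset_H0 by blast
    let ?n = "norm_G E (\<alpha> + \<delta>) X powr \<alpha>"
    let ?c = "\<Sum>i. real (Suc i) powr (- (((\<alpha> + \<delta>) / \<alpha>) / \<gamma>))"
    \<comment> \<open>The exponent \<beta> / \<gamma> exceeds 1, so the series converges;
      \<open>suminf_nonneg\<close> asks for this.\<close>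
    have "1 < (\<alpha> + \<delta>) / \<alpha> / \<gamma>" using \<gamma> by (subst pos_less_divide_eq) auto
    then have "summable (\<lambda>i. real (Suc i) powr (- (((\<alpha> + \<delta>) / \<alpha>) / \<gamma>)))"
      using summable_Suc_iff[of "\<lambda>i. real i powr (- (((\<alpha> + \<delta>) / \<alpha>) / \<gamma>))"]
        summable_real_powr_iff[of "- (((\<alpha> + \<delta>) / \<alpha>) / \<gamma>)"] by simp
    then have c: "0 \<le> ?c" by (intro suminf_nonneg) auto
    have "\<gamma> * \<alpha> < \<alpha> + \<delta>" using \<gamma> \<alpha> by (simp add: pos_less_divide_eq)
    \<comment> \<open>The function q / (q - 1) decreases for q > 1, and \<gamma> < \<beta>; the left
      side is \<beta> / (\<beta> - 1).\<close>
    then have const: "(\<alpha> + \<delta>) / (\<alpha> + \<delta> - \<alpha>) \<le> \<gamma> / (\<gamma> - 1)"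
      using \<gamma> assms by (simp add: field_simps)
    have "norm_eval T E \<P> \<alpha> X powr \<alpha> \<le> (\<alpha> + \<delta>) / (\<alpha> + \<delta> - \<alpha>) * ?n"
      by (rule norm_eval_powr_le[OF X \<alpha>])
    also have "\<dots> \<le> \<gamma> / (\<gamma> - 1) * ?n" using const by (intro mult_right_mono) auto
    also have "\<dots> \<le> \<gamma> / (\<gamma> - 1) * (?n + 14 powr (1 / \<gamma>) * ?c * norm_G E (\<alpha> + \<delta>) X powr ((\<alpha> + \<delta>) / \<gamma>))"
      using \<gamma> c by (intro mult_left_mono) auto
    finally show "norm_eval T E \<P> \<alpha> X powr \<alpha> \<le> \<gamma> / (\<gamma> - 1) *
        (?n + 14 powr (1 / \<gamma>) * ?c * norm_G E (\<alpha> + \<delta>) X powr ((\<alpha> + \<delta>) / \<gamma>))" .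
  qed
qed

end
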